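(* Let $\bar\beta\in(0,\frac19)$ and $\phi\in C^1([0,1])$, and suppose $\phi$ is not a coboundary up to a constant for $T_{\bar\beta}$, i.e. there is no measurable $u:[0,1]\to\mathbb R$ and constant $c$ with $\phi=c+u\circ T_{\bar\beta}-u$ a.e. Then there exists $\epsilon>0$ (with $\bar\beta+\epsilon<\frac19$) such that for every sequence $\beta_1,\beta_2,\dots\in(\bar\beta-\epsilon,\bar\beta+\epsilon)$ there are $C>0$ and $N$ with $\sigma_n^2\ge Cn$ for all $n\ge N$; consequently $S_n/\sigma_n$ converges in distribution (under $m$) to the standard normal law.
   Context: For $0<\gamma<1$ let $T_\gamma(x)=x+2^\gamma x^{1+\gamma}$ on $[0,1/2]$ and $T_\gamma(x)=2x-1$ on $(1/2,1]$. $m$ is Lebesgue measure on $[0,1]$. For a sequence $\beta_k$ write $\mathcal T^n=T_{\beta_n}\circ\cdots\circ T_{\beta_1}$, $\phi_k=\phi-\int\phi\circ\mathcal T^k\,dm$, $S_n=\sum_{k=1}^n\phi_k\circ\mathcal T^k$ and $\sigma_n^2=\int S_n^2\,dm$. *)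

theory Defs
  imports "HOL-Probability.Probability"
begin

definition LSV :: "real \<Rightarrow> real \<Rightarrow> real" where
  "LSV \<gamma> x = (if x \<le> 1/2 then x + 2 powr \<gamma> * x powr (1 + \<gamma>) else 2 * x - 1)"

abbreviation mI :: "real measure" where
  "mI \<equiv> lebesgue_on {0..1}"

text \<open>Sequential composition T_{beta_n} o ... o T_{beta_1}; beta is indexed from 1.\<close>
fun seqT :: "(nat \<Rightarrow> real) \<Rightarrow> nat \<Rightarrow> real \<Rightarrow> real" where
  "seqT \<beta> 0 = id"
| "seqT \<beta> (Suc n) = LSV (\<beta> (Suc n)) \<circ> seqT \<beta> n"

definition Ssum :: "(real \<Rightarrow> real) \<Rightarrow> (nat \<Rightarrow> real) \<Rightarrow> nat \<Rightarrow> real \<Rightarrow> real" where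
  "Ssum \<phi> \<beta> n x =
     (\<Sum>k = 1..n. \<phi> (seqT \<beta> k x) - (\<integral>y. \<phi> (seqT \<beta> k y) \<partial>mI))"

definition sigma2 :: "(real \<Rightarrow> real) \<Rightarrow> (nat \<Rightarrow> real) \<Rightarrow> nat \<Rightarrow> real" where
  "sigma2 \<phi> \<beta> n = (\<integral>x. (Ssum \<phi> \<beta> n x)\<^sup>2 \<partial>mI)"

definition C1_on_unit :: "(real \<Rightarrow> real) \<Rightarrow> bool" where
  "C1_on_unit \<phi> \<longleftrightarrow> (\<exists>\<phi>'. continuous_on {0..1} \<phi>' \<and>
      (\<forall>x\<in>{0..1}. (\<phi> has_real_derivative \<phi>' x) (at x within {0..1})))"

definition coboundary_const :: "(real \<Rightarrow> real) \<Rightarrow> (real \<Rightarrow> real) \<Rightarrow> bool" where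
  "coboundary_const T \<phi> \<longleftrightarrow> (\<exists>u c. u \<in> borel_measurable mI \<and>
      (AE x in mI. \<phi> x = c + u (T x) - u x))"

end

theory Submission
  imports Defs
begin

text \<open>
  Let \<open>\<alpha> < 1/9\<close> bound all exponents. The transfer operators preserve the cone of nonnegative decreasing \<open>f\<close> with
  \<open>f x \<le> a (\<integral> f) x powr -\<alpha>\<close>, and after a fixed time densities in it exceed a constant \<open>c > 0\<close>. Splitting
  off \<open>c\<close> couples two densities; the remainder returns to the cone after \<open>N\<close> steps up to mass \<open>O(N^(-8))\<close>, so
  two compositions of densities approach each other in L1 at rate \<open>n^(-4)\<close>, uniformly in the sequence of exponents.
  The same holds for complex functions whose modulus and variation are dominated by a cone element, in particular
  for the images of 1 under the transfer operators twisted by \<open>exp(i s (\<phi> - m))\<close>; hence characteristic functions of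
  blocks separated by gaps nearly factorize, and Bernstein blocks with Levy's continuity theorem give the central limit
  theorem once the variance grows linearly.

  Covariances are summable uniformly in the sequence, and far from time 0 they are close to those of the stationary
  process of \<open>T\<close> with exponent \<open>\<beta>bar\<close> when all exponents are close to \<open>\<beta>bar\<close>. So the variance grows at
  least like half of the Green--Kubo variance. This is the limit of the squared norms of
  \<open>\<phi> - c + u\<^sub>N - u\<^sub>N \<circ> T\<close> in \<open>L2(h dm)\<close>, where \<open>h\<close> is the invariant density and
  \<open>u\<^sub>N = (\<Sum>k=1..N. P^k ((\<phi> - c) h)) / h\<close> converges in L1; if it vanished, \<open>\<phi>\<close> would be a coboundary up to a
  constant.
\<close>

text \<open>The exponents fit together as follows. Since \<open>9 * al < 1\<close>, the function
  \<open>X ^ 9\<close> is integrable, which makes the mass above level \<open>N\<close> of order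
  N^-8. In time of order N^2 there is room for \<open>N\<close> coupling rounds of about
  \<open>N\<close> steps; the losses of successive rounds are damped by \<open>1 - c\<close> and add
  up to a multiple of one loss, whence the power 4. This power has to beat a growth: a Lipschitz
  phase costs a multiple of its Lipschitz constant at each step, so a twisted density after k steps
  is dominated only with mass 1 + O(k s). With order w^6 blocks, n s of order w^5 and gaps w^3, the
  decoupling error is of order w^11 / w^12.

  The cone refers to the largest exponent only, hence is preserved by all admissible maps at once
  and all constants are uniform in the sequence. The maps of a sequence share no invariant density,
  so stationary covariances are compared over a window of fixed length, where dominated convergence
  applies; memory loss removes what precedes it. Working on the half-open interval keeps the weight
  singular only at an excluded point and lets transfer operators act on genuine functions.\<close>

definition U :: "real measure" where
  "U = restrict_space lborel {0<..1}"

lemma space_U [simp]: "space U = {0<..1}"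
  by (simp add: U_def space_restrict_space)

lemma sets_U: "A \<in> sets U \<longleftrightarrow> A \<in> sets borel \<and> A \<subseteq> {0<..1}"
  by (auto simp: U_def sets_restrict_space_iff)

lemma U_eq_restrict_borel: "borel_measurable U = borel_measurable (restrict_space borel {0<..1::real})"
  by (rule measurable_cong_sets) (auto simp: U_def sets_restrict_space)

lemma nn_integral_U: "(\<integral>\<^sup>+x. f x \<partial>U) = (\<integral>\<^sup>+x. f x * indicator {0<..1} x \<partial>lborel)"
  by (simp add: U_def nn_integral_restrict_space)

lemma integral_U:
  fixes f :: "real \<Rightarrow> 'a::{banach, second_countable_topology}"
  shows "(\<integral>x. f x \<partial>U) = (\<integral>x. indicator {0<..1} x *\<^sub>R f x \<partial>lborel)"
  by (simp add: U_def integral_restrict_space)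

lemma prob_space_U: "prob_space U"
  by (intro prob_spaceI) (simp add: U_def emeasure_restrict_space space_restrict_space)

interpretation U: prob_space U
  by (rule prob_space_U)

lemma borel_measurable_U_I:
  "f \<in> borel_measurable borel \<Longrightarrow> f \<in> borel_measurable U"
  unfolding U_eq_restrict_borel by (rule measurable_restrict_space1)

lemma measurable_U_U_iff:
  "f \<in> U \<rightarrow>\<^sub>M U \<longleftrightarrow> f \<in> borel_measurable U \<and> (\<forall>x\<in>{0<..1}. f x \<in> {0<..1})"
proof -
  have "f \<in> U \<rightarrow>\<^sub>M U \<longleftrightarrow> f \<in> U \<rightarrow>\<^sub>M restrict_space borel {0<..1}"
    by (intro arg_cong[where f = "\<lambda>X. f \<in> X"] measurable_cong_sets) (auto simp: U_def sets_restrict_space)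
  then show ?thesis by (auto simp: measurable_restrict_space2_iff)
qed

text \<open>The densities below are handled as pointwise monotone functions; this is how they, and
  sums of them, become measurable.\<close>

lemma borel_measurable_U_antimono:
  assumes "\<And>x y. 0 < x \<Longrightarrow> x \<le> y \<Longrightarrow> y \<le> 1 \<Longrightarrow> f y \<le> (f x :: real)"
  shows "f \<in> borel_measurable U"
proof -
  have "(\<lambda>x. - f x) \<in> borel_measurable U"
    unfolding U_eq_restrict_borel
    by (rule borel_measurable_mono_on_fnc) (auto simp: mono_on_def intro: assms)
  then have "(\<lambda>x. - (- f x)) \<in> borel_measurable U" by (rule borel_measurable_uminus)
  then show ?thesis by simp
qed

section \<open>The maps and their transfer operators\<close>

text \<open>The derivative of the left branch; on the right branch the derivative is the constant
  2.\<close>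

definition dT :: "real \<Rightarrow> real \<Rightarrow> real" where
  "dT \<gamma> u = 1 + (1 + \<gamma>) * (2 * u) powr \<gamma>"

lemma LSV_left: "0 < u \<Longrightarrow> u \<le> 1/2 \<Longrightarrow> LSV \<gamma> u = u * (1 + (2 * u) powr \<gamma>)"
  by (simp add: LSV_def powr_add powr_mult algebra_simps)

lemma powr_01: "0 < (u::real) \<Longrightarrow> u \<le> 1/2 \<Longrightarrow> 0 < \<gamma> \<Longrightarrow> 0 < (2 * u) powr \<gamma> \<and> (2 * u) powr \<gamma> \<le> 1"
  using powr_mono2[of \<gamma> "2*u" 1] by simp

lemma LSV_in:
  assumes "0 < \<gamma>" "0 < x" "x \<le> 1"
  shows "0 < LSV \<gamma> x" "LSV \<gamma> x \<le> 1"
proof -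
  show "0 < LSV \<gamma> x"
    using assms by (cases "x \<le> 1/2") (auto simp: LSV_left LSV_def add_pos_nonneg)
  show "LSV \<gamma> x \<le> 1"
  proof (cases "x \<le> 1/2")
    case True
    have "x * (1 + (2 * x) powr \<gamma>) \<le> 1/2 * (1 + 1)"
      using assms True powr_01[of x \<gamma>] by (intro mult_mono) auto
    then show ?thesis using assms True by (simp add: LSV_left)
  qed (use assms in \<open>auto simp: LSV_def\<close>)
qed

lemma LSV_measurable [measurable]: "LSV \<gamma> \<in> borel_measurable borel"
  unfolding LSV_def by measurable

lemma LSV_measurable_U: "0 < \<gamma> \<Longrightarrow> LSV \<gamma> \<in> U \<rightarrow>\<^sub>M U"
  by (simp add: measurable_U_U_iff borel_measurable_U_I LSV_in)

lemma LSV_strict_mono_left: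
  assumes "0 < \<gamma>" "0 < u" "u < v" "v \<le> 1/2"
  shows "LSV \<gamma> u < LSV \<gamma> v"
proof -
  have "(2 * u) powr \<gamma> < (2 * v) powr \<gamma>"
    using assms by (intro powr_less_mono2) auto
  then have "u * (1 + (2 * u) powr \<gamma>) < v * (1 + (2 * v) powr \<gamma>)"
    using assms by (intro mult_strict_mono) (auto simp: add_pos_nonneg)
  then show ?thesis using assms by (simp add: LSV_left)
qed

text \<open>The inverse of the left branch has no closed form. By
  \<open>LSV_strict_mono_left\<close> the choice is unique for \<open>0 < x \<le> 1\<close>.\<close>

definition uinv :: "real \<Rightarrow> real \<Rightarrow> real" where
  "uinv \<gamma> x = (SOME u. 0 < u \<and> u \<le> 1/2 \<and> LSV \<gamma> u = x)"

lemma uinv: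
  assumes "0 < \<gamma>" "0 < x" "x \<le> 1"
  shows "0 < uinv \<gamma> x" "uinv \<gamma> x \<le> 1/2" "LSV \<gamma> (uinv \<gamma> x) = x"
proof -
  let ?g = "\<lambda>u::real. u * (1 + (2 * u) powr \<gamma>)"
  \<comment> \<open>Starting at \<open>x/2\<close> instead of 0 keeps the root positive; the branch
    at most doubles its argument, so its value at \<open>x/2\<close> is at most
    \<open>x\<close>.\<close>
  have "continuous_on {x/2..1/2} ?g"
    using assms by (intro continuous_intros) auto
  moreover have "?g (x/2) \<le> x"
    using assms powr_01[of "x/2" \<gamma>] mult_left_mono[of "1 + x powr \<gamma>" 2 "x/2"] by simp
  moreover have "x \<le> ?g (1/2)" using assms by simp
  ultimately obtain u where "x/2 \<le> u" "u \<le> 1/2" "?g u = x"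
    using IVT'[of ?g "x/2" x "1/2"] assms by auto
  then have "0 < u \<and> u \<le> 1/2 \<and> LSV \<gamma> u = x" using assms by (simp add: LSV_left)
  from someI[of "\<lambda>u. 0 < u \<and> u \<le> 1/2 \<and> LSV \<gamma> u = x", OF this]
  show "0 < uinv \<gamma> x" "uinv \<gamma> x \<le> 1/2" "LSV \<gamma> (uinv \<gamma> x) = x"
    by (auto simp: uinv_def)
qed

lemma uinv_LSV:
  assumes "0 < \<gamma>" "0 < u" "u \<le> 1/2"
  shows "uinv \<gamma> (LSV \<gamma> u) = u"
proof -
  have "0 < LSV \<gamma> u" "LSV \<gamma> u \<le> 1" using LSV_in[of \<gamma> u] assms by auto
  note v = uinv[OF assms(1) this]
  show ?thesis
    using LSV_strict_mono_left[of \<gamma> u "uinv \<gamma> (LSV \<gamma> u)"] LSV_strict_mono_left[of \<gamma> "uinv \<gamma> (LSV \<gamma> u)" u] assms v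
    by (smt (verit))
qed

lemma uinv_mono:
  assumes "0 < \<gamma>" "0 < x" "x \<le> y" "y \<le> 1"
  shows "uinv \<gamma> x \<le> uinv \<gamma> y"
  using LSV_strict_mono_left[of \<gamma> "uinv \<gamma> y" "uinv \<gamma> x"] uinv[of \<gamma> x] uinv[of \<gamma> y] assms by force

lemma uinv_eq:
  assumes "0 < \<gamma>" "0 < x" "x \<le> 1"
  shows "x = uinv \<gamma> x * (1 + (2 * uinv \<gamma> x) powr \<gamma>)"
  using uinv[OF assms] LSV_left[of "uinv \<gamma> x" \<gamma>] by simp

lemma uinv_measurable_U:
  assumes "0 < \<gamma>" shows "uinv \<gamma> \<in> U \<rightarrow>\<^sub>M U"
proof -
  have "(\<lambda>x. - uinv \<gamma> x) \<in> borel_measurable U"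
    by (rule borel_measurable_U_antimono) (auto intro: uinv_mono assms)
  then have "(\<lambda>x. - (- uinv \<gamma> x)) \<in> borel_measurable U" by (rule borel_measurable_uminus)
  then show ?thesis using uinv assms by (fastforce simp: measurable_U_U_iff)
qed

lemma rbranch_measurable_U: "(\<lambda>x. (x + 1) / 2) \<in> U \<rightarrow>\<^sub>M U"
  by (simp add: measurable_U_U_iff borel_measurable_U_I)

lemma dT_bounds:
  assumes "0 < \<gamma>" "\<gamma> \<le> 1" "0 < u" "u \<le> 1/2"
  shows "1 < dT \<gamma> u" "dT \<gamma> u \<le> 3"
proof -
  show "1 < dT \<gamma> u" using assms powr_01[of u \<gamma>] by (simp add: dT_def)
  have "(1 + \<gamma>) * (2*u) powr \<gamma> \<le> 2 * 1" using assms powr_01[of u \<gamma>] by (intro mult_mono) auto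
  then show "dT \<gamma> u \<le> 3" by (simp add: dT_def)
qed

lemma dT_mono:
  assumes "0 < \<gamma>" "0 < u" "u \<le> v"
  shows "dT \<gamma> u \<le> dT \<gamma> v"
  using assms by (auto simp: dT_def intro!: mult_left_mono powr_mono2)

lemma dT_measurable [measurable]: "dT \<gamma> \<in> borel_measurable borel"
  unfolding dT_def by measurable

text \<open>The Perron-Frobenius operator with respect to Lebesgue measure. Values in a real vector
  space let it act on real densities and on complex twisted ones alike.\<close>

definition transfer :: "real \<Rightarrow> (real \<Rightarrow> 'a) \<Rightarrow> real \<Rightarrow> 'a::real_vector" where
  "transfer \<gamma> f x = f (uinv \<gamma> x) /\<^sub>R dT \<gamma> (uinv \<gamma> x) + f ((x + 1) / 2) /\<^sub>R 2"

text \<open>The change of variables on one branch, phrased as an identity of measures so that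
  integrability and integrals of arbitrary functions follow together.\<close>

lemma distr_left:
  assumes \<gamma>: "0 < \<gamma>" "\<gamma> \<le> 1"
  shows "distr (density U (\<lambda>x. ennreal (indicator {0<..1/2} x * dT \<gamma> x))) U (LSV \<gamma>) = U"
    (is "distr ?D U _ = U")
proof (rule measure_eqI)
  fix A assume "A \<in> sets (distr ?D U (LSV \<gamma>))"
  then have A: "A \<in> sets U" "A \<in> sets borel" "A \<subseteq> {0<..1}" by (auto simp: sets_U)
  let ?g = "\<lambda>x::real. x + 2 powr \<gamma> * x powr (1 + \<gamma>)"
  let ?h = "\<lambda>x::real. 1 + (1 + \<gamma>) * (2 * x) powr \<gamma>"
  have der: "(?g has_real_derivative ?h x) (at x)" if "x \<in> {0..1/2}" for x
  proof (cases "x = 0")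
    case False
    then have "0 < x" using that by simp
    then show ?thesis
      by (auto intro!: derivative_eq_intros simp: powr_mult)
  next
    case True
    \<comment> \<open>The substitution rule asks for a two-sided derivative at 0, so
      \<open>powr\<close> at negative arguments matters: there \<open>h powr a\<close> equals
      \<open>\<bar>h\<bar> powr a\<close>, which produces the factor \<open>sgn h\<close>.\<close>
    have lim: "((\<lambda>h::real. 2 powr \<gamma> * \<bar>h\<bar> powr \<gamma> * sgn h) \<longlongrightarrow> 0) (at 0)"
    proof (rule tendsto_rabs_zero_cancel)
      have "((\<lambda>h::real. \<bar>h\<bar> powr \<gamma>) \<longlongrightarrow> 0) (at 0)"
        by (rule tendsto_zero_powrI[OF tendsto_rabs_zero tendsto_const]) (auto simp: \<gamma> intro: tendsto_ident_at)
      then have "((\<lambda>h::real. 2 powr \<gamma> * \<bar>h\<bar> powr \<gamma>) \<longlongrightarrow> 0) (at 0)"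
        by (rule tendsto_mult_right_zero)
      then show "((\<lambda>h::real. \<bar>2 powr \<gamma> * \<bar>h\<bar> powr \<gamma> * sgn h\<bar>) \<longlongrightarrow> 0) (at 0)"
        by (rule Lim_transform_eventually) (auto simp: eventually_at_filter abs_mult abs_sgn_eq)
    qed
    have eq: "(?g (0 + h) - ?g 0) / h = 1 + 2 powr \<gamma> * \<bar>h\<bar> powr \<gamma> * sgn h" if "h \<noteq> 0" for h :: real
    proof -
      have "h powr (1 + \<gamma>) = \<bar>h\<bar> * \<bar>h\<bar> powr \<gamma>"
        using powr_mult_base'[of "h" \<gamma>] by (cases "h < 0") (auto simp: powr_def ln_minus)
      then show ?thesis using that by (auto simp: field_simps sgn_if)
    qed
    have "((\<lambda>h. (?g (0 + h) - ?g 0) / h) \<longlongrightarrow> 1 + 0) (at 0)"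
      by (rule Lim_transform_eventually[OF tendsto_add[OF tendsto_const lim]])
         (unfold eventually_at_filter, intro always_eventually allI impI, rule eq[symmetric])
    then show ?thesis using True by (simp add: DERIV_def)
  qed
  have "continuous_on {0..1/2} ?h"
    using \<gamma> by (intro continuous_intros continuous_on_powr') auto
  then have sub: "(\<integral>\<^sup>+x. indicator A x * indicator {?g 0..?g (1/2)} x \<partial>lborel) =
      (\<integral>\<^sup>+x. indicator A (?g x) * ennreal (?h x) * indicator {0..1/2} x \<partial>lborel)"
    using A der \<gamma> by (intro nn_integral_substitution_aux) (auto intro!: add_nonneg_nonneg mult_nonneg_nonneg)
  have g1: "?g (1/2) = 1"
  proof -
    have "2 powr \<gamma> * (1/2) powr (1 + \<gamma>) = (1/2::real)"
      by (simp add: powr_divide powr_add)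
    then show ?thesis by simp
  qed
  have "emeasure (distr ?D U (LSV \<gamma>)) A = emeasure ?D (LSV \<gamma> -` A \<inter> {0<..1})"
    using A by (subst emeasure_distr) (simp_all add: LSV_measurable_U \<gamma>)
  also have "\<dots> = (\<integral>\<^sup>+x. ennreal (indicator {0<..1/2} x * dT \<gamma> x) * indicator (LSV \<gamma> -` A \<inter> {0<..1}) x \<partial>U)"
    using measurable_sets[OF LSV_measurable_U[OF \<gamma>(1)] A(1)]
    by (intro emeasure_density) (auto intro!: borel_measurable_U_I)
  also have "\<dots> = (\<integral>\<^sup>+x. indicator A (?g x) * ennreal (?h x) * indicator {0..1/2} x \<partial>lborel)"
    unfolding nn_integral_U
  proof (intro nn_integral_cong)
    fix x :: real
    have "0 \<notin> A" using A by auto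
    then show "ennreal (indicator {0<..1/2} x * dT \<gamma> x) * indicator (LSV \<gamma> -` A \<inter> {0<..1}) x * indicator {0<..1} x =
        indicator A (?g x) * ennreal (?h x) * indicator {0..1/2} x"
      by (cases "x = 0") (auto split: split_indicator simp: LSV_def dT_def)
  qed
  also have "\<dots> = (\<integral>\<^sup>+x. indicator A x * indicator {0..1} x \<partial>lborel)"
    using sub g1 by simp
  also have "\<dots> = emeasure lborel A"
    using A by (subst nn_integral_indicator[symmetric], simp, intro nn_integral_cong) (auto split: split_indicator)
  also have "\<dots> = emeasure U A" using A by (simp add: U_def emeasure_restrict_space)
  finally show "emeasure (distr ?D U (LSV \<gamma>)) A = emeasure U A" .
qed simp

lemma distr_right:
  assumes \<gamma>: "0 < \<gamma>"
  shows "distr (density U (\<lambda>x. ennreal (indicator {1/2<..1} x * 2))) U (LSV \<gamma>) = U"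
    (is "distr ?D U _ = U")
proof (rule measure_eqI)
  fix A assume "A \<in> sets (distr ?D U (LSV \<gamma>))"
  then have A: "A \<in> sets U" "A \<in> sets borel" "A \<subseteq> {0<..1}" by (auto simp: sets_U)
  let ?g = "\<lambda>x::real. 2 * x - 1"
  have sub: "(\<integral>\<^sup>+x. indicator A x * indicator {?g (1/2)..?g 1} x \<partial>lborel) =
      (\<integral>\<^sup>+x. indicator A (?g x) * ennreal 2 * indicator {1/2..1} x \<partial>lborel)"
    using A by (intro nn_integral_substitution_aux) (auto intro!: derivative_eq_intros)
  have "emeasure (distr ?D U (LSV \<gamma>)) A = emeasure ?D (LSV \<gamma> -` A \<inter> {0<..1})"
    using A by (subst emeasure_distr) (simp_all add: LSV_measurable_U \<gamma>)
  also have "\<dots> = (\<integral>\<^sup>+x. ennreal (indicator {1/2<..1} x * 2) * indicator (LSV \<gamma> -` A \<inter> {0<..1}) x \<partial>U)"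
    using measurable_sets[OF LSV_measurable_U[OF \<gamma>(1)] A(1)]
    by (intro emeasure_density) (auto intro!: borel_measurable_U_I)
  also have "\<dots> = (\<integral>\<^sup>+x. indicator A (?g x) * ennreal 2 * indicator {1/2..1} x \<partial>lborel)"
    unfolding nn_integral_U
  proof (intro nn_integral_cong)
    fix x :: real
    \<comment> \<open>The closed and half-open intervals differ at \<open>1/2\<close>, where the
      affine formula takes the value 0, outside \<open>A\<close>.\<close>
    have "0 \<notin> A" using A by auto
    then show "ennreal (indicator {1/2<..1} x * 2) * indicator (LSV \<gamma> -` A \<inter> {0<..1}) x * indicator {0<..1} x =
        indicator A (?g x) * ennreal 2 * indicator {1/2..1} x"
    proof (cases "x = 1/2")
      case True
      then have "2 * x - 1 = 0" by simp
      then have "indicator A (2 * x - 1) = (0::ennreal)" using \<open>0 \<notin> A\<close> by (metis indicator_simps(2))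
      then show ?thesis unfolding True by (simp add: LSV_def)
    qed (auto split: split_indicator simp: LSV_def)
  qed
  also have "\<dots> = (\<integral>\<^sup>+x. indicator A x * indicator {0..1} x \<partial>lborel)"
    using sub by simp
  also have "\<dots> = emeasure lborel A"
    using A by (subst nn_integral_indicator[symmetric], simp, intro nn_integral_cong) (auto split: split_indicator)
  also have "\<dots> = emeasure U A" using A by (simp add: U_def emeasure_restrict_space)
  finally show "emeasure (distr ?D U (LSV \<gamma>)) A = emeasure U A" .
qed simp

text \<open>The two summands of \<open>transfer\<close> are the contributions \<open>F1\<close> and
  \<open>F2\<close> of the branches, and \<open>distr_left\<close> and \<open>distr_right\<close>
  pull each back to its half of the interval. Integrability is assumed only for the product before
  transfer; \<open>F = 1\<close> yields conservation of mass.\<close>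

lemma transfer_duality:
  fixes f F :: "real \<Rightarrow> 'a::{real_normed_field, banach, second_countable_topology}"
  assumes \<gamma>: "0 < \<gamma>" "\<gamma> \<le> 1" and f: "f \<in> borel_measurable U" and F: "F \<in> borel_measurable U"
    and int: "integrable U (\<lambda>x. F (LSV \<gamma> x) * f x)"
  shows "integrable U (\<lambda>x. F x * transfer \<gamma> f x)"
    and "(\<integral>x. F x * transfer \<gamma> f x \<partial>U) = (\<integral>x. F (LSV \<gamma> x) * f x \<partial>U)"
proof -
  define F1 where "F1 x = F x * (f (uinv \<gamma> x) /\<^sub>R dT \<gamma> (uinv \<gamma> x))" for x
  define F2 where "F2 x = F x * (f ((x+1)/2) /\<^sub>R 2)" for x
  note [measurable] = f F uinv_measurable_U[OF \<gamma>(1)] rbranch_measurable_U LSV_measurable_U[OF \<gamma>(1)]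
  have [measurable]: "(\<lambda>x. f (uinv \<gamma> x)) \<in> borel_measurable U" "(\<lambda>x. f ((x + 1)/2)) \<in> borel_measurable U"
    by (rule measurable_compose[OF _ f], measurable)+
  have [measurable]: "(\<lambda>x. dT \<gamma> (uinv \<gamma> x)) \<in> borel_measurable U"
    by (rule measurable_compose[OF _ borel_measurable_U_I[OF dT_measurable]], measurable)
  have [measurable]: "F1 \<in> borel_measurable U" unfolding F1_def by measurable
  have [measurable]: "F2 \<in> borel_measurable U" unfolding F2_def by measurable
  have [measurable]: "(\<lambda>x. F1 (LSV \<gamma> x)) \<in> borel_measurable U" "(\<lambda>x. F2 (LSV \<gamma> x)) \<in> borel_measurable U"
    by (rule measurable_compose[OF LSV_measurable_U[OF \<gamma>(1)]], measurable)+
  have [measurable]: "(\<lambda>x. x) \<in> borel_measurable U" by (rule borel_measurable_U_I) measurable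
  have [measurable]: "dT \<gamma> \<in> borel_measurable U" by (rule borel_measurable_U_I) measurable
  have [measurable]: "(indicator {0<..1/2} :: real \<Rightarrow> real) \<in> borel_measurable U" "(indicator {1/2<..1} :: real \<Rightarrow> real) \<in> borel_measurable U"
    by (intro borel_measurable_U_I, measurable)+
  let ?L = "{0<..1/2::real}" and ?R = "{1/2<..1::real}"
  have dT0: "0 \<le> dT \<gamma> x" for x by (simp add: dT_def \<gamma> add_nonneg_nonneg less_imp_le)
  have e1: "(indicator ?L x * dT \<gamma> x) *\<^sub>R F1 (LSV \<gamma> x) = indicator ?L x *\<^sub>R (F (LSV \<gamma> x) * f x)" if "x \<in> {0<..1}" for x
    using that dT_bounds[of \<gamma> x] \<gamma> by (auto simp: F1_def uinv_LSV split: split_indicator)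
  have e2: "(indicator ?R x * 2) *\<^sub>R F2 (LSV \<gamma> x) = indicator ?R x *\<^sub>R (F (LSV \<gamma> x) * f x)" if "x \<in> {0<..1}" for x
    using that by (auto simp: F2_def LSV_def split: split_indicator)
  have iL: "integrable U (\<lambda>x. indicator ?L x *\<^sub>R (F (LSV \<gamma> x) * f x))"
    by (rule Bochner_Integration.integrable_bound[OF int]) (auto split: split_indicator intro!: AE_I2
      borel_measurable_scaleR borel_measurable_integrable[OF int])
  have iR: "integrable U (\<lambda>x. indicator ?R x *\<^sub>R (F (LSV \<gamma> x) * f x))"
    by (rule Bochner_Integration.integrable_bound[OF int]) (auto split: split_indicator intro!: AE_I2
      borel_measurable_scaleR borel_measurable_integrable[OF int])
  have i1: "integrable U F1"
  proof -
    have "integrable (distr (density U (\<lambda>x. ennreal (indicator ?L x * dT \<gamma> x))) U (LSV \<gamma>)) F1"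
      apply (subst integrable_distr_eq, measurable)
      apply (subst integrable_density)
         apply measurable
        apply (simp add: dT0)
       apply (rule Bochner_Integration.integrable_cong[THEN iffD1, OF refl _ iL])
      apply (simp add: e1)
      done
    then show ?thesis by (simp add: distr_left[OF \<gamma>])
  qed
  have i2: "integrable U F2"
  proof -
    have "integrable (distr (density U (\<lambda>x. ennreal (indicator ?R x * 2))) U (LSV \<gamma>)) F2"
      apply (subst integrable_distr_eq, measurable)
      apply (subst integrable_density)
         apply measurable
      apply (rule Bochner_Integration.integrable_cong[THEN iffD1, OF refl _ iR])
      apply (simp add: e2)
      done
    then show ?thesis by (simp add: distr_right[OF \<gamma>(1)])
  qed
  have v1: "(\<integral>x. F1 x \<partial>U) = (\<integral>x. indicator ?L x *\<^sub>R (F (LSV \<gamma> x) * f x) \<partial>U)"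
  proof -
    have "(\<integral>x. F1 x \<partial>U) = (\<integral>x. F1 x \<partial>distr (density U (\<lambda>x. ennreal (indicator ?L x * dT \<gamma> x))) U (LSV \<gamma>))"
      by (simp add: distr_left[OF \<gamma>])
    also have "\<dots> = (\<integral>x. (indicator ?L x * dT \<gamma> x) *\<^sub>R F1 (LSV \<gamma> x) \<partial>U)"
      by (subst integral_distr, measurable) (subst integral_density, auto simp: dT0)
    also have "\<dots> = (\<integral>x. indicator ?L x *\<^sub>R (F (LSV \<gamma> x) * f x) \<partial>U)"
      by (rule Bochner_Integration.integral_cong) (use e1 in auto)
    finally show ?thesis .
  qed
  have v2: "(\<integral>x. F2 x \<partial>U) = (\<integral>x. indicator ?R x *\<^sub>R (F (LSV \<gamma> x) * f x) \<partial>U)"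
  proof -
    have "(\<integral>x. F2 x \<partial>U) = (\<integral>x. F2 x \<partial>distr (density U (\<lambda>x. ennreal (indicator ?R x * 2))) U (LSV \<gamma>))"
      by (simp add: distr_right[OF \<gamma>(1)])
    also have "\<dots> = (\<integral>x. (indicator ?R x * 2) *\<^sub>R F2 (LSV \<gamma> x) \<partial>U)"
      by (subst integral_distr, measurable) (subst integral_density, auto)
    also have "\<dots> = (\<integral>x. indicator ?R x *\<^sub>R (F (LSV \<gamma> x) * f x) \<partial>U)"
      by (rule Bochner_Integration.integral_cong) (use e2 in auto)
    finally show ?thesis .
  qed
  have eq: "(\<lambda>x. F x * transfer \<gamma> f x) = (\<lambda>x. F1 x + F2 x)"
    by (auto simp: F1_def F2_def transfer_def algebra_simps)
  show "integrable U (\<lambda>x. F x * transfer \<gamma> f x)"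
    unfolding eq using i1 i2 by simp
  have "(\<integral>x. F x * transfer \<gamma> f x \<partial>U) = (\<integral>x. indicator ?L x *\<^sub>R (F (LSV \<gamma> x) * f x) + indicator ?R x *\<^sub>R (F (LSV \<gamma> x) * f x) \<partial>U)"
    unfolding eq using i1 i2 iL iR by (simp add: v1 v2)
  also have "\<dots> = (\<integral>x. F (LSV \<gamma> x) * f x \<partial>U)"
    by (rule Bochner_Integration.integral_cong) (auto split: split_indicator)
  finally show "(\<integral>x. F x * transfer \<gamma> f x \<partial>U) = (\<integral>x. F (LSV \<gamma> x) * f x \<partial>U)" .
qed

lemma transfer_add: "transfer \<gamma> (\<lambda>x. f x + g x) = (\<lambda>x. transfer \<gamma> f x + transfer \<gamma> g x)"
  by (auto simp: transfer_def algebra_simps)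

lemma transfer_diff: "transfer \<gamma> (\<lambda>x. f x - g x) = (\<lambda>x. transfer \<gamma> f x - transfer \<gamma> g x)"
  by (auto simp: transfer_def algebra_simps)

lemma transfer_mult: "transfer \<gamma> (\<lambda>x. c * f x) = (\<lambda>x. c * transfer \<gamma> f x)"
  for f :: "real \<Rightarrow> 'a::real_algebra"
  by (auto simp: transfer_def algebra_simps)

lemma transfer_real:
  fixes f :: "real \<Rightarrow> real"
  shows "transfer \<gamma> f x = f (uinv \<gamma> x) / dT \<gamma> (uinv \<gamma> x) + f ((x + 1) / 2) / 2"
  by (simp only: transfer_def real_scaleR_def divide_inverse mult.commute)

lemma transfer_Re: "Re (transfer \<gamma> f x) = transfer \<gamma> (\<lambda>x. Re (f x)) x"
  and transfer_Im: "Im (transfer \<gamma> f x) = transfer \<gamma> (\<lambda>x. Im (f x)) x"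
  by (auto simp: transfer_def)

lemma transfer_of_real: "transfer \<gamma> (\<lambda>x. of_real (f x)) x = (of_real (transfer \<gamma> f x) :: complex)"
  by (simp add: transfer_def scaleR_conv_of_real)

lemma transfer_integrable:
  fixes f :: "real \<Rightarrow> 'a::{real_normed_field, banach, second_countable_topology}"
  assumes "0 < \<gamma>" "\<gamma> \<le> 1" "integrable U f"
  shows "integrable U (transfer \<gamma> f)" "(\<integral>x. transfer \<gamma> f x \<partial>U) = (\<integral>x. f x \<partial>U)"
  using transfer_duality[of \<gamma> f "\<lambda>_. 1"] assms by auto

lemma dT_nonneg: "0 < \<gamma> \<Longrightarrow> 0 \<le> dT \<gamma> u"
  by (simp add: dT_def)

lemma transfer_mono:
  fixes f g :: "real \<Rightarrow> real"
  assumes "0 < \<gamma>" "\<And>x. 0 < x \<Longrightarrow> x \<le> 1 \<Longrightarrow> f x \<le> g x" "0 < x" "x \<le> 1"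
  shows "transfer \<gamma> f x \<le> transfer \<gamma> g x"
  using assms uinv[of \<gamma> x] dT_nonneg[of \<gamma> "uinv \<gamma> x"]
  by (auto simp: transfer_def intro!: add_mono mult_left_mono)

lemma transfer_nonneg:
  fixes f :: "real \<Rightarrow> real"
  assumes "0 < \<gamma>" "\<And>x. 0 < x \<Longrightarrow> x \<le> 1 \<Longrightarrow> 0 \<le> f x" "0 < x" "x \<le> 1"
  shows "0 \<le> transfer \<gamma> f x"
  using transfer_mono[of \<gamma> "\<lambda>_. 0" f x] assms by (simp add: transfer_def)

lemma transfer_norm:
  fixes f :: "real \<Rightarrow> 'a::real_normed_vector"
  assumes "0 < \<gamma>"
  shows "norm (transfer \<gamma> f x) \<le> transfer \<gamma> (\<lambda>x. norm (f x)) x"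
  using dT_nonneg[OF assms, of "uinv \<gamma> x"] unfolding transfer_def
  by (intro order.trans[OF norm_triangle_ineq]) simp

lemma transfer_L1:
  fixes f :: "real \<Rightarrow> 'a::{real_normed_field, banach, second_countable_topology}"
  assumes "0 < \<gamma>" "\<gamma> \<le> 1" "integrable U f"
  shows "(\<integral>x. norm (transfer \<gamma> f x) \<partial>U) \<le> (\<integral>x. norm (f x) \<partial>U)"
proof -
  note i = transfer_integrable[OF assms] transfer_integrable[OF assms(1,2) integrable_norm[OF assms(3)]]
  have "(\<integral>x. norm (transfer \<gamma> f x) \<partial>U) \<le> (\<integral>x. transfer \<gamma> (\<lambda>x. norm (f x)) x \<partial>U)"
    by (rule integral_mono) (use i transfer_norm[OF assms(1)] in auto)
  then show ?thesis using i by simp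
qed

text \<open>A larger point has a larger left preimage, where \<open>f\<close> is smaller and the
  derivative larger. Nonnegativity of \<open>f\<close> is what allows the quotients to be
  compared.\<close>

lemma transfer_antimono:
  fixes f :: "real \<Rightarrow> real"
  assumes \<gamma>: "0 < \<gamma>" "\<gamma> \<le> 1"
    and f0: "\<And>x. 0 < x \<Longrightarrow> x \<le> 1 \<Longrightarrow> 0 \<le> f x"
    and f: "\<And>x y. 0 < x \<Longrightarrow> x \<le> y \<Longrightarrow> y \<le> 1 \<Longrightarrow> f y \<le> f x"
    and xy: "0 < x" "x \<le> y" "y \<le> 1"
  shows "transfer \<gamma> f y \<le> transfer \<gamma> f x"
proof -
  have u: "0 < uinv \<gamma> x" "uinv \<gamma> x \<le> uinv \<gamma> y" "uinv \<gamma> y \<le> 1/2"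
    using uinv[of \<gamma> x] uinv[of \<gamma> y] uinv_mono[of \<gamma> x y] \<gamma> xy by auto
  have "1 < dT \<gamma> (uinv \<gamma> x)" using dT_bounds[of \<gamma> "uinv \<gamma> x"] u \<gamma> by auto
  moreover have "dT \<gamma> (uinv \<gamma> x) \<le> dT \<gamma> (uinv \<gamma> y)" using dT_mono u \<gamma> by auto
  ultimately have "f (uinv \<gamma> y) / dT \<gamma> (uinv \<gamma> y) \<le> f (uinv \<gamma> x) / dT \<gamma> (uinv \<gamma> x)"
    using u by (intro frac_le f f0) auto
  moreover have "f ((y + 1)/2) \<le> f ((x + 1)/2)" using xy by (intro f) auto
  ultimately show ?thesis unfolding transfer_real by linarith
qed

section \<open>Compositions of transfer operators along a sequence of exponents\<close>

fun PP :: "(nat \<Rightarrow> real) \<Rightarrow> nat \<Rightarrow> (real \<Rightarrow> 'a::real_vector) \<Rightarrow> real \<Rightarrow> 'a" where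
  "PP \<beta> 0 f = f"
| "PP \<beta> (Suc n) f = transfer (\<beta> (Suc n)) (PP \<beta> n f)"

text \<open>The sequence as seen after \<open>m\<close> steps: its entry at 1 is the exponent of
  step \<open>m + 1\<close>, in agreement with indexing from 1.\<close>

definition sh :: "nat \<Rightarrow> (nat \<Rightarrow> real) \<Rightarrow> nat \<Rightarrow> real" where
  "sh m \<beta> k = \<beta> (m + k)"

lemma PP_plus: "PP \<beta> (m + n) f = PP (sh m \<beta>) n (PP \<beta> m f)"
  by (induction n) (auto simp: sh_def)

lemma seqT_plus: "seqT \<beta> (m + n) x = seqT (sh m \<beta>) n (seqT \<beta> m x)"
  by (induction n) (auto simp: sh_def)

lemma PP_add: "PP \<beta> n (\<lambda>x. f x + g x) = (\<lambda>x. PP \<beta> n f x + PP \<beta> n g x)"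
  by (induction n) (auto simp: transfer_add)

lemma PP_diff: "PP \<beta> n (\<lambda>x. f x - g x) = (\<lambda>x. PP \<beta> n f x - PP \<beta> n g x)"
  by (induction n) (auto simp: transfer_diff)

lemma PP_mult: "PP \<beta> n (\<lambda>x. c * f x) = (\<lambda>x. c * PP \<beta> n f x)"
  for f :: "real \<Rightarrow> 'a::real_algebra"
  by (induction n) (auto simp: transfer_mult)

lemma PP_Re: "Re (PP \<beta> n f x) = PP \<beta> n (\<lambda>x. Re (f x)) x"
  and PP_Im: "Im (PP \<beta> n f x) = PP \<beta> n (\<lambda>x. Im (f x)) x"
proof -
  have "(\<lambda>x. Re (PP \<beta> n f x)) = PP \<beta> n (\<lambda>x. Re (f x))"
    by (induction n) (auto simp: transfer_Re)
  then show "Re (PP \<beta> n f x) = PP \<beta> n (\<lambda>x. Re (f x)) x" by metis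
  have "(\<lambda>x. Im (PP \<beta> n f x)) = PP \<beta> n (\<lambda>x. Im (f x))"
    by (induction n) (auto simp: transfer_Im)
  then show "Im (PP \<beta> n f x) = PP \<beta> n (\<lambda>x. Im (f x)) x" by metis
qed

lemma powr_integral_U:
  assumes "p < (1::real)"
  shows "integrable U (\<lambda>x. x powr - p)" "(\<integral>x. x powr - p \<partial>U) = 1 / (1 - p)"
proof -
  have h: "((\<lambda>x. x powr - p) has_integral (1 / (1 - p))) {0..1::real}"
    using has_integral_powr_from_0[of "-p" 1] assms by simp
  have n: "(\<integral>\<^sup>+x. ennreal (indicator {0..1} x * x powr - p) \<partial>lborel) = ennreal (1 / (1 - p))"
    by (rule nn_integral_has_integral_lebesgue[OF _ h]) auto
  have n': "(\<integral>\<^sup>+x. ennreal (x powr - p) \<partial>U) = ennreal (1 / (1 - p))"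
    unfolding nn_integral_U n[symmetric]
    by (intro nn_integral_cong) (auto split: split_indicator)
  have m: "(\<lambda>x. x powr - p) \<in> borel_measurable U" by (rule borel_measurable_U_I) measurable
  show "integrable U (\<lambda>x. x powr - p)"
    by (rule integrableI_nonneg) (auto simp: n' m)
  show "(\<integral>x. x powr - p \<partial>U) = 1 / (1 - p)"
    using assms by (subst integral_eq_nn_integral) (auto simp: n' m)
qed

section \<open>The cone of densities and memory loss\<close>

locale lsv =
  fixes al :: real
  assumes al: "0 < al" "al < 1/9"
begin

definition adm :: "(nat \<Rightarrow> real) \<Rightarrow> bool" where
  "adm \<beta> \<longleftrightarrow> (\<forall>k\<ge>1. 0 < \<beta> k \<and> \<beta> k \<le> al)"

lemma admD: "adm \<beta> \<Longrightarrow> 0 < \<beta> (Suc k)" "adm \<beta> \<Longrightarrow> \<beta> (Suc k) \<le> al" "adm \<beta> \<Longrightarrow> \<beta> (Suc k) \<le> 1"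
  using al by (auto simp: adm_def dest: spec[of _ "Suc k"])

lemma adm_sh: "adm \<beta> \<Longrightarrow> adm (sh m \<beta>)"
  by (auto simp: adm_def sh_def)

lemma PP_integrable:
  fixes f :: "real \<Rightarrow> 'a::{real_normed_field, banach, second_countable_topology}"
  assumes "adm \<beta>" "integrable U f"
  shows "integrable U (PP \<beta> n f)" "(\<integral>x. PP \<beta> n f x \<partial>U) = (\<integral>x. f x \<partial>U)"
proof -
  have "integrable U (PP \<beta> n f) \<and> (\<integral>x. PP \<beta> n f x \<partial>U) = (\<integral>x. f x \<partial>U)"
    by (induction n) (auto simp: assms transfer_integrable admD)
  then show "integrable U (PP \<beta> n f)" "(\<integral>x. PP \<beta> n f x \<partial>U) = (\<integral>x. f x \<partial>U)" by auto
qed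

lemma PP_L1:
  fixes f :: "real \<Rightarrow> 'a::{real_normed_field, banach, second_countable_topology}"
  assumes "adm \<beta>" "integrable U f"
  shows "(\<integral>x. norm (PP \<beta> n f x) \<partial>U) \<le> (\<integral>x. norm (f x) \<partial>U)"
proof (induction n)
  case (Suc n)
  have "(\<integral>x. norm (PP \<beta> (Suc n) f x) \<partial>U) \<le> (\<integral>x. norm (PP \<beta> n f x) \<partial>U)"
    using assms PP_integrable[OF assms, of n] by (simp add: transfer_L1 admD)
  with Suc show ?case by simp
qed simp

lemma PP_nonneg:
  fixes f :: "real \<Rightarrow> real"
  assumes "adm \<beta>" "\<And>x. 0 < x \<Longrightarrow> x \<le> 1 \<Longrightarrow> 0 \<le> f x" "0 < x" "x \<le> 1"
  shows "0 \<le> PP \<beta> n f x"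
  using assms(3,4) by (induction n arbitrary: x) (auto simp: assms transfer_nonneg admD)

lemma PP_norm:
  fixes f :: "real \<Rightarrow> 'a::real_normed_vector"
  assumes "adm \<beta>" "0 < x" "x \<le> 1"
  shows "norm (PP \<beta> n f x) \<le> PP \<beta> n (\<lambda>x. norm (f x)) x"
  using assms(2,3)
proof (induction n arbitrary: x)
  case (Suc n)
  have "norm (PP \<beta> (Suc n) f x) \<le> transfer (\<beta> (Suc n)) (\<lambda>x. norm (PP \<beta> n f x)) x"
    using assms by (simp add: transfer_norm admD)
  also have "\<dots> \<le> PP \<beta> (Suc n) (\<lambda>x. norm (f x)) x"
    using Suc assms by (auto simp: admD intro!: transfer_mono)
  finally show ?case .
qed simp

lemma PP_antimono:
  fixes f :: "real \<Rightarrow> real"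
  assumes "adm \<beta>"
    and "\<And>x. 0 < x \<Longrightarrow> x \<le> 1 \<Longrightarrow> 0 \<le> f x"
    and "\<And>x y. 0 < x \<Longrightarrow> x \<le> y \<Longrightarrow> y \<le> 1 \<Longrightarrow> f y \<le> f x"
    and "0 < x" "x \<le> y" "y \<le> 1"
  shows "PP \<beta> n f y \<le> PP \<beta> n f x"
  using assms(4-)
proof (induction n arbitrary: x y)
  case (Suc n)
  show ?case unfolding PP.simps
    by (rule transfer_antimono) (use Suc assms admD PP_nonneg[OF assms(1,2)] in auto)
qed (use assms in auto)

lemma seqT_in:
  assumes "adm \<beta>" "0 < x" "x \<le> 1"
  shows "0 < seqT \<beta> n x \<and> seqT \<beta> n x \<le> 1"
  using assms by (induction n) (auto simp: admD LSV_in)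

lemma seqT_measurable:
  assumes "adm \<beta>"
  shows "seqT \<beta> n \<in> U \<rightarrow>\<^sub>M U"
proof (induction n)
  case (Suc n)
  show ?case unfolding seqT.simps by (rule measurable_comp[OF Suc LSV_measurable_U[OF admD(1)[OF assms]]])
qed (simp add: id_def)

lemma seqT_borel: "seqT \<beta> n \<in> borel_measurable borel"
proof (induction n)
  case (Suc n)
  then show ?case using measurable_comp[OF Suc LSV_measurable] by simp
qed (simp add: id_def)

text \<open>Induction with \<open>F\<close> generalised: the last map moves from the operator into
  the test function, which stays bounded because the map preserves the half-open interval.\<close>

lemma PP_duality:
  fixes f F :: "real \<Rightarrow> 'a::{real_normed_field, banach, second_countable_topology}"
  assumes \<beta>: "adm \<beta>" and f: "integrable U f" and F: "F \<in> borel_measurable U"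
    and bd: "\<And>x. 0 < x \<Longrightarrow> x \<le> 1 \<Longrightarrow> norm (F x) \<le> B"
  shows "integrable U (\<lambda>x. F (seqT \<beta> n x) * f x)" "integrable U (\<lambda>x. F x * PP \<beta> n f x)"
    "(\<integral>x. F x * PP \<beta> n f x \<partial>U) = (\<integral>x. F (seqT \<beta> n x) * f x \<partial>U)"
proof -
  have *: "integrable U (\<lambda>x. F (seqT \<beta> n x) * f x) \<and> integrable U (\<lambda>x. F x * PP \<beta> n f x) \<and>
    (\<integral>x. F x * PP \<beta> n f x \<partial>U) = (\<integral>x. F (seqT \<beta> n x) * f x \<partial>U)"
    using F bd
  proof (induction n arbitrary: F)
    case 0
    have "integrable U (\<lambda>x. F x * f x)"
      by (rule Bochner_Integration.integrable_bound[OF integrable_mult_right[OF f, of "of_real B"]])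
         (use 0 f in \<open>auto simp: norm_mult intro!: borel_measurable_times AE_I2 mult_right_mono intro: order.trans[OF _ abs_ge_self]\<close>)
    then show ?case by simp
  next
    case (Suc n)
    have T: "LSV (\<beta> (Suc n)) \<in> U \<rightarrow>\<^sub>M U" using \<beta> by (intro LSV_measurable_U admD)
    have FT: "(\<lambda>x. F (LSV (\<beta> (Suc n)) x)) \<in> borel_measurable U" using measurable_compose[OF T Suc(2)] .
    have bd': "norm (F (LSV (\<beta> (Suc n)) x)) \<le> B" if "0 < x" "x \<le> 1" for x
      by (rule Suc(3)) (use that LSV_in[of "\<beta> (Suc n)"] admD[OF \<beta>] in auto)
    have IH: "integrable U (\<lambda>x. F (LSV (\<beta> (Suc n)) (seqT \<beta> n x)) * f x)"
      "integrable U (\<lambda>x. F (LSV (\<beta> (Suc n)) x) * PP \<beta> n f x)"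
      "(\<integral>x. F (LSV (\<beta> (Suc n)) x) * PP \<beta> n f x \<partial>U) = (\<integral>x. F (LSV (\<beta> (Suc n)) (seqT \<beta> n x)) * f x \<partial>U)"
      using Suc(1)[OF FT bd'] by blast+
    have "PP \<beta> n f \<in> borel_measurable U" by (rule borel_measurable_integrable[OF PP_integrable(1)[OF \<beta> f]])
    note D = transfer_duality[OF admD(1)[OF \<beta>] admD(3)[OF \<beta>] this Suc(2) IH(2)]
    show ?case using IH(1) D(1) D(2)[unfolded IH(3)] by simp
  qed
  then show "integrable U (\<lambda>x. F (seqT \<beta> n x) * f x)" "integrable U (\<lambda>x. F x * PP \<beta> n f x)"
    "(\<integral>x. F x * PP \<beta> n f x \<partial>U) = (\<integral>x. F (seqT \<beta> n x) * f x \<partial>U)" by blast+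
qed

end

section \<open>Invariance of the cone, return to it, and lower bounds\<close>

context lsv
begin

abbreviation X :: "real \<Rightarrow> real" where "X x \<equiv> x powr - al"

lemma X_ge_1: "0 < x \<Longrightarrow> x \<le> 1 \<Longrightarrow> 1 \<le> X x"
  using powr_mono2'[of "-al" x 1] al by simp

lemma X_antimono: "0 < x \<Longrightarrow> x \<le> y \<Longrightarrow> X y \<le> X x"
  using powr_mono2'[of "-al" x y] al by simp

lemma X_integral: "integrable U X" "1 \<le> (\<integral>x. X x \<partial>U)" "(\<integral>x. X x \<partial>U) \<le> 2"
proof -
  have "1 \<le> 1 / (1 - al)" "1 / (1 - al) \<le> 2" using al by (auto simp: pos_le_divide_eq pos_divide_le_eq)
  then show "integrable U X" "1 \<le> (\<integral>x. X x \<partial>U)" "(\<integral>x. X x \<partial>U) \<le> 2"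
    using powr_integral_U[of al] al by auto
qed

text \<open>\<open>\<xi>\<close> is the relative displacement at the left preimage \<open>u\<close>.
  It satisfies \<open>x powr al \<le> (2 * u) powr al \<le> \<xi>\<close>, so any gain proportional
  to \<open>\<xi>\<close> is worth a constant once multiplied by \<open>X x\<close>. The growth
  \<open>X u \<le> X x * (1 + al * \<xi>)\<close> is Bernoulli's inequality for
  \<open>(1 + \<xi>) powr al\<close>, here obtained from Young's inequality with second factor
  1.\<close>

lemma left_branch_facts:
  assumes "0 < \<gamma>" "\<gamma> \<le> al" "0 < x" "x \<le> 1"
  obtains u \<xi> where "u = uinv \<gamma> x" "0 < u" "u \<le> 1/2" "u \<le> x" "0 < \<xi>" "\<xi> \<le> 1" "dT \<gamma> u = 1 + (1 + \<gamma>) * \<xi>"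
    "1 \<le> X x * \<xi>" "X x \<le> X u" "X u \<le> X x * (1 + al * \<xi>)" "\<xi> = (2 * u) powr \<gamma>" "x = u * (1 + \<xi>)"
proof -
  define u where "u = uinv \<gamma> x"
  define \<xi> where "\<xi> = (2 * u) powr \<gamma>"
  have u: "0 < u" "u \<le> 1/2" using uinv[of \<gamma> x] assms by (auto simp: u_def)
  have x: "x = u * (1 + \<xi>)" using uinv_eq[of \<gamma> x] assms by (auto simp: u_def \<xi>_def)
  have \<xi>: "0 < \<xi>" "\<xi> \<le> 1" using powr_01[of u \<gamma>] u assms by (auto simp: \<xi>_def)
  have ux: "u \<le> x" "x \<le> 2 * u" using x u \<xi> by (auto simp: algebra_simps)
  have "x powr al \<le> (2 * u) powr al" using ux assms al by (intro powr_mono2) auto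
  also have "\<dots> \<le> \<xi>" unfolding \<xi>_def using u assms by (intro powr_mono') auto
  finally have "x powr al \<le> \<xi>" .
  then have "X x * x powr al \<le> X x * \<xi>" by (intro mult_left_mono) auto
  then have 1: "1 \<le> X x * \<xi>" using assms by (simp add: powr_minus)
  have "(1 + \<xi>) powr al * 1 powr (1 - al) \<le> al * (1 + \<xi>) + (1 - al) * 1"
    by (rule Youngs_inequality_0) (use al \<xi> in auto)
  then have B: "(1 + \<xi>) powr al \<le> 1 + al * \<xi>" by (simp add: algebra_simps)
  have "X u = X x * (1 + \<xi>) powr al"
    unfolding x powr_mult by (simp add: powr_minus) (use \<xi> in auto)
  then have 2: "X u \<le> X x * (1 + al * \<xi>)" using B by (simp add: mult_left_mono)
  show ?thesis
    by (rule that[of u \<xi>])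
       (fact u_def u \<xi> ux 1 2 x \<xi>_def X_antimono[OF u(1) ux(1)] | simp add: dT_def \<xi>_def)+
qed

text \<open>The integral in the last condition makes it homogeneous, so that \<open>a\<close> is
  independent of the mass and multiples and sums stay inside.\<close>

definition K :: "real \<Rightarrow> (real \<Rightarrow> real) \<Rightarrow> bool" where
  "K a f \<longleftrightarrow> (\<forall>x y. 0 < x \<longrightarrow> x \<le> y \<longrightarrow> y \<le> 1 \<longrightarrow> f y \<le> f x) \<and> (\<forall>x. 0 < x \<longrightarrow> x \<le> 1 \<longrightarrow> 0 \<le> f x)
     \<and> (\<forall>x. 0 < x \<longrightarrow> x \<le> 1 \<longrightarrow> f x \<le> a * (\<integral>x. f x \<partial>U) * X x)"

lemma KD:
  assumes "K a f"
  shows "0 < x \<Longrightarrow> x \<le> y \<Longrightarrow> y \<le> 1 \<Longrightarrow> f y \<le> f x" "0 < x \<Longrightarrow> x \<le> 1 \<Longrightarrow> 0 \<le> f x"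
    "0 < x \<Longrightarrow> x \<le> 1 \<Longrightarrow> f x \<le> a * (\<integral>x. f x \<partial>U) * X x"
  using assms unfolding K_def by auto

lemma integrable_X_bound:
  assumes "\<And>x y. 0 < x \<Longrightarrow> x \<le> y \<Longrightarrow> y \<le> 1 \<Longrightarrow> f y \<le> f x" "\<And>x. 0 < x \<Longrightarrow> x \<le> 1 \<Longrightarrow> 0 \<le> f x"
    "\<And>x. 0 < x \<Longrightarrow> x \<le> 1 \<Longrightarrow> f x \<le> b * X x"
  shows "integrable U f"
proof (rule Bochner_Integration.integrable_bound)
  show "integrable U (\<lambda>x. b * X x)" using X_integral by auto
  show "f \<in> borel_measurable U" by (rule borel_measurable_U_antimono) (rule assms(1))
  show "AE x in U. norm (f x) \<le> norm (b * X x)"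
    by (rule AE_I2) (use assms(2,3) in \<open>fastforce intro: order.trans[OF _ abs_ge_self]\<close>)
qed

lemma K_integrable: "K a f \<Longrightarrow> integrable U f"
  by (rule integrable_X_bound[of f "a * (\<integral>x. f x \<partial>U)"]) (auto dest: KD)

lemma K_int_nonneg: "K a f \<Longrightarrow> 0 \<le> (\<integral>x. f x \<partial>U)"
  by (rule Bochner_Integration.integral_nonneg) (auto dest: KD)

text \<open>The function is at least \<open>f (1/2)\<close> on the left half, a set of mass one
  half. This controls the right branch, whose preimages all lie beyond \<open>1/2\<close>.\<close>

lemma antimono_value_le:
  assumes int: "integrable U f" and f: "\<And>x y. 0 < x \<Longrightarrow> x \<le> y \<Longrightarrow> y \<le> 1 \<Longrightarrow> f y \<le> (f x::real)"
    and nn: "\<And>x. 0 < x \<Longrightarrow> x \<le> 1 \<Longrightarrow> 0 \<le> f x"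
  shows "f (1/2) \<le> 2 * (\<integral>x. f x \<partial>U)"
proof -
  have m: "(indicator {0<..1/2} :: real \<Rightarrow> real) \<in> borel_measurable U" by (rule borel_measurable_U_I) measurable
  have "(\<integral>x. indicator {0<..1/2} x * f (1/2) \<partial>U) \<le> (\<integral>x. f x \<partial>U)"
  proof (rule integral_mono)
    show "integrable U (\<lambda>x. indicator {0<..1/2} x * f (1/2))"
      by (rule Bochner_Integration.integrable_bound[of _ "\<lambda>_. f (1/2)"]) (use m in \<open>auto split: split_indicator\<close>)
  qed (use int f nn in \<open>auto split: split_indicator\<close>)
  moreover have "U.prob {0<..1/2} = 1/2"
  proof -
    have "emeasure U {0<..1/2} = emeasure lborel {0<..1/2::real}"
      unfolding U_def by (rule emeasure_restrict_space) auto
    then have "U.prob {0<..1/2} = measure lborel {0<..1/2::real}" by (simp only: measure_def)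
    then show ?thesis by simp
  qed
  ultimately show ?thesis by simp
qed

text \<open>Contraction by the derivative \<open>1 + (1 + \<gamma>) * \<xi>\<close> outweighs the
  growth \<open>1 + al * \<xi>\<close> of the weight; as \<open>al < 1/9\<close> and
  \<open>\<xi> \<le> 1\<close> there is room for the extra factor
  \<open>1 - \<xi>/4\<close>.\<close>

lemma left_gain:
  assumes \<gamma>: "0 < \<gamma>" "\<gamma> \<le> al" and \<xi>: "0 < \<xi>" "\<xi> \<le> 1"
  shows "1 + al * \<xi> \<le> (1 - \<xi>/4) * (1 + (1 + \<gamma>) * \<xi>)"
proof -
  have "(1 + \<gamma>) * \<xi> * \<xi> \<le> (1 + \<gamma>) * \<xi> * 1" using \<xi> \<gamma> by (intro mult_left_mono) auto
  moreover have "al * \<xi> \<le> 1/9 * \<xi>" using \<xi> al by (intro mult_right_mono) auto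
  moreover have "1 * \<xi> \<le> (1 + \<gamma>) * \<xi>" using \<xi> \<gamma> by (intro mult_right_mono) auto
  ultimately have "al * \<xi> + \<xi>/4 + (1 + \<gamma>) * \<xi> * \<xi> / 4 \<le> (1 + \<gamma>) * \<xi>" using \<xi>(1) by linarith
  then show ?thesis by (simp add: algebra_simps)
qed

text \<open>The left branch drops by \<open>b/4\<close>, since the gain \<open>\<xi>/4\<close> is
  multiplied by \<open>X x\<close> and \<open>1 \<le> X x * \<xi>\<close>. The right branch adds at
  most half of \<open>2 * \<mu>\<close>. The balance is favourable once
  \<open>b \<ge> 4 * \<mu>\<close>, the origin of the threshold 4 for the cone.\<close>

lemma transfer_X_bound:
  assumes \<gamma>: "0 < \<gamma>" "\<gamma> \<le> al"
    and int: "integrable U f" and f: "\<And>x y. 0 < x \<Longrightarrow> x \<le> y \<Longrightarrow> y \<le> 1 \<Longrightarrow> f y \<le> f x"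
    and nn: "\<And>x. 0 < x \<Longrightarrow> x \<le> 1 \<Longrightarrow> 0 \<le> f x"
    and b: "\<And>x. 0 < x \<Longrightarrow> x \<le> 1 \<Longrightarrow> f x \<le> b * X x" and "0 \<le> b"
    and mu: "(\<integral>x. f x \<partial>U) \<le> \<mu>" and x: "0 < x" "x \<le> 1"
  shows "transfer \<gamma> f x \<le> b * X x - b / 4 + \<mu>"
proof -
  obtain u \<xi> where u: "u = uinv \<gamma> x" "0 < u" "u \<le> 1/2" "u \<le> x" "0 < \<xi>" "\<xi> \<le> 1" "dT \<gamma> u = 1 + (1 + \<gamma>) * \<xi>"
    "1 \<le> X x * \<xi>" "X x \<le> X u" "X u \<le> X x * (1 + al * \<xi>)"
    using left_branch_facts[OF \<gamma> x] by metis
  let ?D = "1 + (1 + \<gamma>) * \<xi>"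
  have D: "0 < ?D" using u \<gamma> by (simp add: add_pos_nonneg)
  note i = left_gain[OF \<gamma> u(5,6)]
  have "f u \<le> b * (X x * ((1 - \<xi>/4) * ?D))"
  proof -
    have "f u \<le> b * X u" using b u by auto
    also have "\<dots> \<le> b * (X x * (1 + al * \<xi>))" using u \<open>0 \<le> b\<close> by (intro mult_left_mono) auto
    also have "\<dots> \<le> b * (X x * ((1 - \<xi>/4) * ?D))" using i \<open>0 \<le> b\<close> by (intro mult_left_mono) auto
    finally show ?thesis .
  qed
  then have "f u / ?D \<le> b * (X x * (1 - \<xi> / 4))"
    unfolding pos_divide_le_eq[OF D] by (simp only: mult.assoc)
  also have "\<dots> = b * (X x - X x * \<xi> / 4)" by (simp add: algebra_simps)
  also have "\<dots> \<le> b * (X x - 1/4)" using u \<open>0 \<le> b\<close> by (intro mult_left_mono) auto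
  finally have 1: "f u / ?D \<le> b * X x - b/4" by (simp add: algebra_simps)
  have "f ((x+1)/2) \<le> f (1/2)" using x by (intro f) auto
  also have "\<dots> \<le> 2 * \<mu>" using antimono_value_le[OF int f nn] mu by auto
  finally show ?thesis using 1 unfolding transfer_real u(1)[symmetric] u(7) by linarith
qed

lemma transfer_K:
  assumes \<gamma>: "0 < \<gamma>" "\<gamma> \<le> al" and a: "4 \<le> a" and f: "K a f"
  shows "K a (transfer \<gamma> f)"
proof -
  have \<gamma>1: "\<gamma> \<le> 1" using \<gamma> al by auto
  have i: "(\<integral>x. transfer \<gamma> f x \<partial>U) = (\<integral>x. f x \<partial>U)" using transfer_integrable[OF \<gamma>(1) \<gamma>1 K_integrable[OF f]] by simp
  have a0: "0 \<le> a * (\<integral>x. f x \<partial>U)" using K_int_nonneg[OF f] a by auto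
  show ?thesis unfolding K_def i
  proof (intro conjI allI impI)
    fix x y :: real assume "0 < x" "x \<le> y" "y \<le> 1"
    then show "transfer \<gamma> f y \<le> transfer \<gamma> f x"
      using KD[OF f] by (intro transfer_antimono \<gamma> \<gamma>1) auto
  next
    fix x :: real assume x: "0 < x" "x \<le> 1"
    then show "0 \<le> transfer \<gamma> f x" using KD[OF f] \<gamma> by (intro transfer_nonneg) auto
    have "transfer \<gamma> f x \<le> a * (\<integral>x. f x \<partial>U) * X x - a * (\<integral>x. f x \<partial>U) / 4 + (\<integral>x. f x \<partial>U)"
      by (rule transfer_X_bound[OF \<gamma> K_integrable[OF f]]) (use KD[OF f] x a0 in auto)
    also have "\<dots> \<le> a * (\<integral>x. f x \<partial>U) * X x"
      using mult_right_mono[of 1 "a/4" "(\<integral>x. f x \<partial>U)"] K_int_nonneg[OF f] a by auto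
    finally show "transfer \<gamma> f x \<le> a * (\<integral>x. f x \<partial>U) * X x" .
  qed
qed

lemma PP_K: "adm \<beta> \<Longrightarrow> 4 \<le> a \<Longrightarrow> K a f \<Longrightarrow> K a (PP \<beta> n f)"
  by (induction n) (auto intro!: transfer_K admD)

lemma K_one: "4 \<le> a \<Longrightarrow> K a (\<lambda>_. 1)"
  unfolding K_def
proof (intro conjI allI impI)
  fix x :: real assume "4 \<le> a" "0 < x" "x \<le> 1"
  then show "1 \<le> a * (\<integral>x. 1 \<partial>U) * X x"
    using X_ge_1[of x] mult_mono[of 1 a 1 "X x"] U.prob_space by simp
qed auto

lemma K_mono: "K a f \<Longrightarrow> a \<le> b \<Longrightarrow> K b f"
  unfolding K_def using K_int_nonneg[of a f] unfolding K_def
  by (smt (verit) mult_right_mono powr_ge_zero)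

text \<open>Subtracting a constant from a density in \<open>K a\<close> leaves the bound \<open>a' X\<close> with \<open>a' > a\<close>. Each further step lowers this bound by
  one until it falls below \<open>a X\<close>; after \<open>N\<close> steps the excess lives near 0 and has mass \<open>O(N^(-8))\<close>.\<close>

lemma transfer_recover:
  assumes \<gamma>: "0 < \<gamma>" "\<gamma> \<le> al" and a: "12 \<le> a" "a \<le> a'" "a' - a \<le> a' / 5" and k: "0 \<le> k"
    and int: "integrable U f" and f: "\<And>x y. 0 < x \<Longrightarrow> x \<le> y \<Longrightarrow> y \<le> 1 \<Longrightarrow> f y \<le> f x"
    and nn: "\<And>x. 0 < x \<Longrightarrow> x \<le> 1 \<Longrightarrow> 0 \<le> f x"
    and b: "\<And>x. 0 < x \<Longrightarrow> x \<le> 1 \<Longrightarrow> f x \<le> max (a' * X x - k) (a * X x)"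
    and mu: "(\<integral>x. f x \<partial>U) \<le> 1" and x: "0 < x" "x \<le> 1"
  shows "transfer \<gamma> f x \<le> max (a' * X x - (k + 1)) (a * X x)"
proof -
  obtain u \<xi> where u: "u = uinv \<gamma> x" "0 < u" "u \<le> 1/2" "u \<le> x" "0 < \<xi>" "\<xi> \<le> 1" "dT \<gamma> u = 1 + (1 + \<gamma>) * \<xi>"
    "1 \<le> X x * \<xi>" "X x \<le> X u" "X u \<le> X x * (1 + al * \<xi>)"
    using left_branch_facts[OF \<gamma> x] by metis
  let ?D = "1 + (1 + \<gamma>) * \<xi>"
  let ?A = "X u"
  have D: "0 < ?D" using u \<gamma> by (simp add: add_pos_nonneg)
  have g9: "\<gamma> \<le> 1/9" using \<gamma> al by auto
  have "f ((x+1)/2) \<le> f (1/2)" using x by (intro f) auto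
  also have "\<dots> \<le> 2" using antimono_value_le[OF int f nn] mu by auto
  finally have r: "f ((x+1)/2) / 2 \<le> 1" by simp
  have fu: "f u \<le> max (a' * ?A - k) (a * ?A)" using b u by auto
  show ?thesis
  proof (cases "a * ?A \<le> a' * ?A - k")
    \<comment> \<open>The unshifted bound is active at \<open>u\<close>. Its drop
      \<open>a/4\<close>, at least 3, exceeds what the right branch adds, at most 1.\<close>
    case False
    have "f u \<le> a * (X x * ((1 - \<xi>/4) * ?D))"
    proof -
      have "f u \<le> a * ?A" using fu False by linarith
      also have "\<dots> \<le> a * (X x * (1 + al * \<xi>))" using u a by (intro mult_left_mono) auto
      also have "\<dots> \<le> a * (X x * ((1 - \<xi>/4) * ?D))"
        using left_gain[OF \<gamma> u(5,6)] a by (intro mult_left_mono) auto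
      finally show ?thesis .
    qed
    then have "f u / ?D \<le> a * (X x * (1 - \<xi> / 4))"
      unfolding pos_divide_le_eq[OF D] by (simp only: mult.assoc)
    also have "\<dots> = a * (X x - X x * \<xi> / 4)" by (simp add: algebra_simps)
    also have "\<dots> \<le> a * (X x - 1/4)" using u a by (intro mult_left_mono) auto
    finally have "f u / ?D + f ((x+1)/2) / 2 \<le> a * X x" using r a by (simp add: algebra_simps)
    then show ?thesis unfolding transfer_real u(1)[symmetric] u(7) by linarith
  next
    case True
    \<comment> \<open>Division by \<open>?D\<close> also shrinks the subtracted \<open>k\<close>.
      Restoring it costs \<open>k * (?D - 1)\<close>, at most 2/9 of
      \<open>a' * (?A * \<xi>)\<close> because \<open>k\<close> is at most \<open>a'/5 * ?A\<close>;
      a further drop by 2 costs at most 1/2 of it, as \<open>a' \<ge> 12\<close>. The contraction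
      leaves room for 4/5, which covers both. The right branch gives back at most 1 of the drop by
      2.\<close>
    then have fu: "f u \<le> a' * ?A - k" using fu by simp
    have A0: "0 \<le> ?A" by simp
    have xA: "1 \<le> ?A * \<xi>" using u(8) mult_right_mono[OF u(9), of \<xi>] u by linarith
    have kA: "k \<le> (a'/5) * ?A" using True mult_right_mono[OF a(3) A0] by (simp add: algebra_simps)
    have D1: "?D - 1 \<le> 10/9 * \<xi>" using g9 u by (auto intro!: mult_right_mono)
    have "k * (?D - 1) \<le> ((a'/5) * ?A) * (10/9 * \<xi>)"
      using k u \<gamma> a by (intro mult_mono kA D1) auto
    then have 1: "k * (?D - 1) \<le> 2/9 * (a' * (?A * \<xi>))" by (simp add: algebra_simps)
    have "2 * ?D \<le> 6" using D1 u(6) by argo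
    also have "\<dots> \<le> a' / 2 * (?A * \<xi>)"
      using mult_mono[of 6 "a'/2" 1 "?A * \<xi>"] xA a by auto
    finally have 2: "2 * ?D \<le> 1/2 * (a' * (?A * \<xi>))" by simp
    have 3: "(1 + 4/5 * \<xi>) * (1 + al * \<xi>) \<le> ?D"
    proof -
      have "(1 + 4/5 * \<xi>) * (1 + al * \<xi>) \<le> (1 + 4/5 * \<xi>) * (1 + 1/9 * \<xi>)"
        using al u by (intro mult_left_mono add_left_mono mult_right_mono) auto
      also have "\<dots> = 1 + 41/45 * \<xi> + 4/45 * (\<xi> * \<xi>)" by (simp add: field_simps)
      also have "\<dots> \<le> 1 + 41/45 * \<xi> + 4/45 * (\<xi> * 1)" using u by (intro add_left_mono mult_left_mono) auto
      also have "\<dots> \<le> ?D" using mult_nonneg_nonneg[of \<gamma> \<xi>] u(5) \<gamma>(1) by (simp add: algebra_simps)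
      finally show ?thesis .
    qed
    have "a' * (?A * (1 + 4/5 * \<xi>)) \<le> a' * ((X x * (1 + al * \<xi>)) * (1 + 4/5 * \<xi>))"
      using u a by (intro mult_left_mono mult_right_mono) auto
    also have "\<dots> = a' * (X x * ((1 + 4/5 * \<xi>) * (1 + al * \<xi>)))" by (simp add: algebra_simps)
    also have "\<dots> \<le> a' * (X x * ?D)" using 3 a by (intro mult_left_mono) auto
    finally have "a' * ?A + 4/5 * (a' * (?A * \<xi>)) \<le> a' * X x * ?D" by (simp add: algebra_simps)
    moreover have "0 \<le> a' * (?A * \<xi>)" using a u by auto
    ultimately have "k * (?D - 1) + 2 * ?D + a' * ?A \<le> a' * X x * ?D" using 1 2 by linarith
    then have "a' * ?A - k \<le> (a' * X x - k - 2) * ?D" by (simp add: algebra_simps)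
    then have "f u / ?D \<le> a' * X x - k - 2"
      using fu D by (simp add: pos_divide_le_eq)
    then show ?thesis using r unfolding transfer_real u(1)[symmetric] u(7) by linarith
  qed
qed

lemma PP_recover:
  assumes \<beta>: "adm \<beta>" and a: "12 \<le> a" "a \<le> a'" "a' - a \<le> a' / 5"
    and int: "integrable U f" and f: "\<And>x y. 0 < x \<Longrightarrow> x \<le> y \<Longrightarrow> y \<le> 1 \<Longrightarrow> f y \<le> f x"
    and nn: "\<And>x. 0 < x \<Longrightarrow> x \<le> 1 \<Longrightarrow> 0 \<le> f x"
    and b: "\<And>x. 0 < x \<Longrightarrow> x \<le> 1 \<Longrightarrow> f x \<le> a' * X x"
    and mu: "(\<integral>x. f x \<partial>U) \<le> 1" and x: "0 < x" "x \<le> 1"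
  shows "PP \<beta> n f x \<le> max (a' * X x - real n) (a * X x)"
  using x
proof (induction n arbitrary: x)
  case 0
  then show ?case using b[of x] by simp
next
  case (Suc n)
  have "PP \<beta> (Suc n) f x \<le> max (a' * X x - (real n + 1)) (a * X x)"
    unfolding PP.simps
    by (rule transfer_recover[OF admD(1,2)[OF \<beta>] a _ PP_integrable(1)[OF \<beta> int] PP_antimono[OF \<beta> nn f] PP_nonneg[OF \<beta> nn]])
       (use Suc PP_integrable(2)[OF \<beta> int] mu in auto)
  then show ?case by simp
qed

text \<open>The cone bound prevents the mass from concentrating near 0, so a density is at least 1/2
  on some \<open>{0<..d}\<close> with \<open>d\<close> depending only on \<open>a\<close>. The left
  branch stretches this interval over the whole space in a fixed number of steps, each dividing the
  lower bound by at most the maximal derivative 3.\<close>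

lemma lower_bound_exists:
  assumes a: "4 \<le> a"
  shows "\<exists>k0 c. 0 < c \<and> c \<le> 1/5 \<and> (\<forall>\<beta> f. adm \<beta> \<longrightarrow> K a f \<longrightarrow> (\<integral>x. f x \<partial>U) = 1 \<longrightarrow>
    (\<forall>x. 0 < x \<longrightarrow> x \<le> 1 \<longrightarrow> c \<le> PP \<beta> k0 f x))"
proof -
  \<comment> \<open>Chosen so that \<open>a * d powr (1/2) = 1/8\<close>; with
    \<open>al < 1/9\<close> the singular part below then has integral at most 1/2.\<close>
  define d where "d = 1 / (8 * a)^2"
  have d: "0 < d" "d \<le> 1/2" using a power_mono[of 2 "8*a" 2] by (auto simp: d_def field_simps)
  have sd: "d powr (1/2) = 1 / (8 * a)"
    unfolding d_def powr_half_sqrt[OF d(1)[unfolded d_def, THEN less_imp_le]] real_sqrt_divide real_sqrt_abs using a by simp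
  have half: "1/2 \<le> f d" if f: "K a f" "(\<integral>x. f x \<partial>U) = 1" for f
  proof (rule ccontr)
    assume "\<not> 1/2 \<le> f d"
    then have fd: "f d < 1/2" by simp
    let ?p = "al + 1/2"
    have p: "?p < 1" using al by simp
    note pI = powr_integral_U[OF p]
    \<comment> \<open>On \<open>{0<..d}\<close> a factor \<open>x powr (1/2)\<close> is split off
      from \<open>X\<close>, leaving an exponent still below 1; beyond \<open>d\<close> monotonicity
      suffices.\<close>
    have le: "f x \<le> a * d powr (1/2) * x powr - ?p + f d" if x: "0 < x" "x \<le> 1" for x
    proof (cases "x \<le> d")
      case True
      have "X x = x powr (1/2) * x powr - ?p" using x by (simp add: powr_add[symmetric])
      also have "\<dots> \<le> d powr (1/2) * x powr - ?p"
        using True x by (intro mult_right_mono powr_mono2) auto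
      finally have "a * X x \<le> a * (d powr (1/2) * x powr - ?p)" using a by (intro mult_left_mono) auto
      moreover have "f x \<le> a * X x" using KD(3)[OF f(1) x] f(2) by simp
      moreover have "0 \<le> f d" using KD(2)[OF f(1)] d by auto
      ultimately show ?thesis by (simp add: mult.assoc)
    next
      case False
      then have "f x \<le> f d" using KD(1)[OF f(1), of d x] d x by auto
      moreover have "0 \<le> a * d powr (1/2) * x powr - ?p" using a by auto
      ultimately show ?thesis by linarith
    qed
    have "(\<integral>x. f x \<partial>U) \<le> (\<integral>x. a * d powr (1/2) * x powr - ?p + f d \<partial>U)"
      by (rule integral_mono) (use le pI K_integrable[OF f(1)] in auto)
    also have "\<dots> = a * d powr (1/2) / (1 - ?p) + f d"
      using pI U.prob_space by simp
    also have "a * d powr (1/2) = 1/8" using a sd by simp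
    also have "1/8 / (1 - ?p) \<le> 1/2" using al by (subst pos_divide_le_eq) auto
    finally show False using fd f(2) by simp
  qed
  \<comment> \<open>A rate of expansion to the right of \<open>d\<close> that is valid for every
    exponent up to \<open>al\<close>.\<close>
  define l where "l = 1 + (2 * d) powr al"
  have l: "1 < l" using d by (simp add: l_def)
  obtain k0 where k0: "1 / d < l ^ k0" using real_arch_pow[OF l] by blast
  have grow: "1/2 / 3^k \<le> PP \<beta> k f x" if \<beta>: "adm \<beta>" and f: "K a f" "(\<integral>x. f x \<partial>U) = 1"
    and x: "0 < x" "x \<le> 1" "x \<le> d * l ^ k" for \<beta> f k x
    using x
  proof (induction k arbitrary: x)
    case 0
    then show ?case using half[OF f] KD(1)[OF f(1), of x d] d by auto
  next
    case (Suc k)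
    let ?\<gamma> = "\<beta> (Suc k)"
    let ?u = "uinv ?\<gamma> x"
    have \<gamma>: "0 < ?\<gamma>" "?\<gamma> \<le> al" "?\<gamma> \<le> 1" using admD[OF \<beta>] by auto
    have u: "0 < ?u" "?u \<le> 1/2" using uinv[OF \<gamma>(1) Suc.prems(1,2)] by auto
    have ud: "?u \<le> d * l ^ k"
    proof (rule ccontr)
      assume "\<not> ?u \<le> d * l ^ k"
      then have gt: "d * l ^ k < ?u" by simp
      have "d * 1 \<le> d * l ^ k" using l d by (intro mult_left_mono one_le_power) auto
      then have du: "d < ?u" using gt by simp
      have "(2 * d) powr al \<le> (2 * ?u) powr al" using du d al by (intro powr_mono2) auto
      also have "\<dots> \<le> (2 * ?u) powr ?\<gamma>" using u \<gamma> by (intro powr_mono') auto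
      finally have "l \<le> 1 + (2 * ?u) powr ?\<gamma>" by (simp add: l_def)
      then have "(d * l ^ k) * l < ?u * (1 + (2 * ?u) powr ?\<gamma>)"
        using gt l d u by (intro mult_less_le_imp_less) auto
      also have "\<dots> = x" using uinv_eq[OF \<gamma>(1) Suc.prems(1,2)] by simp
      finally show False using Suc.prems(3) by (simp add: mult_ac)
    qed
    have "1/2/3^k / 3 \<le> PP \<beta> k f ?u / dT ?\<gamma> ?u"
      using Suc.IH[OF u(1) _ ud] u dT_bounds[OF \<gamma>(1,3) u] by (intro frac_le) (auto intro: order.trans[rotated])
    moreover have "0 \<le> PP \<beta> k f ((x+1)/2)"
      by (rule PP_nonneg[OF \<beta>]) (use KD(2)[OF f(1)] Suc.prems in auto)
    ultimately show ?case unfolding PP.simps transfer_real by simp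
  qed
  show ?thesis
  proof (intro exI conjI allI impI)
    show "0 < min (1/5) (1/2/3^k0 :: real)" by simp
    show "min (1/5) (1/2/3^k0 :: real) \<le> 1/5" by simp
    fix \<beta> f x assume "adm \<beta>" "K a f" "(\<integral>x. f x \<partial>U) = 1" and x: "0 < x" "x \<le> (1::real)"
    moreover have "x \<le> d * l ^ k0" using k0 d x by (simp add: field_simps)
    ultimately show "min (1/5) (1/2/3^k0 :: real) \<le> PP \<beta> k0 f x" using grow[of \<beta> f x k0] by auto
  qed
qed

end

section \<open>Coupling and polynomial loss of memory\<close>

context lsv
begin

lemma K_scale: "K a f \<Longrightarrow> 0 \<le> s \<Longrightarrow> K a (\<lambda>x. s * f x)"
  unfolding K_def by (auto intro: mult_left_mono simp: mult.assoc mult.left_commute[of a s])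

lemma K_add:
  assumes "K a f" "K a g"
  shows "K a (\<lambda>x. f x + g x)"
  using KD[OF assms(1)] KD[OF assms(2)] K_integrable[OF assms(1)] K_integrable[OF assms(2)]
  unfolding K_def by (fastforce simp: algebra_simps intro: add_mono)

lemma K_X: "12 \<le> a \<Longrightarrow> K a X"
  unfolding K_def
proof (intro conjI allI impI)
  fix x :: real assume "12 \<le> a" "0 < x" "x \<le> 1"
  then show "X x \<le> a * (\<integral>x. X x \<partial>U) * X x"
    using X_integral mult_mono[of 1 a 1 "\<integral>x. X x \<partial>U"] mult_right_mono[of 1 "a * (\<integral>x. X x \<partial>U)" "X x"] by simp
qed (auto intro: X_antimono)

text \<open>For \<open>z > N\<close> one has \<open>z \<le> z ^ 9 / N ^ 8\<close>, a Markov
  estimate. The ninth power of the weight is \<open>x powr - (9 * al)\<close>, and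
  \<open>al < 1/9\<close> is exactly what makes it integrable.\<close>

lemma excess_integral:
  assumes "0 \<le> b" "1 \<le> N"
  shows "integrable U (\<lambda>x. max 0 (b * X x - real N))"
    "(\<integral>x. max 0 (b * X x - real N) \<partial>U) \<le> b ^ 9 / (1 - 9 * al) / real N ^ 8"
proof -
  have p: "9 * al < 1" using al by simp
  note pI = powr_integral_U[OF p]
  have le: "max 0 (b * X x - real N) \<le> b ^ 9 / real N ^ 8 * x powr - (9 * al)" if "0 < x" for x
  proof -
    define z where "z = b * X x"
    have z: "0 \<le> z" using assms by (simp add: z_def)
    have "(X x) ^ 9 = x powr - (9 * al)"
      using that by (simp add: powr_powr powr_realpow[symmetric] mult.commute)
    then have "b ^ 9 / real N ^ 8 * x powr - (9 * al) = z ^ 9 / real N ^ 8"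
      by (simp add: z_def power_mult_distrib)
    moreover have "max 0 (z - real N) \<le> z ^ 9 / real N ^ 8"
    proof (cases "z \<le> real N")
      case False
      then have "real N ^ 8 \<le> z ^ 8" by (intro power_mono) auto
      then have "z * real N ^ 8 \<le> z * z ^ 8" using z by (intro mult_left_mono)
      then have "z \<le> z ^ 9 / real N ^ 8"
        using assms by (simp add: pos_le_divide_eq power_Suc[symmetric] del: power_Suc)
      then show ?thesis using z by auto
    qed (use z in auto)
    ultimately show ?thesis by (simp only: z_def)
  qed
  have m: "(\<lambda>x. max 0 (b * X x - real N)) \<in> borel_measurable U" by (rule borel_measurable_U_I) measurable
  show i: "integrable U (\<lambda>x. max 0 (b * X x - real N))"
  proof (rule Bochner_Integration.integrable_bound[OF integrable_mult_right[OF pI(1), of "b ^ 9 / real N ^ 8"] m], rule AE_I2)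
    fix x assume "x \<in> space U"
    then have "max 0 (b * X x - real N) \<le> b ^ 9 / real N ^ 8 * x powr - (9 * al)" by (intro le) simp
    then show "norm (max 0 (b * X x - real N)) \<le> norm (b ^ 9 / real N ^ 8 * x powr - (9 * al))"
      unfolding real_norm_def by (metis abs_ge_self abs_of_nonneg max.cobounded1 order.trans)
  qed
  have "(\<integral>x. max 0 (b * X x - real N) \<partial>U) \<le> (\<integral>x. b ^ 9 / real N ^ 8 * x powr - (9 * al) \<partial>U)"
    by (rule integral_mono[OF i]) (use pI le in auto)
  also have "\<dots> = b ^ 9 / (1 - 9 * al) / real N ^ 8" using pI by simp
  finally show "(\<integral>x. max 0 (b * X x - real N) \<partial>U) \<le> b ^ 9 / (1 - 9 * al) / real N ^ 8" .
qed

text \<open>The split-off part is \<open>c\<close> times the constant 1 at time \<open>k0\<close>,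
  whatever \<open>f\<close> was, so its images cancel when two densities are compared. The rest is
  normalised, evolved for \<open>N\<close> steps and truncated to the cone bound; the truncated mass
  is handed back as a constant.\<close>

lemma coupling_step:
  assumes a: "12 \<le> a" and c: "0 < c" "c \<le> 1/5"
    and low: "\<forall>\<beta> f. adm \<beta> \<longrightarrow> K a f \<longrightarrow> (\<integral>x. f x \<partial>U) = 1 \<longrightarrow> (\<forall>x. 0 < x \<longrightarrow> x \<le> 1 \<longrightarrow> c \<le> PP \<beta> k0 f x)"
    and N: "1 \<le> N" and \<beta>: "adm \<beta>" and f: "K a f" "(\<integral>x. f x \<partial>U) = 1"
  shows "\<exists>f'. K a f' \<and> (\<integral>x. f' x \<partial>U) = 1 \<and>
    (\<integral>x. \<bar>PP \<beta> (k0 + Suc N) f x - (c * PP (sh k0 \<beta>) (Suc N) (\<lambda>_. 1) x + (1 - c) * f' x)\<bar> \<partial>U)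
      \<le> 2 * ((5/4 * a) ^ 9 / (1 - 9 * al) / real N ^ 8)"
proof -
  define g0 where "g0 = PP \<beta> k0 f"
  have g0: "K a g0" "(\<integral>x. g0 x \<partial>U) = 1" "integrable U g0"
    using PP_K[OF \<beta> _ f(1)] a PP_integrable[OF \<beta> K_integrable[OF f(1)]] f(2) by (auto simp: g0_def)
  have g0c: "c \<le> g0 x" if "0 < x" "x \<le> 1" for x using low \<beta> f that by (simp add: g0_def)
  define a' where "a' = a / (1 - c)"
  have a'c: "a' * (1 - c) = a" using c by (simp add: a'_def)
  have ca': "a' - a = c * a'" using a'c by (simp add: algebra_simps)
  have a'0: "0 < a'" using a c by (simp add: a'_def)
  \<comment> \<open>The bound \<open>c \<le> 1/5\<close> serves to meet the hypothesis of
    \<open>PP_recover\<close>, since \<open>a' - a = c * a'\<close>.\<close>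
  have a': "a \<le> a'" "a' - a \<le> a' / 5"
    using ca' mult_right_mono[OF c(2), of a'] mult_pos_pos[OF c(1) a'0] a'0 by auto
  have a'54: "a' \<le> 5/4 * a" using a'(2) by simp
  define f1 where "f1 x = (g0 x - c) / (1 - c)" for x
  have c1: "0 < 1 - c" using c by simp
  have f1i: "integrable U f1" "(\<integral>x. f1 x \<partial>U) = 1"
    unfolding f1_def using g0 c U.prob_space by auto
  have f1anti: "f1 y \<le> f1 x" if "0 < x" "x \<le> y" "y \<le> 1" for x y
    unfolding f1_def using KD(1)[OF g0(1) that] c1 by (intro divide_right_mono) auto
  have f1nn: "0 \<le> f1 x" if "0 < x" "x \<le> 1" for x
    unfolding f1_def using g0c[OF that] c1 by auto
  have f1b: "f1 x \<le> a' * X x" if "0 < x" "x \<le> 1" for x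
    using KD(3)[OF g0(1) that] c c1 g0(2) unfolding f1_def a'_def by (simp add: divide_right_mono)
  define \<beta>' where "\<beta>' = sh k0 \<beta>"
  have \<beta>': "adm \<beta>'" using adm_sh[OF \<beta>] by (simp add: \<beta>'_def)
  define g where "g = PP \<beta>' N f1"
  have gi: "integrable U g" "(\<integral>x. g x \<partial>U) = 1" using PP_integrable[OF \<beta>' f1i(1)] f1i(2) by (auto simp: g_def)
  have ganti: "g y \<le> g x" if "0 < x" "x \<le> y" "y \<le> 1" for x y
    unfolding g_def using that f1nn f1anti by (intro PP_antimono[OF \<beta>']) auto
  have gnn: "0 \<le> g x" if "0 < x" "x \<le> 1" for x
    unfolding g_def using that f1nn by (intro PP_nonneg[OF \<beta>']) auto
  have gb: "g x \<le> max (a' * X x - real N) (a * X x)" if "0 < x" "x \<le> 1" for x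
    unfolding g_def using that a a' f1i f1nn f1anti f1b by (intro PP_recover[OF \<beta>' a a' f1i(1)]) auto
  define f2 where "f2 x = min (g x) (a * X x)" for x
  have f2anti: "f2 y \<le> f2 x" if "0 < x" "x \<le> y" "y \<le> 1" for x y
    unfolding f2_def using ganti[OF that] a X_antimono[OF that(1,2)] by (intro min.mono mult_left_mono) auto
  have f2nn: "0 \<le> f2 x" if "0 < x" "x \<le> 1" for x
    unfolding f2_def using gnn[OF that] a by auto
  have f2b: "f2 x \<le> a * X x" for x by (simp add: f2_def)
  have f2i: "integrable U f2" by (rule integrable_X_bound[of _ a]) (use f2anti f2nn f2b in auto)
  define \<eta> where "\<eta> = (\<integral>x. g x - f2 x \<partial>U)"
  have \<eta>: "\<eta> = 1 - (\<integral>x. f2 x \<partial>U)" using gi f2i by (simp add: \<eta>_def)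
  have \<eta>0: "0 \<le> \<eta>" unfolding \<eta>_def by (rule Bochner_Integration.integral_nonneg) (simp add: f2_def)
  have if2: "0 \<le> (\<integral>x. f2 x \<partial>U)" by (rule Bochner_Integration.integral_nonneg) (use f2nn in auto)
  have \<eta>E: "\<eta> \<le> (5/4 * a) ^ 9 / (1 - 9 * al) / real N ^ 8"
  proof -
    have "\<eta> \<le> (\<integral>x. max 0 (a' * X x - real N) \<partial>U)" unfolding \<eta>_def
    proof (rule integral_mono)
      fix x assume "x \<in> space U"
      then have "g x \<le> a' * X x - real N \<or> g x \<le> a * X x"
        using gb[of x] by (auto simp: le_max_iff_disj)
      moreover have "0 \<le> a * X x" using a by simp
      ultimately show "g x - f2 x \<le> max 0 (a' * X x - real N)"
        unfolding f2_def by linarith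
    qed (use gi f2i excess_integral[of a' N] a'0 N in auto)
    also have "\<dots> \<le> a' ^ 9 / (1 - 9 * al) / real N ^ 8" using excess_integral[of a' N] a'0 N by auto
    also have "\<dots> \<le> (5/4 * a) ^ 9 / (1 - 9 * al) / real N ^ 8"
      using a'54 a'0 al by (intro divide_right_mono power_mono) auto
    finally show ?thesis .
  qed
  define \<gamma> where "\<gamma> = \<beta>' (Suc N)"
  have \<gamma>: "0 < \<gamma>" "\<gamma> \<le> al" "\<gamma> \<le> 1" using admD[OF \<beta>'] by (auto simp: \<gamma>_def)
  \<comment> \<open>One more step is taken before adding the lost mass \<open>\<eta>\<close>: it
    lowers the cone bound by \<open>a / 4 - 1\<close>, at least 2, which leaves room for the
    constant \<open>\<eta> \<le> 1\<close>.\<close>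
  define f3 where "f3 x = transfer \<gamma> f2 x + \<eta>" for x
  note tf2 = transfer_integrable[OF \<gamma>(1,3) f2i]
  have f3i: "(\<integral>x. f3 x \<partial>U) = 1" unfolding f3_def using tf2 U.prob_space by (simp add: \<eta>)
  have "K a f3" unfolding K_def f3i
  proof (intro conjI allI impI)
    fix x y :: real assume "0 < x" "x \<le> y" "y \<le> 1"
    then show "f3 y \<le> f3 x" unfolding f3_def by (intro add_right_mono transfer_antimono \<gamma> f2nn f2anti)
  next
    fix x :: real assume x: "0 < x" "x \<le> 1"
    then show "0 \<le> f3 x" unfolding f3_def by (intro add_nonneg_nonneg transfer_nonneg \<gamma> f2nn \<eta>0)
    have "transfer \<gamma> f2 x \<le> a * X x - a / 4 + 1"
      by (rule transfer_X_bound[OF \<gamma>(1,2) f2i f2anti f2nn]) (use x a \<eta> \<eta>0 f2b in auto)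
    then show "f3 x \<le> a * 1 * X x" using a \<eta> if2 by (simp add: f3_def)
  qed
  moreover have "(\<integral>x. \<bar>PP \<beta> (k0 + Suc N) f x - (c * PP (sh k0 \<beta>) (Suc N) (\<lambda>_. 1) x + (1 - c) * f3 x)\<bar> \<partial>U) \<le> 2 * \<eta>"
  proof -
    have "g0 = (\<lambda>x. c * 1 + (1 - c) * f1 x)" using c by (auto simp: f1_def)
    then have "PP \<beta>' (Suc N) g0 = (\<lambda>x. c * PP \<beta>' (Suc N) (\<lambda>_. 1) x + (1 - c) * transfer \<gamma> g x)"
      by (simp only: PP_add PP_mult) (simp add: g_def \<gamma>_def)
    \<comment> \<open>The discrepancy consists of the transferred excess and the constant replacing
      it, both of integral \<open>\<eta>\<close>; hence the factor 2.\<close>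
    then have e: "PP \<beta> (k0 + Suc N) f x - (c * PP (sh k0 \<beta>) (Suc N) (\<lambda>_. 1) x + (1 - c) * f3 x)
      = (1 - c) * (transfer \<gamma> (\<lambda>x. g x - f2 x) x - \<eta>)" for x
      unfolding PP_plus \<beta>'_def[symmetric] g0_def[symmetric] by (simp add: f3_def transfer_diff algebra_simps)
    have "\<bar>(1 - c) * (transfer \<gamma> (\<lambda>x. g x - f2 x) x - \<eta>)\<bar> \<le> transfer \<gamma> (\<lambda>x. g x - f2 x) x + \<eta>" if "0 < x" "x \<le> 1" for x
    proof -
      have "0 \<le> transfer \<gamma> (\<lambda>x. g x - f2 x) x"
        using that by (intro transfer_nonneg \<gamma>) (auto simp: f2_def)
      then have "\<bar>transfer \<gamma> (\<lambda>x. g x - f2 x) x - \<eta>\<bar> \<le> transfer \<gamma> (\<lambda>x. g x - f2 x) x + \<eta>" using \<eta>0 by auto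
      moreover have "\<bar>1 - c\<bar> \<le> 1" using c by auto
      ultimately show ?thesis unfolding abs_mult by (metis abs_ge_zero mult_left_le_one_le order.trans)
    qed
    moreover have ti: "integrable U (transfer \<gamma> (\<lambda>x. g x - f2 x))" "(\<integral>x. transfer \<gamma> (\<lambda>x. g x - f2 x) x \<partial>U) = \<eta>"
      using transfer_integrable[OF \<gamma>(1,3), of "\<lambda>x. g x - f2 x"] gi f2i by (auto simp: \<eta>_def)
    ultimately have "(\<integral>x. \<bar>(1 - c) * (transfer \<gamma> (\<lambda>x. g x - f2 x) x - \<eta>)\<bar> \<partial>U) \<le> (\<integral>x. transfer \<gamma> (\<lambda>x. g x - f2 x) x + \<eta> \<partial>U)"
      by (intro integral_mono) auto
    also have "\<dots> = 2 * \<eta>" using ti U.prob_space by simp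
    finally show ?thesis unfolding e .
  qed
  ultimately show ?thesis using f3i \<eta>E by (intro exI[of _ f3]) auto
qed

lemma memory_loss_unit:
  assumes a: "12 \<le> a"
  shows "\<exists>C>0. \<forall>\<beta> f g n. adm \<beta> \<longrightarrow> K a f \<longrightarrow> K a g \<longrightarrow> (\<integral>x. f x \<partial>U) = 1 \<longrightarrow> (\<integral>x. g x \<partial>U) = 1 \<longrightarrow>
    (\<integral>x. \<bar>PP \<beta> n f x - PP \<beta> n g x\<bar> \<partial>U) \<le> C / real (Suc n) ^ 4"
proof -
  obtain k0 c where c: "0 < c" "c \<le> 1/5"
    and low: "\<forall>\<beta> f. adm \<beta> \<longrightarrow> K a f \<longrightarrow> (\<integral>x. f x \<partial>U) = 1 \<longrightarrow> (\<forall>x. 0 < x \<longrightarrow> x \<le> 1 \<longrightarrow> c \<le> PP \<beta> k0 f x)"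
  proof -
    have "4 \<le> a" using a by simp
    from lower_bound_exists[OF this] show ?thesis using that by blast
  qed
  define E where "E = (5/4 * a) ^ 9 / (1 - 9 * al)"
  have E: "0 \<le> E" using a al by (simp add: E_def)
  have base: "(\<integral>x. \<bar>f x - g x\<bar> \<partial>U) \<le> 2" if "K a f" "K a g" "(\<integral>x. f x \<partial>U) = 1" "(\<integral>x. g x \<partial>U) = 1" for f g
  proof -
    have i: "integrable U f" "integrable U g" using K_integrable that by auto
    have "(\<integral>x. \<bar>f x - g x\<bar> \<partial>U) \<le> (\<integral>x. f x + g x \<partial>U)"
    proof (rule integral_mono)
      fix x assume "x \<in> space U"
      then show "\<bar>f x - g x\<bar> \<le> f x + g x" using KD(2)[OF that(1), of x] KD(2)[OF that(2), of x] by auto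
    qed (use i in auto)
    then show ?thesis using that i by simp
  qed
  \<comment> \<open>For fixed \<open>N\<close> the distance obeys the recursion d' \<le> (1 - c) d +
    4 e with e the loss of one density in a round up to the factor 2. Thus the losses form a
    geometric series, bounded by 4 e / c for any number of rounds.\<close>
  have iter: "(\<integral>x. \<bar>PP \<beta> (j * (k0 + Suc N)) f x - PP \<beta> (j * (k0 + Suc N)) g x\<bar> \<partial>U) \<le> 2 * (1 - c) ^ j + 4 * (E / real N ^ 8) / c"
    if N: "1 \<le> N" and "adm \<beta>" "K a f" "K a g" "(\<integral>x. f x \<partial>U) = 1" "(\<integral>x. g x \<partial>U) = 1" for N \<beta> f g j
    using that(2-)
  proof (induction j arbitrary: \<beta> f g)
    case 0
    have "0 \<le> 4 * (E / real N ^ 8) / c" using E c by simp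
    then show ?case using base[OF 0(2-)] by simp
  next
    case (Suc j)
    let ?m = "k0 + Suc N" and ?e = "E / real N ^ 8"
    note S = coupling_step[OF a c low N Suc.prems(1), folded E_def]
    obtain f' where f': "K a f'" "(\<integral>x. f' x \<partial>U) = 1"
      "(\<integral>x. \<bar>PP \<beta> ?m f x - (c * PP (sh k0 \<beta>) (Suc N) (\<lambda>_. 1) x + (1 - c) * f' x)\<bar> \<partial>U) \<le> 2 * ?e"
      using S[OF Suc.prems(2,4)] by blast
    obtain g' where g': "K a g'" "(\<integral>x. g' x \<partial>U) = 1"
      "(\<integral>x. \<bar>PP \<beta> ?m g x - (c * PP (sh k0 \<beta>) (Suc N) (\<lambda>_. 1) x + (1 - c) * g' x)\<bar> \<partial>U) \<le> 2 * ?e"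
      using S[OF Suc.prems(3,5)] by blast
    define q where "q x = c * PP (sh k0 \<beta>) (Suc N) (\<lambda>_. 1::real) x" for x
    define r where "r x = (PP \<beta> ?m f x - (q x + (1 - c) * f' x)) - (PP \<beta> ?m g x - (q x + (1 - c) * g' x))" for x
    let ?s = "sh ?m \<beta>"
    have s: "adm ?s" using adm_sh Suc.prems by auto
    have ints: "integrable U (PP \<beta> ?m f)" "integrable U (PP \<beta> ?m g)" "integrable U q" "integrable U f'" "integrable U g'"
      unfolding q_def using Suc.prems K_integrable f' g' PP_integrable(1)[OF adm_sh[OF Suc.prems(1)], of "\<lambda>_. 1::real"]
      by (auto intro!: PP_integrable(1) simp del: PP.simps)
    have ri: "integrable U r" unfolding r_def using ints by auto
    have rE: "(\<integral>x. \<bar>r x\<bar> \<partial>U) \<le> 4 * ?e"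
    proof -
      have "(\<integral>x. \<bar>r x\<bar> \<partial>U) \<le> (\<integral>x. \<bar>PP \<beta> ?m f x - (q x + (1 - c) * f' x)\<bar> + \<bar>PP \<beta> ?m g x - (q x + (1 - c) * g' x)\<bar> \<partial>U)"
        by (rule integral_mono) (use ints ri in \<open>auto simp: r_def\<close>)
      also have "\<dots> = (\<integral>x. \<bar>PP \<beta> ?m f x - (q x + (1 - c) * f' x)\<bar> \<partial>U) + (\<integral>x. \<bar>PP \<beta> ?m g x - (q x + (1 - c) * g' x)\<bar> \<partial>U)"
        by (rule Bochner_Integration.integral_add) (use ints in auto)
      also have "\<dots> \<le> 2 * ?e + 2 * ?e" unfolding q_def by (intro add_mono f'(3) g'(3))
      also have "\<dots> = 4 * ?e" by linarith
      finally show ?thesis .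
    qed
    have eq: "PP \<beta> (Suc j * ?m) f x - PP \<beta> (Suc j * ?m) g x
        = (1 - c) * (PP ?s (j * ?m) f' x - PP ?s (j * ?m) g' x) + PP ?s (j * ?m) r x" for x
    proof -
      have "(\<lambda>x. PP \<beta> ?m f x - PP \<beta> ?m g x) = (\<lambda>x. (1 - c) * (f' x - g' x) + r x)"
        by (auto simp: r_def algebra_simps)
      then have "PP ?s (j * ?m) (\<lambda>x. PP \<beta> ?m f x - PP \<beta> ?m g x) x = PP ?s (j * ?m) (\<lambda>x. (1 - c) * (f' x - g' x) + r x) x"
        by simp
      then show ?thesis
        unfolding mult_Suc PP_plus[of \<beta> ?m "j * ?m"] by (simp only: PP_add PP_diff PP_mult)
    qed
    have i1: "integrable U (\<lambda>x. PP ?s (j * ?m) f' x)" "integrable U (\<lambda>x. PP ?s (j * ?m) g' x)" "integrable U (PP ?s (j * ?m) r)"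
      using PP_integrable(1)[OF s] ints ri by auto
    have "(\<integral>x. \<bar>PP \<beta> (Suc j * ?m) f x - PP \<beta> (Suc j * ?m) g x\<bar> \<partial>U)
      \<le> (\<integral>x. (1 - c) * \<bar>PP ?s (j * ?m) f' x - PP ?s (j * ?m) g' x\<bar> + \<bar>PP ?s (j * ?m) r x\<bar> \<partial>U)"
      unfolding eq
      by (rule integral_mono) (use i1 c in \<open>auto simp: abs_mult intro!: order.trans[OF abs_triangle_ineq] Bochner_Integration.integrable_add
        Bochner_Integration.integrable_abs Bochner_Integration.integrable_mult_right Bochner_Integration.integrable_diff\<close>)
    also have "\<dots> = (1 - c) * (\<integral>x. \<bar>PP ?s (j * ?m) f' x - PP ?s (j * ?m) g' x\<bar> \<partial>U) + (\<integral>x. \<bar>PP ?s (j * ?m) r x\<bar> \<partial>U)"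
      using i1 by simp
    also have "\<dots> \<le> (1 - c) * (2 * (1 - c) ^ j + 4 * ?e / c) + 4 * ?e"
      using Suc.IH[OF s f'(1) g'(1) f'(2) g'(2)] PP_L1[OF s ri, of "j * ?m"] rE c
      by (intro add_mono mult_left_mono) auto
    also have "\<dots> = 2 * (1 - c) ^ Suc j + 4 * ?e / c" using c N by (simp add: field_simps)
    finally show ?case .
  qed
  \<comment> \<open>With this value a round of \<open>k0 + Suc N\<close> steps lasts at most
    \<open>\<kappa> * N\<close> as soon as \<open>N \<ge> 1\<close>.\<close>
  define \<kappa> where "\<kappa> = k0 + 2"
  define C1 where "C1 = 2 * (8 / c) ^ 8 + 4 * E / c"
  define C where "C = C1 * real (4 * \<kappa>) ^ 4 + 2 * real \<kappa> ^ 4 + 1"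
  have C1: "0 \<le> C1" using E c by (simp add: C1_def)
  have C: "0 < C" using C1 by (simp add: C_def add_nonneg_pos)
  have main: "(\<integral>x. \<bar>PP \<beta> n f x - PP \<beta> n g x\<bar> \<partial>U) \<le> C / real (Suc n) ^ 4"
    if fg: "adm \<beta>" "K a f" "K a g" "(\<integral>x. f x \<partial>U) = 1" "(\<integral>x. g x \<partial>U) = 1" for \<beta> f g n
  proof -
    \<comment> \<open>The distance does not increase in time, so steps left over after the last full
      round are harmless.\<close>
    have ml: "(\<integral>x. \<bar>PP \<beta> (m + l) f x - PP \<beta> (m + l) g x\<bar> \<partial>U) \<le> (\<integral>x. \<bar>PP \<beta> m f x - PP \<beta> m g x\<bar> \<partial>U)" for m l
    proof -
      have "integrable U (\<lambda>x. PP \<beta> m f x - PP \<beta> m g x)"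
        using PP_integrable(1)[OF fg(1)] K_integrable fg by (intro Bochner_Integration.integrable_diff) auto
      from PP_L1[OF adm_sh[OF fg(1), of m] this, of l] show ?thesis
        by (simp add: PP_diff PP_plus)
    qed
    show ?thesis
    proof (cases "n < \<kappa>")
      case True
      have "(\<integral>x. \<bar>PP \<beta> n f x - PP \<beta> n g x\<bar> \<partial>U) \<le> 2" using ml[of 0 n] base[OF fg(2-)] by simp
      also have "2 \<le> C / real (Suc n) ^ 4"
      proof -
        have "2 * real (Suc n) ^ 4 \<le> 2 * real \<kappa> ^ 4" using True by (intro mult_left_mono power_mono) auto
        also have "\<dots> \<le> C" using C1 by (simp add: C_def)
        finally show ?thesis by (simp add: pos_le_divide_eq)
      qed
      finally show ?thesis .
    next
      case False
      \<comment> \<open>\<open>N\<close> is about the square root of \<open>n / \<kappa>\<close>: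
        then \<open>N\<close> rounds of at most \<open>\<kappa> * N\<close> steps fit into time
        \<open>n\<close>, while minimality keeps \<open>n\<close> below a multiple of
        \<open>N ^ 2\<close>. The error N^-8 thereby becomes n^-4.\<close>
      define N where "N = (LEAST N. n < \<kappa> * (Suc N)^2)"
      have kp: "0 < \<kappa>" by (simp add: \<kappa>_def)
      have ex: "n < \<kappa> * (Suc n)^2"
        using kp by (metis One_nat_def Suc_le_eq le_square less_le_trans lessI mult.commute mult_le_mono mult_1_right power2_eq_square)
      have N1: "n < \<kappa> * (Suc N)^2" unfolding N_def by (rule LeastI, rule ex)
      have N0: "1 \<le> N" using N1 False by (cases N) auto
      then obtain N' where N': "N = Suc N'" by (cases N) auto
      have N2: "\<kappa> * N^2 \<le> n" using not_less_Least[of N' "\<lambda>N. n < \<kappa> * (Suc N)^2"] N' by (auto simp: N_def[symmetric])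
      have "N * (k0 + Suc N) \<le> N * (\<kappa> * N)"
      proof (intro mult_left_mono)
        have "k0 + Suc N \<le> (k0 + 1) * N + N" unfolding N' by simp
        then show "k0 + Suc N \<le> \<kappa> * N" by (simp add: \<kappa>_def algebra_simps)
      qed simp
      also have "\<dots> = \<kappa> * N^2" by (simp add: power2_eq_square)
      finally have le: "N * (k0 + Suc N) \<le> n" using N2 by linarith
      have "(\<integral>x. \<bar>PP \<beta> n f x - PP \<beta> n g x\<bar> \<partial>U) \<le> 2 * (1 - c) ^ N + 4 * (E / real N ^ 8) / c"
        using ml[of "N * (k0 + Suc N)" "n - N * (k0 + Suc N)"] iter[OF N0 fg, of N] le by simp
      also have "\<dots> \<le> C1 / real N ^ 8"
      proof -
        have Np: "0 < real N" using N0 by simp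
        \<comment> \<open>The geometric factor is compared with N^-8 by writing the exponential as
          an eighth power and using \<open>y \<le> exp y\<close>.\<close>
        have "(1 - c) ^ N \<le> exp (- c) ^ N"
          using c exp_ge_add_one_self[of "-c"] by (intro power_mono) auto
        also have "\<dots> = 1 / (exp (c * real N / 8)) ^ 8"
        proof -
          have "exp (- c) ^ N = exp (real N * (- c))" by (rule exp_of_nat_mult[symmetric])
          also have "\<dots> = inverse (exp (c * real N))" by (simp only: exp_minus[symmetric]) (simp add: mult.commute)
          also have "exp (c * real N) = exp (real 8 * (c * real N / 8))" by simp
          also have "\<dots> = exp (c * real N / 8) ^ 8" by (rule exp_of_nat_mult)
          finally show ?thesis by (simp only: inverse_eq_divide)
        qed
        also have "\<dots> \<le> 1 / (c * real N / 8) ^ 8"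
        proof -
          have "c * real N / 8 \<le> exp (c * real N / 8)" using exp_ge_add_one_self[of "c * real N / 8"] by linarith
          then have "(c * real N / 8) ^ 8 \<le> exp (c * real N / 8) ^ 8" using c by (intro power_mono) auto
          then show ?thesis using c Np by (intro frac_le zero_less_power) auto
        qed
        also have "\<dots> = (8 / c) ^ 8 / real N ^ 8" using c by (simp add: power_divide power_mult_distrib)
        finally have "2 * (1 - c) ^ N \<le> 2 * (8 / c) ^ 8 / real N ^ 8" by simp
        moreover have "C1 / real N ^ 8 = 2 * (8 / c) ^ 8 / real N ^ 8 + 4 * (E / real N ^ 8) / c"
          by (simp add: C1_def add_divide_distrib mult.commute)
        ultimately show ?thesis by linarith
      qed
      also have "\<dots> \<le> C / real (Suc n) ^ 4"
      proof -
        have "Suc n \<le> \<kappa> * (Suc N)^2" using N1 by simp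
        also have "\<dots> \<le> \<kappa> * (2 * N)^2" using N0 by (intro mult_left_mono power_mono) auto
        finally have "real (Suc n) \<le> real (4 * \<kappa> * N^2)" by (subst of_nat_le_iff) (simp add: power_mult_distrib)
        then have "real (Suc n) ^ 4 \<le> real (4 * \<kappa> * N^2) ^ 4" by (intro power_mono) auto
        also have "\<dots> = real (4 * \<kappa>) ^ 4 * real N ^ 8" by (simp add: power_mult_distrib)
        finally have "C1 * real (Suc n) ^ 4 \<le> C1 * (real (4 * \<kappa>) ^ 4 * real N ^ 8)" using C1 by (intro mult_left_mono)
        also have "\<dots> \<le> C * real N ^ 8"
          unfolding mult.assoc[symmetric] by (intro mult_right_mono) (auto simp: C_def)
        finally show ?thesis using N0 by (simp add: pos_le_divide_eq pos_divide_le_eq)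
      qed
      finally show ?thesis .
    qed
  qed
  show ?thesis using C main by blast
qed

text \<open>By homogeneity of the cone the estimate scales with the common mass. If that mass is 0,
  the cone bound forces both functions to vanish.\<close>

lemma memory_loss:
  assumes a: "12 \<le> a"
  shows "\<exists>C>0. \<forall>\<beta> f g n. adm \<beta> \<longrightarrow> K a f \<longrightarrow> K a g \<longrightarrow> (\<integral>x. f x \<partial>U) = (\<integral>x. g x \<partial>U) \<longrightarrow>
    (\<integral>x. \<bar>PP \<beta> n f x - PP \<beta> n g x\<bar> \<partial>U) \<le> C * (\<integral>x. f x \<partial>U) / real (Suc n) ^ 4"
proof -
  obtain C where C: "0 < C" "\<And>\<beta> f g n. adm \<beta> \<Longrightarrow> K a f \<Longrightarrow> K a g \<Longrightarrow> (\<integral>x. f x \<partial>U) = 1 \<Longrightarrow> (\<integral>x. g x \<partial>U) = 1 \<Longrightarrow>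
    (\<integral>x. \<bar>PP \<beta> n f x - PP \<beta> n g x\<bar> \<partial>U) \<le> C / real (Suc n) ^ 4"
    using memory_loss_unit[OF a] by blast
  have "(\<integral>x. \<bar>PP \<beta> n f x - PP \<beta> n g x\<bar> \<partial>U) \<le> C * (\<integral>x. f x \<partial>U) / real (Suc n) ^ 4"
    if fg: "adm \<beta>" "K a f" "K a g" "(\<integral>x. f x \<partial>U) = (\<integral>x. g x \<partial>U)" for \<beta> f g n
  proof (cases "(\<integral>x. f x \<partial>U) = 0")
    case True
    have d: "integrable U (\<lambda>x. f x - g x)" using K_integrable fg by auto
    have "f x = 0 \<and> g x = 0" if "0 < x" "x \<le> 1" for x
      using KD(2,3)[OF fg(2) that] KD(2,3)[OF fg(3) that] True fg(4) by auto
    then have "(\<integral>x. \<bar>f x - g x\<bar> \<partial>U) = (\<integral>x. 0 \<partial>U)"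
      by (intro Bochner_Integration.integral_cong) auto
    then show ?thesis using PP_L1[OF fg(1) d, of n] True by (simp add: PP_diff)
  next
    case False
    define \<mu> where "\<mu> = (\<integral>x. f x \<partial>U)"
    have \<mu>: "0 < \<mu>" using False K_int_nonneg[OF fg(2)] by (simp add: \<mu>_def)
    have "(\<integral>x. \<bar>PP \<beta> n (\<lambda>x. 1/\<mu> * f x) x - PP \<beta> n (\<lambda>x. 1/\<mu> * g x) x\<bar> \<partial>U) \<le> C / real (Suc n) ^ 4"
      using \<mu> fg by (intro C(2) K_scale) (auto simp: \<mu>_def[symmetric])
    also have "(\<lambda>x. \<bar>PP \<beta> n (\<lambda>x. 1/\<mu> * f x) x - PP \<beta> n (\<lambda>x. 1/\<mu> * g x) x\<bar>) = (\<lambda>x. \<bar>PP \<beta> n f x - PP \<beta> n g x\<bar> / \<mu>)"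
      unfolding PP_mult using \<mu> by (auto simp: diff_divide_distrib[symmetric])
    finally show ?thesis using \<mu> by (simp add: \<mu>_def[symmetric] pos_divide_le_eq mult_ac)
  qed
  then show ?thesis using C(1) by blast
qed

end

section \<open>Functions with modulus and variation controlled by a cone element\<close>

context lsv
begin

text \<open>\<open>G\<close> bounds \<open>F\<close> in modulus and dominates its variation, so that \<open>Re F + 2 G\<close> lies in a cone \<open>K a\<close>.\<close>

definition ctrl :: "(real \<Rightarrow> 'a::real_normed_vector) \<Rightarrow> (real \<Rightarrow> real) \<Rightarrow> bool" where
  "ctrl F G \<longleftrightarrow> (\<forall>x. 0 < x \<longrightarrow> x \<le> 1 \<longrightarrow> norm (F x) \<le> G x) \<and>
     (\<forall>x y. 0 < x \<longrightarrow> x \<le> y \<longrightarrow> y \<le> 1 \<longrightarrow> norm (F x - F y) \<le> G x - G y)"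

lemma ctrlD:
  assumes "ctrl F G"
  shows "0 < x \<Longrightarrow> x \<le> 1 \<Longrightarrow> norm (F x) \<le> G x" "0 < x \<Longrightarrow> x \<le> 1 \<Longrightarrow> 0 \<le> G x"
    "0 < x \<Longrightarrow> x \<le> y \<Longrightarrow> y \<le> 1 \<Longrightarrow> norm (F x - F y) \<le> G x - G y"
    "0 < x \<Longrightarrow> x \<le> y \<Longrightarrow> y \<le> 1 \<Longrightarrow> G y \<le> G x"
proof -
  show 1: "0 < x \<Longrightarrow> x \<le> 1 \<Longrightarrow> norm (F x) \<le> G x" and 2: "0 < x \<Longrightarrow> x \<le> y \<Longrightarrow> y \<le> 1 \<Longrightarrow> norm (F x - F y) \<le> G x - G y"
    using assms unfolding ctrl_def by auto
  show "0 < x \<Longrightarrow> x \<le> 1 \<Longrightarrow> 0 \<le> G x" using 1 norm_ge_zero[of "F x"] by linarith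
  show "0 < x \<Longrightarrow> x \<le> y \<Longrightarrow> y \<le> 1 \<Longrightarrow> G y \<le> G x" using 2 norm_ge_zero[of "F x - F y"] by linarith
qed

lemma ctrl_Re: "ctrl F G \<Longrightarrow> ctrl (\<lambda>x. Re (F x)) G"
  and ctrl_Im: "ctrl F G \<Longrightarrow> ctrl (\<lambda>x. Im (F x)) G"
  unfolding ctrl_def real_norm_def minus_complex.sel[symmetric]
  using abs_Re_le_cmod abs_Im_le_cmod order.trans by blast+

lemma ctrl_measurable_real:
  fixes F :: "real \<Rightarrow> real"
  assumes "ctrl F G"
  shows "F \<in> borel_measurable U"
proof -
  have m1: "G \<in> borel_measurable U" using ctrlD(4)[OF assms] by (rule borel_measurable_U_antimono)
  have m2: "(\<lambda>x. F x + G x) \<in> borel_measurable U"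
  proof (rule borel_measurable_U_antimono)
    fix x y :: real assume "0 < x" "x \<le> y" "y \<le> 1"
    from ctrlD(3)[OF assms this] show "F y + G y \<le> F x + G x" by simp
  qed
  from borel_measurable_diff[OF m2 m1] show ?thesis by simp
qed

lemma ctrl_measurable:
  fixes F :: "real \<Rightarrow> complex"
  assumes "ctrl F G"
  shows "F \<in> borel_measurable U"
  using ctrl_measurable_real[OF ctrl_Re[OF assms]] ctrl_measurable_real[OF ctrl_Im[OF assms]]
  by (simp add: borel_measurable_complex_iff)

lemma ctrl_integrable_real:
  fixes F :: "real \<Rightarrow> real"
  assumes "ctrl F G" "integrable U G"
  shows "integrable U F"
  by (rule Bochner_Integration.integrable_bound[OF assms(2) ctrl_measurable_real[OF assms(1)]])
     (rule AE_I2, use ctrlD(1)[OF assms(1)] in \<open>auto intro: order.trans[OF _ abs_ge_self]\<close>)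

lemma ctrl_integrable:
  fixes F :: "real \<Rightarrow> complex"
  assumes "ctrl F G" "integrable U G"
  shows "integrable U F"
  by (rule Bochner_Integration.integrable_bound[OF assms(2) ctrl_measurable[OF assms(1)]])
     (rule AE_I2, use ctrlD(1)[OF assms(1)] in \<open>auto intro: order.trans[OF _ abs_ge_self]\<close>)

text \<open>At the left preimages the difference splits into a change of weight,
  \<open>p - q\<close> times \<open>F u\<close>, and \<open>q\<close> times an increment of
  \<open>F\<close>. The first is paid by the modulus bound and the second by the variation bound,
  which is why \<open>ctrl\<close> demands both; \<open>p \<ge> q\<close> because the derivative
  increases.\<close>

lemma ctrl_transfer:
  assumes \<gamma>: "0 < \<gamma>" "\<gamma> \<le> 1" and F: "ctrl F G"
  shows "ctrl (transfer \<gamma> F) (transfer \<gamma> G)"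
  unfolding ctrl_def
proof (intro conjI allI impI)
  fix x :: real assume x: "0 < x" "x \<le> 1"
  have "norm (transfer \<gamma> F x) \<le> transfer \<gamma> (\<lambda>x. norm (F x)) x" by (rule transfer_norm[OF \<gamma>(1)])
  also have "\<dots> \<le> transfer \<gamma> G x" by (rule transfer_mono) (use \<gamma> x ctrlD[OF F] in auto)
  finally show "norm (transfer \<gamma> F x) \<le> transfer \<gamma> G x" .
next
  fix x y :: real assume xy: "0 < x" "x \<le> y" "y \<le> 1"
  define u v where "u = uinv \<gamma> x" and "v = uinv \<gamma> y"
  have uv: "0 < u" "u \<le> v" "v \<le> 1/2"
    using uinv[of \<gamma> x] uinv[of \<gamma> y] uinv_mono[of \<gamma> x y] \<gamma> xy by (auto simp: u_def v_def)
  define p q where "p = inverse (dT \<gamma> u)" and "q = inverse (dT \<gamma> v)"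
  have "1 < dT \<gamma> u" using dT_bounds[of \<gamma> u] uv \<gamma> by auto
  moreover have "dT \<gamma> u \<le> dT \<gamma> v" using dT_mono uv \<gamma> by auto
  ultimately have pq: "0 < q" "q \<le> p" unfolding p_def q_def by (auto intro: le_imp_inverse_le)
  have e: "transfer \<gamma> F x - transfer \<gamma> F y = (p - q) *\<^sub>R F u + q *\<^sub>R (F u - F v) + (F ((x+1)/2) - F ((y+1)/2)) /\<^sub>R 2"
    unfolding transfer_def u_def[symmetric] v_def[symmetric] p_def[symmetric] q_def[symmetric]
    by (simp add: algebra_simps)
  have "norm (transfer \<gamma> F x - transfer \<gamma> F y) \<le> norm ((p - q) *\<^sub>R F u) + norm (q *\<^sub>R (F u - F v)) + norm ((F ((x+1)/2) - F ((y+1)/2)) /\<^sub>R 2)"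
    unfolding e by (rule order.trans[OF norm_triangle_ineq add_right_mono[OF norm_triangle_ineq]])
  also have "\<dots> = (p - q) * norm (F u) + q * norm (F u - F v) + norm (F ((x+1)/2) - F ((y+1)/2)) / 2"
    using pq by simp
  also have "\<dots> \<le> (p - q) * G u + q * (G u - G v) + (G ((x+1)/2) - G ((y+1)/2)) / 2"
    using pq ctrlD[OF F] uv xy by (intro add_mono mult_left_mono divide_right_mono) auto
  also have "\<dots> = transfer \<gamma> G x - transfer \<gamma> G y"
    unfolding transfer_def u_def[symmetric] v_def[symmetric] p_def[symmetric] q_def[symmetric] real_scaleR_def
    by (simp add: algebra_simps diff_divide_distrib)
  finally show "norm (transfer \<gamma> F x - transfer \<gamma> F y) \<le> transfer \<gamma> G x - transfer \<gamma> G y" .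
qed

text \<open>The slope of \<open>X\<close> has modulus al x^(-al-1), which on the unit interval is at
  least \<open>al\<close> times the weight. This charges the oscillation of a Lipschitz factor to
  the decrease of \<open>X\<close>.\<close>

lemma X_variation:
  assumes "0 < x" "x \<le> y" "y \<le> 1"
  shows "X y * (y - x) \<le> (X x - X y) / al"
proof -
  have "1 + al * (1 - x / y) \<le> 1 + al * ln (y / x)"
  proof -
    have "1 - x / y \<le> ln (y / x)" using ln_le_minus_one[of "x / y"] assms by (simp add: ln_div)
    then show ?thesis using al by simp
  qed
  also have "\<dots> \<le> exp (al * ln (y / x))" by (rule exp_ge_add_one_self)
  also have "\<dots> = X x / X y" using assms by (simp add: powr_def ln_div exp_diff[symmetric] algebra_simps)
  finally have "(1 + al * (1 - x / y)) * X y \<le> X x" using assms by (simp add: pos_le_divide_eq)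
  then have "al * ((1 - x / y) * X y) \<le> X x - X y" by (simp add: algebra_simps)
  moreover have "X y * (y - x) \<le> (1 - x / y) * X y"
  proof -
    have "(y - x) * y \<le> (y - x) * 1" using assms by (intro mult_left_mono) auto
    then have "y - x \<le> 1 - x / y" using assms by (simp add: field_simps)
    then have "X y * (y - x) \<le> X y * (1 - x / y)" by (intro mult_left_mono) auto
    then show ?thesis by (simp only: mult.commute)
  qed
  ultimately have "al * (X y * (y - x)) \<le> X x - X y" using al by (meson mult_left_mono less_imp_le order.trans)
  then show ?thesis using al by (simp add: pos_le_divide_eq mult.commute)
qed

text \<open>The product rule with the increment of \<open>w\<close> multiplied by \<open>F\<close>
  at the larger point, where \<open>F\<close> is bounded by \<open>12 * X y\<close> as
  \<open>X_variation\<close> requires. The fixed bound on \<open>F\<close> keeps the additional term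
  independent of \<open>G\<close>.\<close>

lemma ctrl_mult:
  fixes F w :: "real \<Rightarrow> 'a::real_normed_algebra"
  assumes F: "ctrl F G" and FX: "\<And>x. 0 < x \<Longrightarrow> x \<le> 1 \<Longrightarrow> norm (F x) \<le> 12 * X x"
    and w: "\<And>x. 0 < x \<Longrightarrow> x \<le> 1 \<Longrightarrow> norm (w x) \<le> B"
      "\<And>x y. 0 < x \<Longrightarrow> x \<le> y \<Longrightarrow> y \<le> 1 \<Longrightarrow> norm (w x - w y) \<le> lip * (y - x)"
    and lip: "0 \<le> lip"
  shows "ctrl (\<lambda>x. w x * F x) (\<lambda>x. B * G x + 12 * lip / al * X x)"
proof -
  have B: "0 \<le> B" using w(1)[of 1] norm_ge_zero[of "w 1"] by linarith
  show ?thesis unfolding ctrl_def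
  proof (intro conjI allI impI)
    fix x :: real assume x: "0 < x" "x \<le> 1"
    have "norm (w x * F x) \<le> B * G x"
      using ctrlD[OF F] w(1) x B by (intro order.trans[OF norm_mult_ineq] mult_mono) auto
    moreover have "0 \<le> 12 * lip / al * X x" using lip al by simp
    ultimately show "norm (w x * F x) \<le> B * G x + 12 * lip / al * X x" by linarith
  next
    fix x y :: real assume xy: "0 < x" "x \<le> y" "y \<le> 1"
    have "w x * F x - w y * F y = w x * (F x - F y) + (w x - w y) * F y" by (simp add: algebra_simps)
    then have "norm (w x * F x - w y * F y) \<le> norm (w x) * norm (F x - F y) + norm (w x - w y) * norm (F y)"
      by (simp only:) (rule order.trans[OF norm_triangle_ineq add_mono[OF norm_mult_ineq norm_mult_ineq]])
    also have "\<dots> \<le> B * (G x - G y) + lip * (y - x) * (12 * X y)"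
      using ctrlD[OF F] w FX xy B lip by (intro add_mono mult_mono) auto
    also have "lip * (y - x) * (12 * X y) = 12 * lip * (X y * (y - x))" by simp
    also have "\<dots> \<le> 12 * lip * ((X x - X y) / al)" using X_variation[OF xy] lip by (intro mult_left_mono) auto
    finally show "norm (w x * F x - w y * F y) \<le> B * G x + 12 * lip / al * X x - (B * G y + 12 * lip / al * X y)"
      by (simp add: algebra_simps diff_divide_distrib)
  qed
qed

lemma ctrl_self: "K a f \<Longrightarrow> ctrl f f"
  using KD[of a f] by (auto simp: ctrl_def)

text \<open>\<open>F\<close> itself need not be in a cone, but \<open>F + 2 * G\<close> and
  \<open>2 * G\<close> are, and each is compared with a multiple of \<open>\<psi>\<close> of the
  same mass. Adding \<open>2 * G\<close> rather than \<open>G\<close> keeps the mass at least that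
  of \<open>G\<close>; together with \<open>F + 2 * G \<le> 3 * G\<close> this gives the cone
  constant 36.\<close>

lemma decorrelation_real:
  "\<exists>C>0. \<forall>\<beta> F G \<psi> n. adm \<beta> \<longrightarrow> ctrl F G \<longrightarrow> K 12 G \<longrightarrow> K 12 \<psi> \<longrightarrow> (\<integral>x. \<psi> x \<partial>U) = 1 \<longrightarrow>
    (\<integral>x. \<bar>PP \<beta> n F x - (\<integral>x. F x \<partial>U) * PP \<beta> n \<psi> x\<bar> \<partial>U) \<le> C * (\<integral>x. G x \<partial>U) / real (Suc n) ^ 4"
proof -
  obtain C where C: "0 < C" "\<And>\<beta> f g n. adm \<beta> \<Longrightarrow> K 36 f \<Longrightarrow> K 36 g \<Longrightarrow> (\<integral>x. f x \<partial>U) = (\<integral>x. g x \<partial>U) \<Longrightarrow>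
    (\<integral>x. \<bar>PP \<beta> n f x - PP \<beta> n g x\<bar> \<partial>U) \<le> C * (\<integral>x. f x \<partial>U) / real (Suc n) ^ 4"
    using memory_loss[of 36] by auto
  have "(\<integral>x. \<bar>PP \<beta> n F x - (\<integral>x. F x \<partial>U) * PP \<beta> n \<psi> x\<bar> \<partial>U) \<le> (5 * C) * (\<integral>x. G x \<partial>U) / real (Suc n) ^ 4"
    if \<beta>: "adm \<beta>" and F: "ctrl F G" and G: "K 12 G" and \<psi>: "K 12 \<psi>" "(\<integral>x. \<psi> x \<partial>U) = 1" for \<beta> F G \<psi> n
  proof -
    note i = ctrl_integrable_real[OF F K_integrable[OF G]] K_integrable[OF G] K_integrable[OF \<psi>(1)]
    define M where "M = (\<integral>x. G x \<partial>U)"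
    define \<rho> where "\<rho> = (\<integral>x. F x \<partial>U)"
    have M0: "0 \<le> M" using K_int_nonneg[OF G] by (simp add: M_def)
    have \<rho>: "\<bar>\<rho>\<bar> \<le> M" unfolding \<rho>_def M_def
      by (rule order.trans[OF integral_abs_bound integral_mono]) (use i ctrlD(1)[OF F] in auto)
    define f where "f x = F x + 2 * G x" for x
    have fi: "(\<integral>x. f x \<partial>U) = \<rho> + 2 * M" using i by (simp add: f_def \<rho>_def M_def)
    have fK: "K 36 f" unfolding K_def fi
    proof (intro conjI allI impI)
      fix x y :: real assume xy: "0 < x" "x \<le> y" "y \<le> 1"
      show "f y \<le> f x" using ctrlD(3,4)[OF F xy] by (auto simp: f_def abs_le_iff)
    next
      fix x :: real assume x: "0 < x" "x \<le> 1"
      show "0 \<le> f x" using ctrlD(1,2)[OF F x] by (auto simp: f_def abs_le_iff)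
      have "f x \<le> 3 * G x" using ctrlD(1)[OF F x] by (auto simp: f_def abs_le_iff)
      also have "\<dots> \<le> 3 * (12 * M * X x)" using KD(3)[OF G x] by (simp add: M_def)
      also have "\<dots> = 36 * M * X x" by simp
      also have "\<dots> \<le> 36 * (\<rho> + 2 * M) * X x" using \<rho> by (intro mult_right_mono mult_left_mono) (auto simp: abs_le_iff)
      finally show "f x \<le> 36 * (\<rho> + 2 * M) * X x" .
    qed
    have s: "0 \<le> \<rho> + 2 * M" using \<rho> M0 by (simp add: abs_le_iff)
    have \<psi>36: "K 36 \<psi>" "K 36 G" using K_mono \<psi> G by auto
    have 1: "(\<integral>x. \<bar>PP \<beta> n f x - PP \<beta> n (\<lambda>x. (\<rho> + 2 * M) * \<psi> x) x\<bar> \<partial>U) \<le> C * (\<rho> + 2 * M) / real (Suc n) ^ 4"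
      unfolding fi[symmetric]
      by (rule C(2)[OF \<beta> fK K_scale[OF \<psi>36(1)]]) (use \<psi> fi s in auto)
    have 2: "(\<integral>x. \<bar>PP \<beta> n (\<lambda>x. 2 * G x) x - PP \<beta> n (\<lambda>x. (2 * M) * \<psi> x) x\<bar> \<partial>U) \<le> C * (\<integral>x. 2 * G x \<partial>U) / real (Suc n) ^ 4"
      by (rule C(2)[OF \<beta> K_scale[OF \<psi>36(2)] K_scale[OF \<psi>36(1)]]) (use \<psi> M0 in \<open>auto simp: M_def\<close>)
    define A where "A x = PP \<beta> n f x - PP \<beta> n (\<lambda>x. (\<rho> + 2 * M) * \<psi> x) x" for x
    define B where "B x = PP \<beta> n (\<lambda>x. 2 * G x) x - PP \<beta> n (\<lambda>x. (2 * M) * \<psi> x) x" for x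
    have e: "PP \<beta> n F x - \<rho> * PP \<beta> n \<psi> x = A x - B x" for x
    proof -
      have "PP \<beta> n f = (\<lambda>x. PP \<beta> n F x + 2 * PP \<beta> n G x)"
        unfolding f_def by (simp add: PP_add PP_mult)
      from fun_cong[OF this, of x] show ?thesis unfolding A_def B_def PP_mult by (simp add: algebra_simps)
    qed
    have AB: "integrable U A" "integrable U B"
      unfolding A_def B_def using i K_integrable[OF fK]
      by (intro Bochner_Integration.integrable_diff PP_integrable(1)[OF \<beta>] integrable_mult_right; simp)+
    have "(\<integral>x. \<bar>A x - B x\<bar> \<partial>U) \<le> (\<integral>x. \<bar>A x\<bar> + \<bar>B x\<bar> \<partial>U)"
      by (rule integral_mono) (use AB in auto)
    also have "\<dots> = (\<integral>x. \<bar>A x\<bar> \<partial>U) + (\<integral>x. \<bar>B x\<bar> \<partial>U)" using AB by simp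
    also have "\<dots> \<le> C * (\<rho> + 2 * M) / real (Suc n) ^ 4 + C * (\<integral>x. 2 * G x \<partial>U) / real (Suc n) ^ 4"
      using 1 2 unfolding A_def B_def by (rule add_mono)
    also have "\<dots> = (C * (\<rho> + 2 * M) + C * (2 * M)) / real (Suc n) ^ 4" by (simp add: M_def add_divide_distrib)
    also have "\<dots> \<le> (5 * C) * M / real (Suc n) ^ 4"
    proof (rule divide_right_mono)
      have "C * (\<rho> + 2 * M) \<le> C * (3 * M)" using \<rho> C(1) by (intro mult_left_mono) (auto simp: abs_le_iff)
      then show "C * (\<rho> + 2 * M) + C * (2 * M) \<le> 5 * C * M" by (simp add: algebra_simps)
    qed simp
    finally show ?thesis unfolding \<rho>_def[symmetric] M_def[symmetric] e .
  qed
  then show ?thesis using C(1) by (intro exI[of _ "5 * C"]) simp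
qed

lemma decorrelation_complex:
  "\<exists>C>0. \<forall>\<beta> F G \<psi> n. adm \<beta> \<longrightarrow> ctrl F G \<longrightarrow> K 12 G \<longrightarrow> K 12 \<psi> \<longrightarrow> (\<integral>x. \<psi> x \<partial>U) = 1 \<longrightarrow>
    (\<integral>x. norm (PP \<beta> n F x - (\<integral>x. F x \<partial>U) * complex_of_real (PP \<beta> n \<psi> x)) \<partial>U) \<le> C * (\<integral>x. G x \<partial>U) / real (Suc n) ^ 4"
proof -
  obtain C where C: "0 < C" "\<And>\<beta> F G \<psi> n. adm \<beta> \<Longrightarrow> ctrl F G \<Longrightarrow> K 12 G \<Longrightarrow> K 12 \<psi> \<Longrightarrow> (\<integral>x. \<psi> x \<partial>U) = 1 \<Longrightarrow>
    (\<integral>x. \<bar>PP \<beta> n F x - (\<integral>x. F x \<partial>U) * PP \<beta> n \<psi> x\<bar> \<partial>U) \<le> C * (\<integral>x. G x \<partial>U) / real (Suc n) ^ 4"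
    using decorrelation_real by blast
  have "(\<integral>x. norm (PP \<beta> n F x - (\<integral>x. F x \<partial>U) * complex_of_real (PP \<beta> n \<psi> x)) \<partial>U) \<le> (2 * C) * (\<integral>x. G x \<partial>U) / real (Suc n) ^ 4"
    if \<beta>: "adm \<beta>" and F: "ctrl F G" and G: "K 12 G" and \<psi>: "K 12 \<psi>" "(\<integral>x. \<psi> x \<partial>U) = 1"
    for \<beta> and F :: "real \<Rightarrow> complex" and G \<psi> n
  proof -
    note i = ctrl_integrable[OF F K_integrable[OF G]] K_integrable[OF \<psi>(1)]
    define D where "D x = PP \<beta> n F x - (\<integral>x. F x \<partial>U) * complex_of_real (PP \<beta> n \<psi> x)" for x
    have Di: "integrable U D" unfolding D_def
      using PP_integrable(1)[OF \<beta> i(1)] PP_integrable(1)[OF \<beta> i(2)]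
      by (intro Bochner_Integration.integrable_diff integrable_mult_right integrable_of_real)
    have Re: "Re (D x) = PP \<beta> n (\<lambda>x. Re (F x)) x - (\<integral>x. Re (F x) \<partial>U) * PP \<beta> n \<psi> x" for x
      using i by (simp add: D_def PP_Re)
    have Im: "Im (D x) = PP \<beta> n (\<lambda>x. Im (F x)) x - (\<integral>x. Im (F x) \<partial>U) * PP \<beta> n \<psi> x" for x
      using i by (simp add: D_def PP_Im)
    have "(\<integral>x. norm (D x) \<partial>U) \<le> (\<integral>x. \<bar>Re (D x)\<bar> + \<bar>Im (D x)\<bar> \<partial>U)"
      by (rule integral_mono) (use Di cmod_le in \<open>auto intro!: integrable_Re integrable_Im\<close>)
    also have "\<dots> = (\<integral>x. \<bar>Re (D x)\<bar> \<partial>U) + (\<integral>x. \<bar>Im (D x)\<bar> \<partial>U)" using Di by simp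
    also have "\<dots> \<le> C * (\<integral>x. G x \<partial>U) / real (Suc n) ^ 4 + C * (\<integral>x. G x \<partial>U) / real (Suc n) ^ 4"
      unfolding Re Im by (intro add_mono C(2)[OF \<beta> _ G \<psi>] ctrl_Re ctrl_Im F)
    finally show ?thesis unfolding D_def by simp
  qed
  then show ?thesis using C(1) by (intro exI[of _ "2 * C"]) simp
qed

section \<open>Decorrelation for twisted operators\<close>

text \<open>The density of the image under \<open>k\<close> maps of Lebesgue measure weighted by the
  phases collected on the way, as \<open>twist_duality\<close> shows. The phase of time
  \<open>j\<close> is inserted after the \<open>j\<close>-th operator, matching sums that start at
  time 1.\<close>

fun twist :: "(nat \<Rightarrow> real \<Rightarrow> real) \<Rightarrow> (nat \<Rightarrow> real) \<Rightarrow> nat \<Rightarrow> real \<Rightarrow> complex" where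
  "twist \<theta> \<beta> 0 = (\<lambda>_. 1)"
| "twist \<theta> \<beta> (Suc k) = (\<lambda>x. cis (\<theta> (Suc k) x) * transfer (\<beta> (Suc k)) (twist \<theta> \<beta> k) x)"

lemma cis_lipschitz: "norm (cis a - cis b) \<le> \<bar>a - b\<bar>"
proof -
  have "norm (cis a - cis b) = norm (cis b * (cis (a - b) - 1))"
    by (simp add: cis_mult algebra_simps)
  also have "\<dots> = norm (exp (\<i> * of_real (a - b)) - 1)" by (simp add: norm_mult cis_conv_exp)
  also have "\<dots> \<le> \<bar>a - b\<bar>" using iexp_approx1[of "a - b" 0] by simp
  finally show ?thesis .
qed

lemma PP_one_bound: "adm \<beta> \<Longrightarrow> 0 < x \<Longrightarrow> x \<le> 1 \<Longrightarrow> PP \<beta> k (\<lambda>_. 1) x \<le> 12 * X x"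
  using KD(3)[OF PP_K[OF _ _ K_one[of 12]], of \<beta> x k] PP_integrable(2)[of \<beta> "\<lambda>_. 1::real" k] U.prob_space by simp

text \<open>Each step adds \<open>12 * lip / al\<close> times \<open>X\<close>, whose integral is at
  most 2; hence the linear growth of the mass. The modulus is bounded separately, since phases do
  not increase it, and this bound \<open>12 * X\<close> uniform in \<open>k\<close> is what makes
  \<open>ctrl_mult\<close> applicable at every step.\<close>

lemma twist_ctrl:
  assumes \<beta>: "adm \<beta>" and lip: "0 \<le> lip"
    and \<theta>: "\<And>j x y. 0 < x \<Longrightarrow> x \<le> y \<Longrightarrow> y \<le> 1 \<Longrightarrow> \<bar>\<theta> j x - \<theta> j y\<bar> \<le> lip * (y - x)"
  shows "\<exists>G. K 12 G \<and> ctrl (twist \<theta> \<beta> k) G \<and> (\<integral>x. G x \<partial>U) \<le> 1 + real k * (24 * lip / al)"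
    and "0 < x \<Longrightarrow> x \<le> 1 \<Longrightarrow> norm (twist \<theta> \<beta> k x) \<le> PP \<beta> k (\<lambda>_. 1) x"
proof -
  have nb: "norm (twist \<theta> \<beta> k x) \<le> PP \<beta> k (\<lambda>_. 1) x" if "0 < x" "x \<le> 1" for k x
    using that
  proof (induction k arbitrary: x)
    case (Suc k)
    have "norm (twist \<theta> \<beta> (Suc k) x) \<le> transfer (\<beta> (Suc k)) (\<lambda>x. norm (twist \<theta> \<beta> k x)) x"
      using transfer_norm[OF admD(1)[OF \<beta>]] by (simp add: norm_mult)
    also have "\<dots> \<le> PP \<beta> (Suc k) (\<lambda>_. 1) x"
      unfolding PP.simps by (rule transfer_mono[OF admD(1)[OF \<beta>]]) (use Suc in auto)
    finally show ?case .
  qed simp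
  then show "0 < x \<Longrightarrow> x \<le> 1 \<Longrightarrow> norm (twist \<theta> \<beta> k x) \<le> PP \<beta> k (\<lambda>_. 1) x" .
  show "\<exists>G. K 12 G \<and> ctrl (twist \<theta> \<beta> k) G \<and> (\<integral>x. G x \<partial>U) \<le> 1 + real k * (24 * lip / al)"
  proof (induction k)
    case 0
    show ?case by (rule exI[of _ "\<lambda>_. 1"]) (auto simp: K_one ctrl_def U.prob_space[unfolded space_U])
  next
    case (Suc k)
    then obtain G where G: "K 12 G" "ctrl (twist \<theta> \<beta> k) G" "(\<integral>x. G x \<partial>U) \<le> 1 + real k * (24 * lip / al)" by blast
    let ?\<gamma> = "\<beta> (Suc k)"
    note \<gamma> = admD[OF \<beta>, of k]
    let ?G = "\<lambda>x. 1 * transfer ?\<gamma> G x + 12 * lip / al * X x"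
    have "ctrl (twist \<theta> \<beta> (Suc k)) ?G"
      unfolding twist.simps
    proof (rule ctrl_mult[OF ctrl_transfer[OF \<gamma>(1,3) G(2)]])
      fix x :: real assume x: "0 < x" "x \<le> 1"
      have "norm (transfer ?\<gamma> (twist \<theta> \<beta> k) x) = norm (twist \<theta> \<beta> (Suc k) x)" by (simp add: norm_mult)
      also have "\<dots> \<le> 12 * X x" using nb[OF x, of "Suc k"] PP_one_bound[OF \<beta> x, of "Suc k"] by linarith
      finally show "norm (transfer ?\<gamma> (twist \<theta> \<beta> k) x) \<le> 12 * X x" .
    next
      fix x y :: real assume "0 < x" "x \<le> y" "y \<le> 1"
      then show "norm (cis (\<theta> (Suc k) x) - cis (\<theta> (Suc k) y)) \<le> lip * (y - x)"
        using \<theta>[of x y "Suc k"] cis_lipschitz order.trans by blast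
    qed (use lip in auto)
    moreover have "K 12 ?G"
      using transfer_K[OF \<gamma>(1,2) _ G(1)] K_X[of 12] lip al by (intro K_add K_scale) auto
    moreover have "(\<integral>x. ?G x \<partial>U) \<le> 1 + real (Suc k) * (24 * lip / al)"
    proof -
      have "(\<integral>x. ?G x \<partial>U) = (\<integral>x. G x \<partial>U) + 12 * lip / al * (\<integral>x. X x \<partial>U)"
        using transfer_integrable[OF \<gamma>(1,3) K_integrable[OF G(1)]] X_integral(1) by simp
      also have "\<dots> \<le> (1 + real k * (24 * lip / al)) + 12 * lip / al * 2"
        using G(3) X_integral(3) lip al by (intro add_mono mult_left_mono) auto
      finally show ?thesis by (simp add: algebra_simps add_divide_distrib)
    qed
    ultimately show ?case by blast
  qed
qed

text \<open>Induction with \<open>W\<close> generalised: the last phase is absorbed into the test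
  function \<open>V\<close>, whose modulus remains at most 1.\<close>

lemma twist_duality:
  assumes \<beta>: "adm \<beta>" and lip: "0 \<le> lip"
    and \<theta>: "\<And>j x y. 0 < x \<Longrightarrow> x \<le> y \<Longrightarrow> y \<le> 1 \<Longrightarrow> \<bar>\<theta> j x - \<theta> j y\<bar> \<le> lip * (y - x)"
    and \<theta>m: "\<And>j. \<theta> j \<in> borel_measurable U"
    and W: "W \<in> borel_measurable U" "\<And>x. 0 < x \<Longrightarrow> x \<le> 1 \<Longrightarrow> norm (W x) \<le> 1"
  shows "(\<integral>x. cis (\<Sum>j=1..k. \<theta> j (seqT \<beta> j x)) * W (seqT \<beta> k x) \<partial>U) = (\<integral>x. W x * twist \<theta> \<beta> k x \<partial>U)"
  using W
proof (induction k arbitrary: W)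
  case 0
  then show ?case by simp
next
  case (Suc k)
  let ?\<gamma> = "\<beta> (Suc k)"
  note \<gamma> = admD[OF \<beta>, of k]
  define V where "V x = cis (\<theta> (Suc k) x) * W x" for x
  have cm: "cis \<in> borel_measurable borel" by (intro borel_measurable_continuous_onI continuous_intros)
  have Vm: "V \<in> borel_measurable U"
    unfolding V_def by (intro borel_measurable_times Suc.prems(1) measurable_compose[OF \<theta>m cm])
  have Vb: "norm (V x) \<le> 1" if "0 < x" "x \<le> 1" for x using Suc.prems(2)[OF that] by (simp add: V_def norm_mult)
  have VTm: "(\<lambda>x. V (LSV ?\<gamma> x)) \<in> borel_measurable U" by (rule measurable_compose[OF LSV_measurable_U[OF \<gamma>(1)] Vm])
  have "\<exists>G. K 12 G \<and> ctrl (twist \<theta> \<beta> k) G \<and> (\<integral>x. G x \<partial>U) \<le> 1 + real k * (24 * lip / al)"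
    by (rule twist_ctrl(1)[OF \<beta> lip \<theta>])
  then obtain G where G: "K 12 G" "ctrl (twist \<theta> \<beta> k) G" by blast
  note ti = ctrl_integrable[OF G(2) K_integrable[OF G(1)]]
  have "(\<integral>x. cis (\<Sum>j=1..Suc k. \<theta> j (seqT \<beta> j x)) * W (seqT \<beta> (Suc k) x) \<partial>U)
     = (\<integral>x. cis (\<Sum>j=1..k. \<theta> j (seqT \<beta> j x)) * V (LSV ?\<gamma> (seqT \<beta> k x)) \<partial>U)"
    by (rule Bochner_Integration.integral_cong) (auto simp: V_def cis_mult[symmetric] mult_ac)
  also have "\<dots> = (\<integral>x. V (LSV ?\<gamma> x) * twist \<theta> \<beta> k x \<partial>U)"
    by (rule Suc.IH[OF VTm]) (use Vb LSV_in[OF \<gamma>(1)] in auto)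
  also have "\<dots> = (\<integral>x. V x * transfer ?\<gamma> (twist \<theta> \<beta> k) x \<partial>U)"
  proof (rule transfer_duality(2)[OF \<gamma>(1,3) _ Vm, symmetric])
    show "twist \<theta> \<beta> k \<in> borel_measurable U" using ti by auto
    show "integrable U (\<lambda>x. V (LSV ?\<gamma> x) * twist \<theta> \<beta> k x)"
    proof (rule Bochner_Integration.integrable_bound[OF ti], intro borel_measurable_times VTm)
      show "twist \<theta> \<beta> k \<in> borel_measurable U" using ti by auto
      show "AE x in U. norm (V (LSV ?\<gamma> x) * twist \<theta> \<beta> k x) \<le> norm (twist \<theta> \<beta> k x)"
        by (rule AE_I2) (use Vb LSV_in[OF \<gamma>(1)] in \<open>auto simp: norm_mult intro!: mult_left_le_one_le\<close>)
    qed
  qed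
  also have "\<dots> = (\<integral>x. W x * twist \<theta> \<beta> (Suc k) x \<partial>U)"
    by (rule Bochner_Integration.integral_cong) (auto simp: V_def mult_ac)
  finally show ?case .
qed

lemma integral_mult_bound:
  fixes W D :: "real \<Rightarrow> 'a::{real_normed_field, banach, second_countable_topology}"
  assumes "integrable U D" "W \<in> borel_measurable U" "\<And>x. 0 < x \<Longrightarrow> x \<le> 1 \<Longrightarrow> norm (W x) \<le> B"
  shows "integrable U (\<lambda>x. W x * D x)" "norm (\<integral>x. W x * D x \<partial>U) \<le> B * (\<integral>x. norm (D x) \<partial>U)"
proof -
  have B: "0 \<le> B" using assms(3)[of 1] norm_ge_zero[of "W 1"] by linarith
  have le: "norm (W x * D x) \<le> B * norm (D x)" if "0 < x" "x \<le> 1" for x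
    using assms(3)[OF that] by (simp add: norm_mult mult_right_mono)
  show i: "integrable U (\<lambda>x. W x * D x)"
    by (rule Bochner_Integration.integrable_bound[of _ "\<lambda>x. B * norm (D x)"])
       (use assms le B in \<open>auto intro!: borel_measurable_times AE_I2\<close>)
  have "norm (\<integral>x. W x * D x \<partial>U) \<le> (\<integral>x. norm (W x * D x) \<partial>U)" by (rule integral_norm_bound)
  also have "\<dots> \<le> (\<integral>x. B * norm (D x) \<partial>U)"
    by (rule integral_mono) (use i assms le in auto)
  finally show "norm (\<integral>x. W x * D x \<partial>U) \<le> B * (\<integral>x. norm (D x) \<partial>U)" by simp
qed

text \<open>Phases up to time \<open>k\<close> turn the initial density into a twisted one dominated
  with mass 1 + O(k lip). The \<open>q\<close> following steps carry no phase and bring it close to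
  its integral times the untwisted density, against which \<open>W\<close> is then
  integrated.\<close>

lemma twisted_decorrelation:
  "\<exists>C>0. \<forall>\<beta> \<theta> lip W k q. adm \<beta> \<longrightarrow> 0 \<le> lip \<longrightarrow>
     (\<forall>j x y. 0 < x \<longrightarrow> x \<le> y \<longrightarrow> y \<le> 1 \<longrightarrow> \<bar>\<theta> j x - \<theta> j y\<bar> \<le> lip * (y - x)) \<longrightarrow>
     (\<forall>j. \<theta> j \<in> borel_measurable U) \<longrightarrow>
     W \<in> borel_measurable U \<longrightarrow> (\<forall>x. 0 < x \<longrightarrow> x \<le> 1 \<longrightarrow> norm (W x) \<le> 1) \<longrightarrow>
     norm ((\<integral>x. cis (\<Sum>j=1..k. \<theta> j (seqT \<beta> j x)) * W (seqT \<beta> (k + q) x) \<partial>U)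
        - (\<integral>x. cis (\<Sum>j=1..k. \<theta> j (seqT \<beta> j x)) \<partial>U) * (\<integral>x. W (seqT \<beta> (k + q) x) \<partial>U))
     \<le> C * (1 + real k * lip) / real (Suc q) ^ 4"
proof -
  obtain C where C: "0 < C" "\<And>\<beta> F G \<psi> n. adm \<beta> \<Longrightarrow> ctrl F G \<Longrightarrow> K 12 G \<Longrightarrow> K 12 \<psi> \<Longrightarrow> (\<integral>x. \<psi> x \<partial>U) = 1 \<Longrightarrow>
    (\<integral>x. norm (PP \<beta> n F x - (\<integral>x. F x \<partial>U) * complex_of_real (PP \<beta> n \<psi> x)) \<partial>U) \<le> C * (\<integral>x. G x \<partial>U) / real (Suc n) ^ 4"
    using decorrelation_complex by blast
  define C' where "C' = C * (1 + 24 / al)"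
  have C': "0 < C'" using C(1) al by (simp add: C'_def add_pos_nonneg)
  have "norm ((\<integral>x. cis (\<Sum>j=1..k. \<theta> j (seqT \<beta> j x)) * W (seqT \<beta> (k + q) x) \<partial>U)
        - (\<integral>x. cis (\<Sum>j=1..k. \<theta> j (seqT \<beta> j x)) \<partial>U) * (\<integral>x. W (seqT \<beta> (k + q) x) \<partial>U))
     \<le> C' * (1 + real k * lip) / real (Suc q) ^ 4"
    if \<beta>: "adm \<beta>" and lip: "0 \<le> lip"
      and \<theta>: "\<And>j x y. 0 < x \<Longrightarrow> x \<le> y \<Longrightarrow> y \<le> 1 \<Longrightarrow> \<bar>\<theta> j x - \<theta> j y\<bar> \<le> lip * (y - x)"
      and \<theta>m: "\<And>j. \<theta> j \<in> borel_measurable U"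
      and W: "W \<in> borel_measurable U" "\<And>x. 0 < x \<Longrightarrow> x \<le> 1 \<Longrightarrow> norm (W x) \<le> 1"
    for \<beta> \<theta> lip k q and W :: "real \<Rightarrow> complex"
  proof -
    have "\<exists>G. K 12 G \<and> ctrl (twist \<theta> \<beta> k) G \<and> (\<integral>x. G x \<partial>U) \<le> 1 + real k * (24 * lip / al)"
      by (rule twist_ctrl(1)[OF \<beta> lip \<theta>])
    then obtain G where G: "K 12 G" "ctrl (twist \<theta> \<beta> k) G" "(\<integral>x. G x \<partial>U) \<le> 1 + real k * (24 * lip / al)"
      by blast
    define F where "F = twist \<theta> \<beta> k"
    note Fi = ctrl_integrable[OF G(2) K_integrable[OF G(1)], folded F_def]
    define \<beta>' where "\<beta>' = sh k \<beta>"
    have \<beta>': "adm \<beta>'" using adm_sh[OF \<beta>] by (simp add: \<beta>'_def)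
    define \<psi> where "\<psi> = PP \<beta> k (\<lambda>_. 1::real)"
    have \<psi>: "K 12 \<psi>" "(\<integral>x. \<psi> x \<partial>U) = 1"
      using PP_K[OF \<beta> _ K_one] PP_integrable(2)[OF \<beta>, of "\<lambda>_. 1::real"] U.prob_space by (auto simp: \<psi>_def)
    define V where "V x = W (seqT \<beta>' q x)" for x
    have Vm: "V \<in> borel_measurable U"
      unfolding V_def by (rule measurable_compose[OF seqT_measurable[OF \<beta>'] W(1)])
    have Vb: "norm (V x) \<le> 1" if "0 < x" "x \<le> 1" for x
      unfolding V_def using seqT_in[OF \<beta>' that, of q] by (intro W(2)) auto
    have V: "W (seqT \<beta> (k + q) x) = V (seqT \<beta> k x)" for x by (simp add: V_def seqT_plus \<beta>'_def)
    have 1: "(\<integral>x. cis (\<Sum>j=1..k. \<theta> j (seqT \<beta> j x)) * W (seqT \<beta> (k + q) x) \<partial>U) = (\<integral>x. W x * PP \<beta>' q F x \<partial>U)"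
    proof -
      have "(\<integral>x. cis (\<Sum>j=1..k. \<theta> j (seqT \<beta> j x)) * W (seqT \<beta> (k + q) x) \<partial>U) = (\<integral>x. V x * F x \<partial>U)"
        unfolding V F_def by (rule twist_duality[OF \<beta> lip \<theta> \<theta>m Vm Vb])
      also have "\<dots> = (\<integral>x. W x * PP \<beta>' q F x \<partial>U)"
        unfolding V_def by (rule PP_duality(3)[OF \<beta>' Fi W, symmetric])
      finally show ?thesis .
    qed
    have 2: "(\<integral>x. cis (\<Sum>j=1..k. \<theta> j (seqT \<beta> j x)) \<partial>U) = (\<integral>x. F x \<partial>U)"
    proof -
      have "(\<integral>x. cis (\<Sum>j=1..k. \<theta> j (seqT \<beta> j x)) * 1 \<partial>U) = (\<integral>x. 1 * F x \<partial>U)"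
        unfolding F_def by (rule twist_duality[OF \<beta> lip \<theta> \<theta>m]) auto
      then show ?thesis by simp
    qed
    have 3: "(\<integral>x. W (seqT \<beta> (k + q) x) \<partial>U) = (\<integral>x. W x * complex_of_real (PP \<beta>' q \<psi> x) \<partial>U)"
    proof -
      have cr: "(\<lambda>x. complex_of_real (PP \<beta>' q \<psi> x)) = PP \<beta> (k + q) (\<lambda>_. 1)"
      proof -
        have "(\<lambda>x. complex_of_real (PP \<beta> n (\<lambda>_. 1) x)) = PP \<beta> n (\<lambda>_. 1)" for n
          by (induction n) (auto simp: transfer_of_real[symmetric])
        then show ?thesis by (simp add: \<psi>_def \<beta>'_def PP_plus[symmetric])
      qed
      show ?thesis using PP_duality(3)[OF \<beta> _ W, of "\<lambda>_. 1" "k + q"] by (simp add: cr[symmetric] fun_cong[OF cr, symmetric])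
    qed
    let ?D = "\<lambda>x. PP \<beta>' q F x - (\<integral>x. F x \<partial>U) * complex_of_real (PP \<beta>' q \<psi> x)"
    have Pi: "integrable U (PP \<beta>' q F)" "integrable U (\<lambda>x. complex_of_real (PP \<beta>' q \<psi> x))"
      using PP_integrable(1)[OF \<beta>' Fi] PP_integrable(1)[OF \<beta>' K_integrable[OF \<psi>(1)]] by auto
    have Di: "integrable U ?D" using Pi by auto
    have e: "(\<integral>x. W x * PP \<beta>' q F x \<partial>U) - (\<integral>x. F x \<partial>U) * (\<integral>x. W x * complex_of_real (PP \<beta>' q \<psi> x) \<partial>U) = (\<integral>x. W x * ?D x \<partial>U)"
    proof -
      have "(\<integral>x. W x * ?D x \<partial>U) = (\<integral>x. W x * PP \<beta>' q F x - (\<integral>x. F x \<partial>U) * (W x * complex_of_real (PP \<beta>' q \<psi> x)) \<partial>U)"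
        by (rule Bochner_Integration.integral_cong) (auto simp: algebra_simps)
      also have "\<dots> = (\<integral>x. W x * PP \<beta>' q F x \<partial>U) - (\<integral>x. (\<integral>x. F x \<partial>U) * (W x * complex_of_real (PP \<beta>' q \<psi> x)) \<partial>U)"
      proof (rule Bochner_Integration.integral_diff)
        show "integrable U (\<lambda>x. W x * PP \<beta>' q F x)" by (rule integral_mult_bound(1)[OF Pi(1) W])
        have "integrable U (\<lambda>x. W x * complex_of_real (PP \<beta>' q \<psi> x))" by (rule integral_mult_bound(1)[OF Pi(2) W])
        then show "integrable U (\<lambda>x. (\<integral>x. F x \<partial>U) * (W x * complex_of_real (PP \<beta>' q \<psi> x)))"
          by (rule integrable_mult_right)
      qed
      finally show ?thesis by simp
    qed
    have "norm (\<integral>x. W x * ?D x \<partial>U) \<le> 1 * (\<integral>x. norm (?D x) \<partial>U)" by (rule integral_mult_bound(2)[OF Di W])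
    also have "\<dots> \<le> C * (\<integral>x. G x \<partial>U) / real (Suc q) ^ 4"
      using C(2)[OF \<beta>' G(2,1) \<psi>, of q] by (simp add: F_def)
    also have "\<dots> \<le> C' * (1 + real k * lip) / real (Suc q) ^ 4"
    proof (rule divide_right_mono)
      have "1 + real k * (24 * lip / al) \<le> (1 + 24 / al) * (1 + real k * lip)"
      proof -
        define z y where "z = 24 / al" and "y = real k * lip"
        have "real k * (24 * lip / al) = z * y" by (simp add: z_def y_def)
        moreover have "0 \<le> z" "0 \<le> y" using lip al by (auto simp: z_def y_def)
        ultimately show ?thesis unfolding z_def[symmetric] y_def[symmetric] by (simp add: algebra_simps)
      qed
      then have "C * (\<integral>x. G x \<partial>U) \<le> C * ((1 + 24 / al) * (1 + real k * lip))"
        using G(3) C(1) by (intro mult_left_mono) auto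
      then show "C * (\<integral>x. G x \<partial>U) \<le> C' * (1 + real k * lip)" by (simp add: C'_def mult.assoc)
    qed simp
    finally show ?thesis unfolding 1 2 3 e .
  qed
  then show ?thesis using C' by (intro exI[of _ C']) simp
qed

end

section \<open>Completeness of L1 and decay of covariances\<close>

lemma summable_inverse_4: "summable (\<lambda>n. D / real (Suc n) ^ 4)"
  using summable_mult[OF iffD2[OF summable_Suc_iff inverse_power_summable[of 4, where 'a=real]], of D]
  by (simp add: divide_inverse)

text \<open>Summable increments converge absolutely almost everywhere, and twice the sum of their
  moduli dominates the errors. It supplies limits both for the invariant density and for the
  transfer function of the coboundary.\<close>

lemma L1_complete_U:
  fixes f :: "nat \<Rightarrow> real \<Rightarrow> real"
  assumes f: "\<And>n. integrable U (f n)" and s: "summable (\<lambda>n. \<integral>x. \<bar>f (Suc n) x - f n x\<bar> \<partial>U)"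
  obtains g where "integrable U g" "(\<lambda>n. \<integral>x. \<bar>f n x - g x\<bar> \<partial>U) \<longlonglongrightarrow> 0"
proof -
  define d where "d n x = f (Suc n) x - f n x" for n x
  have di: "integrable U (d n)" for n unfolding d_def using f by auto
  have fin: "(\<integral>\<^sup>+x. (\<Sum>n. ennreal \<bar>d n x\<bar>) \<partial>U) < \<infinity>"
  proof -
    have "(\<integral>\<^sup>+x. (\<Sum>n. ennreal \<bar>d n x\<bar>) \<partial>U) = (\<Sum>n. \<integral>\<^sup>+x. ennreal \<bar>d n x\<bar> \<partial>U)"
      using di by (intro nn_integral_suminf) auto
    also have "\<dots> = (\<Sum>n. ennreal (\<integral>x. \<bar>d n x\<bar> \<partial>U))"
      using di by (intro arg_cong[where f = suminf] ext nn_integral_eq_integral) auto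
    also have "\<dots> = ennreal (\<Sum>n. \<integral>x. \<bar>d n x\<bar> \<partial>U)"
      using s by (intro suminf_ennreal2) (auto simp: d_def)
    finally show ?thesis by simp
  qed
  have sm: "AE x in U. summable (\<lambda>n. norm (d n x))"
  proof -
    have "AE x in U. (\<Sum>n. ennreal \<bar>d n x\<bar>) \<noteq> \<infinity>"
      using di fin by (intro nn_integral_noteq_infinite) auto
    then show ?thesis
      by eventually_elim (auto intro!: summable_suminf_not_top simp: top_ennreal_def[symmetric] less_top[symmetric])
  qed
  have s': "summable (\<lambda>n. \<integral>x. norm (d n x) \<partial>U)" using s by (simp add: d_def)
  have iw: "integrable U (\<lambda>x. \<Sum>n. d n x)" by (rule integrable_suminf[OF di sm s'])
  have iw': "integrable U (\<lambda>x. \<Sum>n. norm (d n x))"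
    by (rule integrable_suminf) (use di sm s' in auto)
  define g where "g x = f 0 x + (\<Sum>n. d n x)" for x
  have gi: "integrable U g" unfolding g_def using f iw by auto
  have tele: "f n x = f 0 x + (\<Sum>k<n. d k x)" for n x
    unfolding d_def using sum_lessThan_telescope[of "\<lambda>n. f n x" n] by simp
  have "(\<lambda>n. \<integral>x. \<bar>f n x - g x\<bar> \<partial>U) \<longlonglongrightarrow> (\<integral>x. 0 \<partial>U)"
  proof (rule integral_dominated_convergence[where w = "\<lambda>x. 2 * (\<Sum>n. norm (d n x))" and f = "\<lambda>_. 0" and s = "\<lambda>n x. \<bar>f n x - g x\<bar>"])
    show "(\<lambda>x. \<bar>f n x - g x\<bar>) \<in> borel_measurable U" for n using f[of n] gi by measurable
    show "integrable U (\<lambda>x. 2 * (\<Sum>n. norm (d n x)))" using iw' by (rule integrable_mult_right)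
    show "AE x in U. (\<lambda>n. \<bar>f n x - g x\<bar>) \<longlonglongrightarrow> 0"
      using sm
    proof eventually_elim
      case (elim x)
      have "(\<lambda>n. \<Sum>k<n. d k x) \<longlonglongrightarrow> (\<Sum>n. d n x)" by (rule summable_LIMSEQ[OF summable_norm_cancel[OF elim]])
      from LIM_zero[OF this]
      have "(\<lambda>n. (\<Sum>k<n. d k x) - (\<Sum>n. d n x)) \<longlonglongrightarrow> 0" .
      moreover have "(\<Sum>k<n. d k x) - (\<Sum>n. d n x) = f n x - g x" for n
        using tele[of n x] by (simp add: g_def)
      ultimately show ?case using tendsto_rabs_zero[of "\<lambda>n. f n x - g x"] by simp
    qed
    show "AE x in U. norm \<bar>f n x - g x\<bar> \<le> 2 * (\<Sum>n. norm (d n x))" for n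
      using sm
    proof eventually_elim
      case (elim x)
      have "\<bar>\<Sum>k<n. d k x\<bar> \<le> (\<Sum>k<n. norm (d k x))" by (simp add: sum_abs)
      also have "\<dots> \<le> (\<Sum>n. norm (d n x))" by (rule sum_le_suminf[OF elim]) auto
      finally have "\<bar>\<Sum>k<n. d k x\<bar> \<le> (\<Sum>n. norm (d n x))" .
      moreover have "\<bar>\<Sum>n. d n x\<bar> \<le> (\<Sum>n. norm (d n x))" using summable_norm[OF elim] by simp
      moreover have "f n x - g x = (\<Sum>k<n. d k x) - (\<Sum>n. d n x)" using tele[of n x] by (simp add: g_def)
      ultimately show ?case unfolding real_norm_def by linarith
    qed
  qed simp
  then have "(\<lambda>n. \<integral>x. \<bar>f n x - g x\<bar> \<partial>U) \<longlonglongrightarrow> 0" by (simp only: Bochner_Integration.integral_zero)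
  with gi show ?thesis by (rule that)
qed

text \<open>Measurability and bound are required on the whole line; the given observable is later
  composed with the retraction onto the unit interval.\<close>

locale lsv_obs = lsv +
  fixes \<phi> :: "real \<Rightarrow> real" and M lip :: real
  assumes \<phi>_measurable: "\<phi> \<in> borel_measurable borel"
    and \<phi>_bound: "\<And>x. \<bar>\<phi> x\<bar> \<le> M"
    and \<phi>_lip: "\<And>x y. 0 < x \<Longrightarrow> x \<le> y \<Longrightarrow> y \<le> 1 \<Longrightarrow> \<bar>\<phi> x - \<phi> y\<bar> \<le> lip * (y - x)"
    and lip_nonneg: "0 \<le> lip"
begin

lemma M_nonneg: "0 \<le> M" using \<phi>_bound[of 0] by simp

lemma \<phi>_U: "\<phi> \<in> borel_measurable U" by (rule borel_measurable_U_I[OF \<phi>_measurable])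

lemma obs_decorrelation:
  "\<exists>C>0. \<forall>\<beta> \<psi> n. adm \<beta> \<longrightarrow> K 12 \<psi> \<longrightarrow> (\<integral>x. \<psi> x \<partial>U) = 1 \<longrightarrow>
    (\<integral>x. \<bar>PP \<beta> n (\<lambda>x. \<phi> x * \<psi> x) x - (\<integral>x. \<phi> x * \<psi> x \<partial>U) * PP \<beta> n \<psi> x\<bar> \<partial>U) \<le> C / real (Suc n) ^ 4"
proof -
  obtain C where C: "0 < C" "\<And>\<beta> F G \<psi> n. adm \<beta> \<Longrightarrow> ctrl F G \<Longrightarrow> K 12 G \<Longrightarrow> K 12 \<psi> \<Longrightarrow> (\<integral>x. \<psi> x \<partial>U) = 1 \<Longrightarrow>
    (\<integral>x. \<bar>PP \<beta> n F x - (\<integral>x. F x \<partial>U) * PP \<beta> n \<psi> x\<bar> \<partial>U) \<le> C * (\<integral>x. G x \<partial>U) / real (Suc n) ^ 4"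
    using decorrelation_real by blast
  define B where "B = M + 24 * lip / al"
  have B: "0 \<le> B" using M_nonneg lip_nonneg al by (simp add: B_def)
  have "(\<integral>x. \<bar>PP \<beta> n (\<lambda>x. \<phi> x * \<psi> x) x - (\<integral>x. \<phi> x * \<psi> x \<partial>U) * PP \<beta> n \<psi> x\<bar> \<partial>U) \<le> (C * (B + 1)) / real (Suc n) ^ 4"
    if \<beta>: "adm \<beta>" and \<psi>: "K 12 \<psi>" "(\<integral>x. \<psi> x \<partial>U) = 1" for \<beta> \<psi> n
  proof -
    let ?G = "\<lambda>x. M * \<psi> x + 12 * lip / al * X x"
    have ct: "ctrl (\<lambda>x. \<phi> x * \<psi> x) ?G"
    proof (rule ctrl_mult[OF ctrl_self[OF \<psi>(1)]])
      fix x :: real assume "0 < x" "x \<le> 1"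
      then show "norm (\<psi> x) \<le> 12 * X x" using KD(2,3)[OF \<psi>(1), of x] \<psi>(2) by auto
    qed (use \<phi>_bound \<phi>_lip lip_nonneg in auto)
    have GK: "K 12 ?G" using M_nonneg lip_nonneg al \<psi> K_X[of 12] by (intro K_add K_scale) auto
    have "(\<integral>x. ?G x \<partial>U) = M + 12 * lip / al * (\<integral>x. X x \<partial>U)"
      using K_integrable[OF \<psi>(1)] \<psi>(2) X_integral(1) by simp
    also have "\<dots> \<le> M + 12 * lip / al * 2" using X_integral(3) lip_nonneg al by (intro add_left_mono mult_left_mono) auto
    finally have GB: "(\<integral>x. ?G x \<partial>U) \<le> B + 1" by (simp add: B_def)
    have "(\<integral>x. \<bar>PP \<beta> n (\<lambda>x. \<phi> x * \<psi> x) x - (\<integral>x. \<phi> x * \<psi> x \<partial>U) * PP \<beta> n \<psi> x\<bar> \<partial>U) \<le> C * (\<integral>x. ?G x \<partial>U) / real (Suc n) ^ 4"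
      by (rule C(2)[OF \<beta> ct GK \<psi>])
    also have "\<dots> \<le> C * (B + 1) / real (Suc n) ^ 4"
      using GB C(1) by (intro divide_right_mono mult_left_mono) auto
    finally show ?thesis .
  qed
  then show ?thesis using C(1) B by (intro exI[of _ "C * (B + 1)"]) simp
qed

definition mean :: "(nat \<Rightarrow> real) \<Rightarrow> nat \<Rightarrow> real" where
  "mean \<beta> i = (\<integral>x. \<phi> (seqT \<beta> i x) \<partial>U)"

definition cov :: "(nat \<Rightarrow> real) \<Rightarrow> nat \<Rightarrow> nat \<Rightarrow> real" where
  "cov \<beta> i j = (\<integral>x. \<phi> (seqT \<beta> i x) * \<phi> (seqT \<beta> j x) \<partial>U) - mean \<beta> i * mean \<beta> j"

lemma mean_le:
  assumes "adm \<beta>" shows "\<bar>mean \<beta> i\<bar> \<le> M"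
proof -
  have m: "(\<lambda>x. \<phi> (seqT \<beta> i x)) \<in> borel_measurable U" by (rule measurable_compose[OF seqT_measurable[OF assms] \<phi>_U])
  have "\<bar>mean \<beta> i\<bar> \<le> M * (\<integral>x. norm (1::real) \<partial>U)"
    using integral_mult_bound(2)[OF _ m, of "\<lambda>_. 1" M] \<phi>_bound by (simp add: mean_def)
  then show ?thesis using U.prob_space by simp
qed

lemma cov_sym: "cov \<beta> i j = cov \<beta> j i"
  by (simp add: cov_def mult.commute)

lemma integral_density_form:
  fixes W :: "real \<Rightarrow> real"
  assumes \<beta>: "adm \<beta>" and W: "W \<in> borel_measurable U" "\<And>x. 0 < x \<Longrightarrow> x \<le> 1 \<Longrightarrow> \<bar>W x\<bar> \<le> B"
  shows "(\<integral>x. W (seqT \<beta> i x) \<partial>U) = (\<integral>x. W x * PP \<beta> i (\<lambda>_. 1) x \<partial>U)"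
  using PP_duality(3)[OF \<beta>, of "\<lambda>_. 1" W B i] W by simp

text \<open>With \<open>\<psi>\<close> the density at time \<open>i\<close>, duality turns the
  covariance into the integral of \<open>\<phi>\<close> against the decorrelation error of
  \<open>\<phi> * \<psi>\<close> over the remaining \<open>d\<close> steps.\<close>

lemma cov_decay:
  "\<exists>C>0. \<forall>\<beta> i d. adm \<beta> \<longrightarrow> \<bar>cov \<beta> i (i + d)\<bar> \<le> C / real (Suc d) ^ 4"
proof -
  obtain C where C: "0 < C" "\<And>\<beta> \<psi> n. adm \<beta> \<Longrightarrow> K 12 \<psi> \<Longrightarrow> (\<integral>x. \<psi> x \<partial>U) = 1 \<Longrightarrow>
    (\<integral>x. \<bar>PP \<beta> n (\<lambda>x. \<phi> x * \<psi> x) x - (\<integral>x. \<phi> x * \<psi> x \<partial>U) * PP \<beta> n \<psi> x\<bar> \<partial>U) \<le> C / real (Suc n) ^ 4"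
    using obs_decorrelation by blast
  have "\<bar>cov \<beta> i (i + d)\<bar> \<le> ((M + 1) * C) / real (Suc d) ^ 4" if \<beta>: "adm \<beta>" for \<beta> i d
  proof -
    define \<beta>' where "\<beta>' = sh i \<beta>"
    have \<beta>': "adm \<beta>'" using adm_sh[OF \<beta>] by (simp add: \<beta>'_def)
    define \<psi> where "\<psi> = PP \<beta> i (\<lambda>_. 1::real)"
    have \<psi>: "K 12 \<psi>" "(\<integral>x. \<psi> x \<partial>U) = 1"
      using PP_K[OF \<beta> _ K_one] PP_integrable(2)[OF \<beta>, of "\<lambda>_. 1::real"] U.prob_space by (auto simp: \<psi>_def)
    note \<psi>i = K_integrable[OF \<psi>(1)]
    have \<phi>T: "(\<lambda>x. \<phi> (seqT \<beta>' d x)) \<in> borel_measurable U"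
      by (rule measurable_compose[OF seqT_measurable[OF \<beta>'] \<phi>_U])
    have \<phi>\<psi>: "integrable U (\<lambda>x. \<phi> x * \<psi> x)" by (rule integral_mult_bound(1)[OF \<psi>i \<phi>_U, of M]) (simp add: \<phi>_bound)
    let ?F = "\<lambda>x. \<phi> x * \<psi> x"
    have m1: "mean \<beta> i = (\<integral>x. ?F x \<partial>U)"
      unfolding mean_def \<psi>_def by (rule integral_density_form[OF \<beta> \<phi>_U]) (rule \<phi>_bound)
    have m2: "mean \<beta> (i + d) = (\<integral>x. \<phi> x * PP \<beta>' d \<psi> x \<partial>U)"
      unfolding mean_def \<psi>_def \<beta>'_def PP_plus[symmetric] by (rule integral_density_form[OF \<beta> \<phi>_U]) (rule \<phi>_bound)
    have m3: "(\<integral>x. \<phi> (seqT \<beta> i x) * \<phi> (seqT \<beta> (i + d) x) \<partial>U) = (\<integral>x. \<phi> x * PP \<beta>' d ?F x \<partial>U)"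
    proof -
      have "(\<integral>x. \<phi> (seqT \<beta> i x) * \<phi> (seqT \<beta> (i + d) x) \<partial>U) = (\<integral>x. (\<phi> x * \<phi> (seqT \<beta>' d x)) * \<psi> x \<partial>U)"
        unfolding seqT_plus \<beta>'_def[symmetric] \<psi>_def
        by (rule integral_density_form[OF \<beta>, of "\<lambda>x. \<phi> x * \<phi> (seqT \<beta>' d x)" "M * M"])
           (use \<phi>_bound M_nonneg in \<open>auto simp: abs_mult intro!: mult_mono borel_measurable_times \<phi>T \<phi>_U\<close>)
      also have "\<dots> = (\<integral>x. \<phi> (seqT \<beta>' d x) * ?F x \<partial>U)" by (simp add: mult_ac)
      also have "\<dots> = (\<integral>x. \<phi> x * PP \<beta>' d ?F x \<partial>U)"
        by (rule PP_duality(3)[OF \<beta>' \<phi>\<psi> \<phi>_U, of M, symmetric]) (simp add: \<phi>_bound)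
      finally show ?thesis .
    qed
    let ?D = "\<lambda>x. PP \<beta>' d ?F x - (\<integral>x. ?F x \<partial>U) * PP \<beta>' d \<psi> x"
    have i1: "integrable U (PP \<beta>' d ?F)" "integrable U (PP \<beta>' d \<psi>)"
      using PP_integrable(1)[OF \<beta>' \<phi>\<psi>] PP_integrable(1)[OF \<beta>' \<psi>i] by auto
    have i2: "integrable U (\<lambda>x. \<phi> x * PP \<beta>' d ?F x)" "integrable U (\<lambda>x. \<phi> x * PP \<beta>' d \<psi> x)"
      by (rule integral_mult_bound(1)[OF i1(1) \<phi>_U, of M], simp add: \<phi>_bound)
         (rule integral_mult_bound(1)[OF i1(2) \<phi>_U, of M], simp add: \<phi>_bound)
    have Di: "integrable U ?D" using i1 by auto
    have "cov \<beta> i (i + d) = (\<integral>x. \<phi> x * PP \<beta>' d ?F x - (\<integral>x. ?F x \<partial>U) * (\<phi> x * PP \<beta>' d \<psi> x) \<partial>U)"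
      using i2 by (simp add: cov_def m1 m2 m3)
    also have "\<dots> = (\<integral>x. \<phi> x * ?D x \<partial>U)" by (rule Bochner_Integration.integral_cong) (auto simp: algebra_simps)
    finally have "\<bar>cov \<beta> i (i + d)\<bar> = norm (\<integral>x. \<phi> x * ?D x \<partial>U)" by simp
    also have "\<dots> \<le> M * (\<integral>x. norm (?D x) \<partial>U)" by (rule integral_mult_bound(2)[OF Di \<phi>_U]) (simp add: \<phi>_bound)
    also have "\<dots> \<le> M * (C / real (Suc d) ^ 4)"
      using C(2)[OF \<beta>' \<psi>, of d] M_nonneg by (intro mult_left_mono) auto
    also have "\<dots> \<le> ((M + 1) * C) / real (Suc d) ^ 4"
      using C(1) by (simp add: divide_right_mono)
    finally show ?thesis .
  qed
  then show ?thesis using C(1) M_nonneg by (intro exI[of _ "(M + 1) * C"]) simp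
qed

end

section \<open>The stationary system and its Green--Kubo variance\<close>

locale lsv_stat = lsv_obs +
  fixes \<gamma> :: real
  assumes \<gamma>: "0 < \<gamma>" "\<gamma> \<le> al"
begin

abbreviation P :: "nat \<Rightarrow> (real \<Rightarrow> real) \<Rightarrow> real \<Rightarrow> real" where "P \<equiv> PP (\<lambda>_. \<gamma>)"

lemma adm_const: "adm (\<lambda>_. \<gamma>)" using \<gamma> by (simp add: adm_def)

lemma P_plus: "P (m + n) f = P n (P m f)"
  unfolding PP_plus[of _ m n] by (simp add: sh_def[abs_def])

lemma P_one: "K 12 (P n (\<lambda>_. 1))" "(\<integral>x. P n (\<lambda>_. 1) x \<partial>U) = 1" "integrable U (P n (\<lambda>_. 1))"
  using PP_K[OF adm_const _ K_one] PP_integrable[OF adm_const, of "\<lambda>_. 1::real"] U.prob_space by auto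

text \<open>The iterates of 1 at times \<open>m + n\<close> and \<open>m' + n\<close> are images
  under \<open>P n\<close> of two cone densities, so memory loss makes them Cauchy. The rate for
  general \<open>f\<close> comes from comparing with the image of the \<open>m\<close>-th iterate
  and letting \<open>m\<close> grow.\<close>

lemma stationary_density_exists:
  "\<exists>h c C. 0 < c \<and> 0 < C \<and> integrable U h \<and> (\<forall>x. c \<le> h x) \<and> (\<lambda>n. \<integral>x. \<bar>P n (\<lambda>_. 1) x - h x\<bar> \<partial>U) \<longlonglongrightarrow> 0
    \<and> (\<forall>f n. K 12 f \<longrightarrow> (\<integral>x. f x \<partial>U) = 1 \<longrightarrow> (\<integral>x. \<bar>P n f x - h x\<bar> \<partial>U) \<le> C / real (Suc n) ^ 4)"
proof -
  obtain C where C: "0 < C" "\<And>\<beta> f g n. adm \<beta> \<Longrightarrow> K 12 f \<Longrightarrow> K 12 g \<Longrightarrow> (\<integral>x. f x \<partial>U) = 1 \<Longrightarrow> (\<integral>x. g x \<partial>U) = 1 \<Longrightarrow>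
    (\<integral>x. \<bar>PP \<beta> n f x - PP \<beta> n g x\<bar> \<partial>U) \<le> C / real (Suc n) ^ 4"
    using memory_loss_unit[of 12] by auto
  obtain k0 c where c: "0 < c" "\<forall>\<beta> f. adm \<beta> \<longrightarrow> K 12 f \<longrightarrow> (\<integral>x. f x \<partial>U) = 1 \<longrightarrow> (\<forall>x. 0 < x \<longrightarrow> x \<le> 1 \<longrightarrow> c \<le> PP \<beta> k0 f x)"
  proof -
    have "4 \<le> (12::real)" by simp
    from lower_bound_exists[OF this] show ?thesis using that by blast
  qed
  let ?\<psi> = "\<lambda>n. P n (\<lambda>_. 1)"
  have step: "(\<integral>x. \<bar>?\<psi> (m + n) x - ?\<psi> (m' + n) x\<bar> \<partial>U) \<le> C / real (Suc n) ^ 4" for m m' n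
    unfolding P_plus by (rule C(2)[OF adm_const P_one(1) P_one(1) P_one(2) P_one(2)])
  have sm: "summable (\<lambda>n. \<integral>x. \<bar>?\<psi> (Suc n) x - ?\<psi> n x\<bar> \<partial>U)"
  proof (rule summable_comparison_test'[where N = 0])
    show "summable (\<lambda>n. C / real (Suc n) ^ 4)" by (rule summable_inverse_4)
    show "norm (\<integral>x. \<bar>?\<psi> (Suc n) x - ?\<psi> n x\<bar> \<partial>U) \<le> C / real (Suc n) ^ 4" for n
      using step[of 1 n 0] by simp
  qed
  obtain g where g: "integrable U g" "(\<lambda>n. \<integral>x. \<bar>?\<psi> n x - g x\<bar> \<partial>U) \<longlonglongrightarrow> 0"
    using L1_complete_U[OF P_one(3) sm] by blast
  \<comment> \<open>The L1 limit is determined only almost everywhere; the maximum enforces the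
    lower bound at every point. It does not worsen the approximation, as the iterates themselves
    exceed \<open>c\<close> from time \<open>k0\<close> on.\<close>
  define h where "h x = max c (g x)" for x
  have hi: "integrable U h" unfolding h_def using g by auto
  have \<psi>c: "c \<le> ?\<psi> n x" if "k0 \<le> n" "0 < x" "x \<le> 1" for n x
  proof -
    have "?\<psi> n = P k0 (?\<psi> (n - k0))" using that P_plus[of "n - k0" k0 "\<lambda>_. 1"] by simp
    then show ?thesis using c(2) adm_const P_one[of "n - k0"] that by metis
  qed
  have lim: "(\<lambda>n. \<integral>x. \<bar>?\<psi> n x - h x\<bar> \<partial>U) \<longlonglongrightarrow> 0"
  proof (rule tendsto_sandwich[OF _ _ tendsto_const g(2)])
    show "\<forall>\<^sub>F n in sequentially. (\<integral>x. \<bar>?\<psi> n x - h x\<bar> \<partial>U) \<le> (\<integral>x. \<bar>?\<psi> n x - g x\<bar> \<partial>U)"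
      using eventually_ge_at_top[of k0]
    proof eventually_elim
      case (elim n)
      show ?case
      proof (rule integral_mono)
        fix x assume "x \<in> space U"
        then show "\<bar>?\<psi> n x - h x\<bar> \<le> \<bar>?\<psi> n x - g x\<bar>" using \<psi>c[OF elim, of x] by (auto simp: h_def)
      qed (use hi g P_one(3) in auto)
    qed
  qed auto
  have rate: "(\<integral>x. \<bar>P n f x - h x\<bar> \<partial>U) \<le> C / real (Suc n) ^ 4" if f: "K 12 f" "(\<integral>x. f x \<partial>U) = 1" for f n
  proof (rule LIMSEQ_le_const)
    show "(\<lambda>m. C / real (Suc n) ^ 4 + (\<integral>x. \<bar>?\<psi> (m + n) x - h x\<bar> \<partial>U)) \<longlonglongrightarrow> C / real (Suc n) ^ 4"
      using tendsto_add[OF tendsto_const[of "C / real (Suc n) ^ 4"] LIMSEQ_ignore_initial_segment[OF lim, of n]] by simp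
    show "\<exists>N. \<forall>m\<ge>N. (\<integral>x. \<bar>P n f x - h x\<bar> \<partial>U) \<le> C / real (Suc n) ^ 4 + (\<integral>x. \<bar>?\<psi> (m + n) x - h x\<bar> \<partial>U)"
    proof (intro exI[of _ 0] allI impI)
      fix m
      have fi: "integrable U (P n f)" by (rule PP_integrable(1)[OF adm_const K_integrable[OF f(1)]])
      have "(\<integral>x. \<bar>P n f x - h x\<bar> \<partial>U) \<le> (\<integral>x. \<bar>P n f x - P n (?\<psi> m) x\<bar> + \<bar>?\<psi> (m + n) x - h x\<bar> \<partial>U)"
        unfolding P_plus[symmetric] by (rule integral_mono) (use fi hi P_one(3) in auto)
      also have "\<dots> = (\<integral>x. \<bar>P n f x - P n (?\<psi> m) x\<bar> \<partial>U) + (\<integral>x. \<bar>?\<psi> (m + n) x - h x\<bar> \<partial>U)"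
        unfolding P_plus[symmetric] using fi hi P_one(3) by simp
      also have "(\<integral>x. \<bar>P n f x - P n (?\<psi> m) x\<bar> \<partial>U) \<le> C / real (Suc n) ^ 4"
        by (rule C(2)[OF adm_const f(1) P_one(1) f(2) P_one(2)])
      finally show "(\<integral>x. \<bar>P n f x - h x\<bar> \<partial>U) \<le> C / real (Suc n) ^ 4 + (\<integral>x. \<bar>?\<psi> (m + n) x - h x\<bar> \<partial>U)" by simp
    qed
  qed
  show ?thesis
    by (intro exI[of _ h] exI[of _ c] exI[of _ C] conjI allI impI c(1) C(1) hi lim rate) (auto simp: h_def)
qed

end

locale lsv_inv = lsv_stat +
  fixes h :: "real \<Rightarrow> real" and c C :: real
  assumes c: "0 < c" and C: "0 < C" and h_int: "integrable U h" and h_ge: "\<And>x. c \<le> h x"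
    and h_lim: "(\<lambda>n. \<integral>x. \<bar>P n (\<lambda>_. 1) x - h x\<bar> \<partial>U) \<longlonglongrightarrow> 0"
    and h_rate: "\<And>f n. K 12 f \<Longrightarrow> (\<integral>x. f x \<partial>U) = 1 \<Longrightarrow> (\<integral>x. \<bar>P n f x - h x\<bar> \<partial>U) \<le> C / real (Suc n) ^ 4"
begin

lemma h_pos: "0 < h x" using c h_ge[of x] by linarith

abbreviation \<psi> :: "nat \<Rightarrow> real \<Rightarrow> real" where "\<psi> n \<equiv> P n (\<lambda>_. 1)"

definition err :: "nat \<Rightarrow> real" where "err n = (\<integral>x. \<bar>\<psi> n x - h x\<bar> \<partial>U)"

lemma err_lim: "err \<longlonglongrightarrow> 0" using h_lim by (simp add: err_def[abs_def])

lemma h_integral: "(\<integral>x. h x \<partial>U) = 1"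
proof -
  have le: "\<bar>1 - (\<integral>x. h x \<partial>U)\<bar> \<le> err n" for n
  proof -
    have "1 - (\<integral>x. h x \<partial>U) = (\<integral>x. \<psi> n x - h x \<partial>U)" using P_one h_int by simp
    then show ?thesis unfolding err_def by simp
  qed
  have "\<bar>1 - (\<integral>x. h x \<partial>U)\<bar> \<le> 0" by (rule LIMSEQ_le_const[OF err_lim]) (use le in auto)
  then show ?thesis by simp
qed

text \<open>Inserting the iterate at time \<open>n\<close> bounds the distance by
  \<open>err n + err (n + k)\<close>, which tends to 0. The identity holds only almost everywhere,
  since \<open>h\<close> was obtained as an L1 limit.\<close>

lemma P_h_AE: "AE x in U. P k h x = h x"
proof -
  have ik: "integrable U (P k h)" by (rule PP_integrable(1)[OF adm_const h_int])
  have le: "(\<integral>x. \<bar>P k h x - h x\<bar> \<partial>U) \<le> err n + err (n + k)" for n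
  proof -
    have d: "integrable U (\<lambda>x. h x - \<psi> n x)" using h_int P_one by auto
    have "(\<integral>x. \<bar>P k h x - h x\<bar> \<partial>U) \<le> (\<integral>x. \<bar>P k (\<lambda>x. h x - \<psi> n x) x\<bar> + \<bar>\<psi> (n + k) x - h x\<bar> \<partial>U)"
      unfolding P_plus PP_diff
      by (rule integral_mono) (use ik h_int P_one(3) P_one(3)[of "n + k", unfolded P_plus] in auto)
    also have "\<dots> = (\<integral>x. \<bar>P k (\<lambda>x. h x - \<psi> n x) x\<bar> \<partial>U) + err (n + k)"
      unfolding err_def using PP_integrable(1)[OF adm_const d] P_one(3) h_int by simp
    also have "(\<integral>x. \<bar>P k (\<lambda>x. h x - \<psi> n x) x\<bar> \<partial>U) \<le> err n"
      using PP_L1[OF adm_const d, of k] by (simp add: err_def abs_minus_commute)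
    finally show ?thesis by simp
  qed
  have "(\<lambda>n. err n + err (n + k)) \<longlonglongrightarrow> 0 + 0"
    by (intro tendsto_add err_lim LIMSEQ_ignore_initial_segment)
  then have "(\<integral>x. \<bar>P k h x - h x\<bar> \<partial>U) \<le> 0" by (intro LIMSEQ_le_const) (use le in auto)
  moreover have "0 \<le> (\<integral>x. \<bar>P k h x - h x\<bar> \<partial>U)" by simp
  ultimately have "(\<integral>x. \<bar>P k h x - h x\<bar> \<partial>U) = 0" by linarith
  then have "AE x in U. \<bar>P k h x - h x\<bar> = 0"
    using ik h_int by (subst (asm) integral_nonneg_eq_0_iff_AE) auto
  then show ?thesis by eventually_elim simp
qed

definition c0 :: real where "c0 = (\<integral>x. \<phi> x * h x \<partial>U)"

definition ph :: "real \<Rightarrow> real" where "ph x = \<phi> x - c0"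

lemma \<phi>h_int: "integrable U f \<Longrightarrow> integrable U (\<lambda>x. \<phi> x * f x)"
  by (rule integral_mult_bound(1)[OF _ \<phi>_U, of _ M]) (simp_all add: \<phi>_bound)

lemma \<phi>_integral_bound: "integrable U f \<Longrightarrow> \<bar>\<integral>x. \<phi> x * f x \<partial>U\<bar> \<le> M * (\<integral>x. \<bar>f x\<bar> \<partial>U)"
  using integral_mult_bound(2)[OF _ \<phi>_U, of f M] \<phi>_bound by simp

lemma c0_bound: "\<bar>c0\<bar> \<le> M"
  using \<phi>_integral_bound[OF h_int] h_integral h_pos unfolding c0_def by (simp add: abs_of_pos)

lemma ph_bound: "\<bar>ph x\<bar> \<le> 2 * M"
  using \<phi>_bound[of x] c0_bound by (simp add: ph_def)

lemma ph_U: "ph \<in> borel_measurable U"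
  unfolding ph_def by (intro borel_measurable_diff \<phi>_U) auto

definition H :: "nat \<Rightarrow> real \<Rightarrow> real" where "H k = P k (\<lambda>x. ph x * h x)"

lemma phh_int: "integrable U (\<lambda>x. ph x * h x)"
  by (rule integral_mult_bound(1)[OF h_int ph_U, of "2 * M"]) (simp add: ph_bound)

lemma H_int: "integrable U (H k)"
  unfolding H_def by (rule PP_integrable(1)[OF adm_const phh_int])

lemma H_Suc: "H (Suc k) = transfer \<gamma> (H k)" by (simp add: H_def)

text \<open>The bound on \<open>ph\<close> passes through the positive operator \<open>P k\<close>,
  which fixes \<open>h\<close> almost everywhere. It keeps the quotients by \<open>h\<close>
  bounded, as duality requires.\<close>

lemma H_bound_AE: "AE x in U. \<bar>H k x\<bar> \<le> 2 * M * h x"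
  using P_h_AE[of k] AE_space
proof eventually_elim
  case (elim x)
  then have x: "0 < x" "x \<le> 1" by auto
  have "\<bar>H k x\<bar> \<le> P k (\<lambda>x. norm (ph x * h x)) x"
    unfolding H_def using PP_norm[OF adm_const x, of k "\<lambda>x. ph x * h x"] by simp
  also have "\<dots> \<le> P k (\<lambda>x. (2 * M) * h x) x"
  proof -
    have "0 \<le> P k (\<lambda>x. (2 * M) * h x - norm (ph x * h x)) x"
      by (rule PP_nonneg[OF adm_const _ x])
         (use ph_bound h_pos in \<open>simp add: abs_mult mult_right_mono less_imp_le\<close>)
    then show ?thesis by (simp add: PP_diff)
  qed
  also have "\<dots> = 2 * M * h x" using elim by (simp add: PP_mult)
  finally show ?case .
qed

text \<open>\<open>h\<close> is an L1 limit and membership in the cone is not at hand, so it is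
  replaced by an iterate, which is in the cone. The replacement costs \<open>3 * M * err n\<close>,
  and \<open>n\<close> tends to infinity for fixed \<open>k\<close>.\<close>

lemma H_rate: "\<exists>D>0. \<forall>k. (\<integral>x. \<bar>H k x\<bar> \<partial>U) \<le> D / real (Suc k) ^ 4"
proof -
  obtain D where D: "0 < D" "\<And>\<beta> \<psi> n. adm \<beta> \<Longrightarrow> K 12 \<psi> \<Longrightarrow> (\<integral>x. \<psi> x \<partial>U) = 1 \<Longrightarrow>
    (\<integral>x. \<bar>PP \<beta> n (\<lambda>x. \<phi> x * \<psi> x) x - (\<integral>x. \<phi> x * \<psi> x \<partial>U) * PP \<beta> n \<psi> x\<bar> \<partial>U) \<le> D / real (Suc n) ^ 4"
    using obs_decorrelation by blast
  have "(\<integral>x. \<bar>H k x\<bar> \<partial>U) \<le> D / real (Suc k) ^ 4" for k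
  proof -
    have le: "(\<integral>x. \<bar>H k x\<bar> \<partial>U) \<le> D / real (Suc k) ^ 4 + 3 * M * err n" for n
    proof -
      define cn where "cn = (\<integral>x. \<phi> x * \<psi> n x \<partial>U)"
      define g where "g x = \<phi> x * \<psi> n x - cn * \<psi> n x" for x
      define d where "d x = ph x * h x - g x" for x
      have gi: "integrable U g" unfolding g_def using \<phi>h_int[OF P_one(3)] P_one(3) by auto
      have di: "integrable U d" unfolding d_def using gi phh_int by auto
      have ei: "integrable U (\<lambda>x. \<bar>\<psi> n x - h x\<bar>)" using P_one(3) h_int by auto
      have "c0 - cn = (\<integral>x. \<phi> x * (h x - \<psi> n x) \<partial>U)"
        unfolding c0_def cn_def using \<phi>h_int[OF P_one(3), of n] \<phi>h_int[OF h_int] by (simp add: right_diff_distrib)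
      then have cc: "\<bar>c0 - cn\<bar> \<le> M * err n"
        using \<phi>_integral_bound[of "\<lambda>x. h x - \<psi> n x"] P_one(3) h_int by (simp add: err_def abs_minus_commute)
      have "\<bar>d x\<bar> \<le> 2 * M * \<bar>\<psi> n x - h x\<bar> + M * err n * \<psi> n x" if "0 < x" "x \<le> 1" for x
      proof -
        have "d x = ph x * (h x - \<psi> n x) - (c0 - cn) * \<psi> n x" by (simp add: d_def g_def ph_def algebra_simps)
        moreover have "\<bar>ph x * (h x - \<psi> n x)\<bar> \<le> 2 * M * \<bar>\<psi> n x - h x\<bar>"
          using ph_bound[of x] by (simp add: abs_mult abs_minus_commute mult_right_mono)
        moreover have "\<bar>(c0 - cn) * \<psi> n x\<bar> \<le> M * err n * \<psi> n x"
          using cc KD(2)[OF P_one(1) that, of n] by (simp add: abs_mult mult_right_mono)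
        ultimately show ?thesis by linarith
      qed
      then have "(\<integral>x. \<bar>d x\<bar> \<partial>U) \<le> (\<integral>x. 2 * M * \<bar>\<psi> n x - h x\<bar> + M * err n * \<psi> n x \<partial>U)"
        by (intro integral_mono) (use di ei P_one(3) in auto)
      also have "\<dots> = 3 * M * err n"
        using ei P_one[of n] by (simp add: err_def[symmetric])
      finally have dE: "(\<integral>x. \<bar>d x\<bar> \<partial>U) \<le> 3 * M * err n" .
      have e: "H k x = P k g x + P k d x" for x
      proof -
        have "(\<lambda>x. ph x * h x) = (\<lambda>x. g x + d x)" by (auto simp: d_def)
        then show ?thesis unfolding H_def by (simp only: PP_add)
      qed
      have gk: "P k g x = P k (\<lambda>x. \<phi> x * \<psi> n x) x - cn * P k (\<psi> n) x" for x
        unfolding g_def by (simp add: PP_diff PP_mult)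
      have "(\<integral>x. \<bar>H k x\<bar> \<partial>U) \<le> (\<integral>x. \<bar>P k g x\<bar> + \<bar>P k d x\<bar> \<partial>U)"
        unfolding e by (rule integral_mono) (use PP_integrable(1)[OF adm_const gi] PP_integrable(1)[OF adm_const di] in auto)
      also have "\<dots> = (\<integral>x. \<bar>P k g x\<bar> \<partial>U) + (\<integral>x. \<bar>P k d x\<bar> \<partial>U)"
        using PP_integrable(1)[OF adm_const gi] PP_integrable(1)[OF adm_const di] by simp
      also have "(\<integral>x. \<bar>P k g x\<bar> \<partial>U) \<le> D / real (Suc k) ^ 4"
        unfolding gk cn_def by (rule D(2)[OF adm_const P_one(1,2)])
      also have "(\<integral>x. \<bar>P k d x\<bar> \<partial>U) \<le> 3 * M * err n"
        using PP_L1[OF adm_const di, of k] dE by simp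
      finally show ?thesis by simp
    qed
    have "(\<lambda>n. D / real (Suc k) ^ 4 + 3 * M * err n) \<longlonglongrightarrow> D / real (Suc k) ^ 4 + 3 * M * 0"
      by (intro tendsto_intros err_lim)
    then have "(\<integral>x. \<bar>H k x\<bar> \<partial>U) \<le> D / real (Suc k) ^ 4 + 3 * M * 0" by (rule LIMSEQ_le_const) (use le in auto)
    then show ?thesis by simp
  qed
  then show ?thesis using D(1) by blast
qed

text \<open>The autocovariance at lag \<open>d\<close> of the stationary process with law
  \<open>h\<close> dm; \<open>\<rho>_eq\<close> brings it into that form.\<close>

definition \<rho> :: "nat \<Rightarrow> real" where "\<rho> d = (\<integral>x. ph x * H d x \<partial>U)"

lemma phH_int: "integrable U (\<lambda>x. ph x * H d x)"
  by (rule integral_mult_bound(1)[OF H_int ph_U, of "2 * M"]) (simp add: ph_bound)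

lemma \<rho>_eq: "\<rho> d = (\<integral>x. \<phi> (seqT (\<lambda>_. \<gamma>) d x) * (\<phi> x * h x) \<partial>U) - c0 * c0"
proof -
  have i1: "integrable U (\<lambda>x. \<phi> x * H d x)" by (rule \<phi>h_int[OF H_int])
  have H0: "(\<integral>x. H d x \<partial>U) = 0"
  proof -
    have "(\<integral>x. H d x \<partial>U) = (\<integral>x. \<phi> x * h x - c0 * h x \<partial>U)"
      unfolding H_def PP_integrable(2)[OF adm_const phh_int] by (simp add: ph_def left_diff_distrib)
    also have "\<dots> = 0" using \<phi>h_int[OF h_int] h_int h_integral by (simp add: c0_def)
    finally show ?thesis .
  qed
  note D = PP_duality[OF adm_const _ \<phi>_U, of _ M d]
  have j: "integrable U (\<lambda>x. \<phi> (seqT (\<lambda>_. \<gamma>) d x) * (\<phi> x * h x))"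
    "integrable U (\<lambda>x. \<phi> (seqT (\<lambda>_. \<gamma>) d x) * h x)"
    using D(1)[OF \<phi>h_int[OF h_int]] D(1)[OF h_int] \<phi>_bound by auto
  have "\<rho> d = (\<integral>x. \<phi> x * H d x - c0 * H d x \<partial>U)" by (simp add: \<rho>_def ph_def left_diff_distrib)
  also have "\<dots> = (\<integral>x. \<phi> x * H d x \<partial>U)" using i1 H_int H0 by simp
  also have "\<dots> = (\<integral>x. \<phi> (seqT (\<lambda>_. \<gamma>) d x) * (ph x * h x) \<partial>U)"
    unfolding H_def by (rule D(3)[OF phh_int]) (simp add: \<phi>_bound)
  also have "\<dots> = (\<integral>x. \<phi> (seqT (\<lambda>_. \<gamma>) d x) * (\<phi> x * h x) - c0 * (\<phi> (seqT (\<lambda>_. \<gamma>) d x) * h x) \<partial>U)"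
    by (rule Bochner_Integration.integral_cong) (auto simp: ph_def algebra_simps)
  also have "\<dots> = (\<integral>x. \<phi> (seqT (\<lambda>_. \<gamma>) d x) * (\<phi> x * h x) \<partial>U) - c0 * (\<integral>x. \<phi> (seqT (\<lambda>_. \<gamma>) d x) * h x \<partial>U)"
    using j by simp
  also have "(\<integral>x. \<phi> (seqT (\<lambda>_. \<gamma>) d x) * h x \<partial>U) = (\<integral>x. \<phi> x * P d h x \<partial>U)"
    by (rule D(3)[OF h_int, symmetric]) (simp add: \<phi>_bound)
  also have "\<dots> = c0" unfolding c0_def
  proof (rule integral_cong_AE)
    show "(\<lambda>x. \<phi> x * P d h x) \<in> borel_measurable U"
      using \<phi>_U PP_integrable(1)[OF adm_const h_int] by (intro borel_measurable_times) auto
    show "(\<lambda>x. \<phi> x * h x) \<in> borel_measurable U"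
      using \<phi>_U h_int by (intro borel_measurable_times) auto
    show "AE x in U. \<phi> x * P d h x = \<phi> x * h x" using P_h_AE[of d] by eventually_elim simp
  qed
  finally show ?thesis .
qed

lemma \<rho>_bound: "(\<integral>x. \<bar>H d x\<bar> \<partial>U) \<le> r \<Longrightarrow> \<bar>\<rho> d\<bar> \<le> 2 * M * r"
  unfolding \<rho>_def
  using integral_mult_bound(2)[OF H_int ph_U, of "2 * M" d] ph_bound mult_left_mono[of "\<integral>x. \<bar>H d x\<bar> \<partial>U" r "2 * M"] M_nonneg
  by simp

lemma \<rho>_summable: "summable (\<lambda>d. \<bar>\<rho> d\<bar>)"
proof -
  obtain D where D: "\<And>k. (\<integral>x. \<bar>H k x\<bar> \<partial>U) \<le> D / real (Suc k) ^ 4" using H_rate by blast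
  show ?thesis
  proof (rule summable_comparison_test'[where N = 0])
    show "summable (\<lambda>n. 2 * M * (D / real (Suc n) ^ 4))" by (rule summable_mult[OF summable_inverse_4])
    show "norm \<bar>\<rho> n\<bar> \<le> 2 * M * (D / real (Suc n) ^ 4)" for n using \<rho>_bound[OF D[of n]] by simp
  qed
qed

definition Vlim :: real where "Vlim = \<rho> 0 + 2 * (\<Sum>d. \<rho> (Suc d))"

section \<open>Martingale-free expansion of the Green-Kubo variance\<close>

definition T :: "real \<Rightarrow> real" where "T = LSV \<gamma>"

lemma T_measurable: "T \<in> U \<rightarrow>\<^sub>M U" unfolding T_def by (rule LSV_measurable_U[OF \<gamma>(1)])

lemma hm: "h \<in> borel_measurable U" using h_int by auto

text \<open>An identity of measures, because duality covers bounded test functions only while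
  \<open>T_invariant\<close> is applied below to differences with the possibly unbounded
  \<open>u\<close>.\<close>

lemma distr_T: "distr (density U (\<lambda>x. ennreal (h x))) U T = density U (\<lambda>x. ennreal (h x))"
proof (rule measure_eqI)
  fix A assume "A \<in> sets (distr (density U (\<lambda>x. ennreal (h x))) U T)"
  then have A: "A \<in> sets U" by simp
  have TA: "T -` A \<inter> {0<..1} \<in> sets U" using measurable_sets[OF T_measurable A] by simp
  have e: "emeasure (density U (\<lambda>x. ennreal (h x))) B = ennreal (\<integral>x. indicator B x * h x \<partial>U)" if "B \<in> sets U" for B
  proof -
    have i: "integrable U (\<lambda>x. indicator B x * h x)"
      by (rule integral_mult_bound(1)[OF h_int, of _ 1]) (use that in \<open>auto split: split_indicator\<close>)
    have "emeasure (density U (\<lambda>x. ennreal (h x))) B = (\<integral>\<^sup>+x. ennreal (indicator B x * h x) \<partial>U)"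
      using that hm by (subst emeasure_density) (auto intro!: nn_integral_cong split: split_indicator)
    also have "\<dots> = ennreal (\<integral>x. indicator B x * h x \<partial>U)"
      by (rule nn_integral_eq_integral[OF i]) (use h_pos in \<open>auto intro!: AE_I2 simp: less_imp_le\<close>)
    finally show ?thesis .
  qed
  have "(\<integral>x. indicator (T -` A \<inter> {0<..1}) x * h x \<partial>U) = (\<integral>x. indicator A (seqT (\<lambda>_. \<gamma>) 1 x) * h x \<partial>U)"
    by (rule Bochner_Integration.integral_cong) (auto split: split_indicator simp: T_def)
  also have "\<dots> = (\<integral>x. indicator A x * P 1 h x \<partial>U)"
    by (rule PP_duality(3)[OF adm_const h_int, of _ 1, symmetric]) (use A in \<open>auto split: split_indicator\<close>)
  also have "\<dots> = (\<integral>x. indicator A x * h x \<partial>U)"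
  proof (rule integral_cong_AE)
    show "AE x in U. indicator A x * P 1 h x = indicator A x * h x" using P_h_AE[of 1] by eventually_elim simp
  qed (use A hm PP_integrable(1)[OF adm_const h_int, of 1] in \<open>auto intro!: borel_measurable_times simp del: PP.simps\<close>)
  finally show "emeasure (distr (density U (\<lambda>x. ennreal (h x))) U T) A = emeasure (density U (\<lambda>x. ennreal (h x))) A"
    using A TA T_measurable by (subst emeasure_distr) (auto simp: e)
qed simp

lemma T_invariant:
  fixes F :: "real \<Rightarrow> real"
  assumes F: "F \<in> borel_measurable U" "integrable U (\<lambda>x. h x * F x)"
  shows "integrable U (\<lambda>x. h x * F (T x))" "(\<integral>x. h x * F (T x) \<partial>U) = (\<integral>x. h x * F x \<partial>U)"
proof -
  let ?\<mu> = "density U (\<lambda>x. ennreal (h x))"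
  have FT: "(\<lambda>x. F (T x)) \<in> borel_measurable U" by (rule measurable_compose[OF T_measurable F(1)])
  have h0: "AE x in U. 0 \<le> h x" using h_pos by (auto intro!: AE_I2 simp: less_imp_le)
  have Tm: "T \<in> measurable ?\<mu> U" using T_measurable by simp
  have "integrable ?\<mu> F" using integrable_density[OF F(1) hm h0] F(2) by simp
  then have "integrable (distr ?\<mu> U T) F" by (simp only: distr_T)
  then have "integrable ?\<mu> (\<lambda>x. F (T x))" using integrable_distr_eq[OF Tm F(1)] by simp
  then show "integrable U (\<lambda>x. h x * F (T x))" using integrable_density[OF FT hm h0] by simp
  have "(\<integral>x. h x * F (T x) \<partial>U) = (\<integral>x. F (T x) \<partial>?\<mu>)" using integral_density[OF FT hm h0] by simp
  also have "\<dots> = (\<integral>x. F x \<partial>distr ?\<mu> U T)" by (rule integral_distr[OF Tm F(1), symmetric])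
  also have "\<dots> = (\<integral>x. F x \<partial>?\<mu>)" by (simp only: distr_T)
  also have "\<dots> = (\<integral>x. h x * F x \<partial>U)" using integral_density[OF F(1) hm h0] by simp
  finally show "(\<integral>x. h x * F (T x) \<partial>U) = (\<integral>x. h x * F x \<partial>U)" .
qed

text \<open>\<open>H k\<close> obeys the bound by \<open>2 M h\<close> only almost everywhere; truncation makes it hold everywhere.\<close>

definition G :: "nat \<Rightarrow> real \<Rightarrow> real" where
  "G k x = max (- (2 * M * h x)) (min (2 * M * h x) (H k x))"

lemma G_bound: "\<bar>G k x\<bar> \<le> 2 * M * h x"
  using M_nonneg h_pos[of x] by (auto simp: G_def abs_le_iff)

lemma G_AE: "AE x in U. \<forall>k. G k x = H k x"
  unfolding AE_all_countable
proof
  fix k show "AE x in U. G k x = H k x"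
    using H_bound_AE[of k] by eventually_elim (auto simp: G_def abs_le_iff)
qed

lemma G_measurable: "G k \<in> borel_measurable U"
  unfolding G_def using hm borel_measurable_integrable[OF H_int[of k]] by measurable

lemma G_int: "integrable U (G k)"
  by (rule Bochner_Integration.integrable_bound[of _ "\<lambda>x. 2 * M * h x"])
     (use h_int G_measurable G_bound in \<open>auto intro!: AE_I2 intro: order.trans[OF _ abs_ge_self]\<close>)

definition Hs :: "nat \<Rightarrow> real \<Rightarrow> real" where "Hs N x = (\<Sum>k=1..N. G k x)"

text \<open>The partial sums called u with index N in the overview, up to null sets.\<close>

definition w :: "nat \<Rightarrow> real \<Rightarrow> real" where "w N x = Hs N x / h x"

lemma Hs_int: "integrable U (Hs N)"
  unfolding Hs_def by (intro Bochner_Integration.integrable_sum G_int)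

lemma w_h: "w N x * h x = Hs N x" using h_pos[of x] by (simp add: w_def)

lemma w_measurable: "w N \<in> borel_measurable U"
  unfolding w_def using hm Hs_int[of N] by (intro borel_measurable_divide) auto

lemma w_bound: "\<bar>w N x\<bar> \<le> 2 * M * real N"
proof -
  have "\<bar>Hs N x\<bar> \<le> (\<Sum>k=1..N. 2 * M * h x)"
    unfolding Hs_def by (rule order.trans[OF sum_abs sum_mono]) (rule G_bound)
  then show ?thesis using h_pos[of x] by (simp add: w_def abs_div pos_divide_le_eq mult_ac)
qed

definition V :: "nat \<Rightarrow> real" where
  "V N = (\<integral>x. (ph x + w N x - w N (T x))\<^sup>2 * h x \<partial>U)"

text \<open>Expand the square with \<open>a = ph + w N\<close> and \<open>b = w N \<circ> T\<close>.
  Here \<open>a * h\<close> is the sum of \<open>H k\<close> for k from 0 to N, which one transfer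
  step shifts to 1, ..., N + 1; so the cross term is \<open>W\<close> plus the boundary term with
  \<open>H (Suc N)\<close>. The square of \<open>b\<close> gives \<open>W\<close> by invariance,
  that of \<open>a\<close> the covariances plus \<open>W\<close>, and all \<open>W\<close>
  cancel.\<close>

lemma V_eq: "V N = \<rho> 0 + 2 * (\<Sum>k=1..N. \<rho> k) - 2 * (\<integral>x. w N x * H (Suc N) x \<partial>U)"
proof -
  define B where "B = 2 * M + 2 * M * real N"
  define a where "a x = ph x + w N x" for x
  define b where "b x = w N (T x)" for x
  have am: "a \<in> borel_measurable U" unfolding a_def using ph_U w_measurable by (intro borel_measurable_add)
  have bm: "b \<in> borel_measurable U" unfolding b_def by (rule measurable_compose[OF T_measurable w_measurable])
  have ab: "\<bar>a x\<bar> \<le> B" for x unfolding a_def B_def using ph_bound[of x] w_bound[of N x] by linarith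
  have wB: "\<bar>w N x\<bar> \<le> B" for x unfolding B_def using w_bound[of N x] M_nonneg by linarith
  have bb: "\<bar>b x\<bar> \<le> B" for x using wB by (simp add: b_def)
  have B0: "0 \<le> B" using ab[of 0] by linarith
  have bd2: "\<bar>p x * q x\<bar> \<le> B * B" if "\<And>x. \<bar>p x\<bar> \<le> B" "\<And>x. \<bar>q x\<bar> \<le> B" for p q :: "real \<Rightarrow> real" and x
    unfolding abs_mult using that B0 by (intro mult_mono) auto
  have I: "integrable U (\<lambda>x. (p x * q x) * f x)"
    if "p \<in> borel_measurable U" "q \<in> borel_measurable U" "\<And>x. \<bar>p x\<bar> \<le> B" "\<And>x. \<bar>q x\<bar> \<le> B" "integrable U f" for p q f
    by (rule integral_mult_bound(1)[OF that(5), of _ "B * B"]) (use that bd2 in auto)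
  have I1: "integrable U (\<lambda>x. p x * f x)"
    if "p \<in> borel_measurable U" "\<And>x. \<bar>p x\<bar> \<le> B" "integrable U f" for p f
    by (rule integral_mult_bound(1)[OF that(3), of _ B]) (use that in auto)
  define W where "W = (\<integral>x. (w N x * w N x) * h x \<partial>U)"
  define S where "S x = (\<Sum>k=0..N. H k x)" for x
  have Si: "integrable U S" unfolding S_def by (intro Bochner_Integration.integrable_sum H_int)
  have AE_S: "AE x in U. a x * h x = S x \<and> Hs N x = (\<Sum>k=1..N. H k x)"
    using G_AE
  proof eventually_elim
    case (elim x)
    have 1: "Hs N x = (\<Sum>k=1..N. H k x)" using elim by (simp add: Hs_def)
    have "a x * h x = ph x * h x + Hs N x" by (simp add: a_def distrib_right w_h)
    also have "ph x * h x = H 0 x" by (simp add: H_def)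
    also have "H 0 x + Hs N x = S x" unfolding 1 S_def by (simp add: sum.atLeast_Suc_atMost)
    finally show ?case using 1 by simp
  qed
  have Vd: "V N = (\<integral>x. (a x * a x) * h x \<partial>U) - 2 * (\<integral>x. b x * (a x * h x) \<partial>U) + (\<integral>x. (b x * b x) * h x \<partial>U)"
  proof -
    have "V N = (\<integral>x. (a x * a x) * h x - 2 * ((b x * a x) * h x) + (b x * b x) * h x \<partial>U)"
      unfolding V_def by (rule Bochner_Integration.integral_cong) (auto simp: a_def b_def power2_eq_square algebra_simps)
    also have "\<dots> = (\<integral>x. (a x * a x) * h x \<partial>U) - 2 * (\<integral>x. (b x * a x) * h x \<partial>U) + (\<integral>x. (b x * b x) * h x \<partial>U)"
      using I[OF am am ab ab h_int] I[OF bm am bb ab h_int] I[OF bm bm bb bb h_int] by simp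
    finally show ?thesis by (simp add: mult.assoc)
  qed
  have b2: "(\<integral>x. (b x * b x) * h x \<partial>U) = W"
  proof -
    have "(\<integral>x. h x * (w N (T x) * w N (T x)) \<partial>U) = (\<integral>x. h x * (w N x * w N x) \<partial>U)"
      by (rule T_invariant(2)[of "\<lambda>x. w N x * w N x"])
         (use w_measurable I[OF w_measurable w_measurable wB wB h_int] in \<open>auto simp: mult.commute\<close>)
    then show ?thesis by (simp add: W_def b_def mult.commute)
  qed
  have ba: "(\<integral>x. b x * (a x * h x) \<partial>U) = W + (\<integral>x. w N x * H (Suc N) x \<partial>U)"
  proof -
    have "(\<integral>x. b x * (a x * h x) \<partial>U) = (\<integral>x. b x * S x \<partial>U)"
    proof (rule integral_cong_AE)
      show "AE x in U. b x * (a x * h x) = b x * S x" using AE_S by eventually_elim simp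
    qed (use am bm hm Si in \<open>auto intro!: borel_measurable_times\<close>)
    also have "\<dots> = (\<integral>x. w N (seqT (\<lambda>_. \<gamma>) 1 x) * S x \<partial>U)" by (simp add: b_def T_def)
    also have "\<dots> = (\<integral>x. w N x * P 1 S x \<partial>U)"
      by (rule PP_duality(3)[OF adm_const Si w_measurable, of N B, symmetric]) (simp add: wB)
    also have "\<dots> = (\<integral>x. w N x * Hs N x + w N x * H (Suc N) x \<partial>U)"
    proof (rule integral_cong_AE)
      have "P 1 S x = (\<Sum>k=0..N. H (Suc k) x)" for x
      proof -
        have "transfer \<gamma> (\<lambda>x. \<Sum>k=0..n. H k x) x = (\<Sum>k=0..n. H (Suc k) x)" for n
          by (induction n) (auto simp: transfer_add H_Suc)
        then show ?thesis by (simp add: S_def[abs_def])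
      qed
      also have "(\<Sum>k=0..N. H (Suc k) x) = (\<Sum>k=1..N. H k x) + H (Suc N) x" for x
        using sum.shift_bounds_cl_Suc_ivl[of "\<lambda>k. H k x" 0 N] by simp
      finally have PS: "P 1 S x = (\<Sum>k=1..N. H k x) + H (Suc N) x" for x .
      show "AE x in U. w N x * P 1 S x = w N x * Hs N x + w N x * H (Suc N) x"
        using AE_S
      proof eventually_elim
        case (elim x)
        then show ?case unfolding PS by (simp add: distrib_left)
      qed
    qed (use w_measurable Hs_int H_int PP_integrable(1)[OF adm_const Si, of 1] in
         \<open>auto intro!: borel_measurable_times borel_measurable_add simp del: PP.simps\<close>)
    also have "\<dots> = (\<integral>x. w N x * Hs N x \<partial>U) + (\<integral>x. w N x * H (Suc N) x \<partial>U)"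
      by (rule Bochner_Integration.integral_add[OF I1[OF w_measurable wB Hs_int] I1[OF w_measurable wB H_int]])
    also have "(\<integral>x. w N x * Hs N x \<partial>U) = W" by (simp add: W_def w_h[symmetric] mult_ac)
    finally show ?thesis .
  qed
  have a2: "(\<integral>x. (a x * a x) * h x \<partial>U) = \<rho> 0 + 2 * (\<Sum>k=1..N. \<rho> k) + W"
  proof -
    have "(\<integral>x. (a x * a x) * h x \<partial>U) = (\<integral>x. ph x * H 0 x + 2 * (\<Sum>k=1..N. ph x * H k x) + (w N x * w N x) * h x \<partial>U)"
    proof (rule integral_cong_AE)
      show "AE x in U. (a x * a x) * h x = ph x * H 0 x + 2 * (\<Sum>k=1..N. ph x * H k x) + (w N x * w N x) * h x"
        using AE_S
      proof eventually_elim
        case (elim x)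
        have "(a x * a x) * h x = ph x * (ph x * h x) + 2 * (ph x * (w N x * h x)) + (w N x * w N x) * h x"
          by (simp add: a_def algebra_simps)
        then show ?case using elim by (simp add: w_h sum_distrib_left H_def)
      qed
    qed (use am hm ph_U w_measurable H_int in \<open>auto intro!: borel_measurable_times borel_measurable_add borel_measurable_sum\<close>)
    also have "\<dots> = \<rho> 0 + 2 * (\<Sum>k=1..N. \<rho> k) + W"
      unfolding \<rho>_def W_def
      using phH_int I[OF w_measurable w_measurable wB wB h_int]
      by (subst Bochner_Integration.integral_add, auto intro!: Bochner_Integration.integrable_sum)+
    finally show ?thesis .
  qed
  show ?thesis unfolding Vd a2 ba b2 by simp
qed

text \<open>The boundary term vanishes because \<open>w N\<close> grows at most linearly while the
  L1 norm of \<open>H (Suc N)\<close> is of order N^-4.\<close>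

lemma V_lim: "V \<longlonglongrightarrow> Vlim"
proof -
  obtain D where D: "0 < D" "\<And>k. (\<integral>x. \<bar>H k x\<bar> \<partial>U) \<le> D / real (Suc k) ^ 4" using H_rate by blast
  have "(\<lambda>N. \<Sum>k=1..N. \<rho> k) \<longlonglongrightarrow> (\<Sum>d. \<rho> (Suc d))"
  proof -
    have "summable (\<lambda>d. \<rho> (Suc d))"
      using summable_norm_cancel[of \<rho>] \<rho>_summable by (simp add: summable_Suc_iff)
    then have "(\<lambda>N. \<Sum>k<N. \<rho> (Suc k)) \<longlonglongrightarrow> (\<Sum>d. \<rho> (Suc d))" by (rule summable_LIMSEQ)
    moreover have "(\<Sum>k<N. \<rho> (Suc k)) = (\<Sum>k=1..N. \<rho> k)" for N
      by (induction N) auto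
    ultimately show ?thesis by simp
  qed
  moreover have "(\<lambda>N. \<integral>x. w N x * H (Suc N) x \<partial>U) \<longlonglongrightarrow> 0"
  proof (rule tendsto_rabs_zero_cancel, rule tendsto_sandwich[OF _ _ tendsto_const])
    show "\<forall>\<^sub>F N in sequentially. \<bar>\<integral>x. w N x * H (Suc N) x \<partial>U\<bar> \<le> 2 * M * D * (1 / real (Suc N))"
    proof (intro always_eventually allI)
      fix N
      have "\<bar>\<integral>x. w N x * H (Suc N) x \<partial>U\<bar> \<le> 2 * M * real N * (\<integral>x. \<bar>H (Suc N) x\<bar> \<partial>U)"
        using integral_mult_bound(2)[OF H_int[of "Suc N"] w_measurable[of N], of "2 * M * real N"] w_bound by simp
      also have "\<dots> \<le> 2 * M * real (Suc N) * (D / real (Suc N) ^ 4)"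
      proof (intro mult_mono)
        have "D / real (Suc (Suc N)) ^ 4 \<le> D / real (Suc N) ^ 4"
          using D(1) by (intro divide_left_mono power_mono mult_pos_pos) auto
        then show "(\<integral>x. \<bar>H (Suc N) x\<bar> \<partial>U) \<le> D / real (Suc N) ^ 4" using D(2)[of "Suc N"] by linarith
      qed (use M_nonneg in auto)
      also have "\<dots> = 2 * M * D * (1 / real (Suc N) ^ 3)" by (simp add: power_Suc eval_nat_numeral)
      also have "\<dots> \<le> 2 * M * D * (1 / real (Suc N))"
      proof (intro mult_left_mono divide_left_mono)
        show "real (Suc N) \<le> real (Suc N) ^ 3" using power_increasing[of 1 3 "real (Suc N)"] by simp
      qed (use M_nonneg D(1) in auto)
      finally show "\<bar>\<integral>x. w N x * H (Suc N) x \<partial>U\<bar> \<le> 2 * M * D * (1 / real (Suc N))" .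
    qed
    show "(\<lambda>N. 2 * M * D * (1 / real (Suc N))) \<longlonglongrightarrow> 0"
      using tendsto_mult_right_zero[OF LIMSEQ_inverse_real_of_nat, of "2 * M * D"] by (simp add: divide_inverse)
  qed auto
  ultimately have "(\<lambda>N. \<rho> 0 + 2 * (\<Sum>k=1..N. \<rho> k) - 2 * (\<integral>x. w N x * H (Suc N) x \<partial>U)) \<longlonglongrightarrow> \<rho> 0 + 2 * (\<Sum>d. \<rho> (Suc d)) - 2 * 0"
    by (intro tendsto_intros)
  then show ?thesis by (simp add: V_eq[abs_def] Vlim_def)
qed

lemma V_nonneg: "0 \<le> Vlim"
  by (rule LIMSEQ_le_const[OF V_lim])
     (auto simp: V_def intro!: Bochner_Integration.integral_nonneg mult_nonneg_nonneg less_imp_le[OF h_pos])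

text \<open>Convergence of the partial sums is available in L1 only, so the defect \<open>z\<close>
  of the limit is estimated there: it differs from the defect \<open>y\<close> of \<open>w N\<close>
  by two terms of equal size by invariance, and the L1 norm of \<open>y\<close> is at most
  \<open>sqrt (V N)\<close>.\<close>

lemma variance_zero_imp_coboundary:
  assumes "Vlim = 0"
  shows "\<exists>u b. u \<in> borel_measurable U \<and> (AE x in U. \<phi> x = b + u (LSV \<gamma> x) - u x)"
proof -
  obtain D where D: "0 < D" "\<And>k. (\<integral>x. \<bar>H k x\<bar> \<partial>U) \<le> D / real (Suc k) ^ 4" using H_rate by blast
  have sm: "summable (\<lambda>n. \<integral>x. \<bar>Hs (Suc n) x - Hs n x\<bar> \<partial>U)"
  proof (rule summable_comparison_test'[where N = 0])
    show "summable (\<lambda>n. D / real (Suc n) ^ 4)" by (rule summable_inverse_4)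
    fix n
    have "(\<integral>x. \<bar>Hs (Suc n) x - Hs n x\<bar> \<partial>U) = (\<integral>x. \<bar>H (Suc n) x\<bar> \<partial>U)"
    proof (rule integral_cong_AE)
      show "AE x in U. \<bar>Hs (Suc n) x - Hs n x\<bar> = \<bar>H (Suc n) x\<bar>"
        using G_AE by eventually_elim (simp add: Hs_def)
    qed (use borel_measurable_integrable[OF Hs_int] borel_measurable_integrable[OF H_int] in auto)
    also have "\<dots> \<le> D / real (Suc (Suc n)) ^ 4" by (rule D(2))
    also have "\<dots> \<le> D / real (Suc n) ^ 4" using D(1) by (intro divide_left_mono power_mono mult_pos_pos) auto
    finally show "norm (\<integral>x. \<bar>Hs (Suc n) x - Hs n x\<bar> \<partial>U) \<le> D / real (Suc n) ^ 4" by simp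
  qed
  obtain u0 where u0: "integrable U u0" "(\<lambda>n. \<integral>x. \<bar>Hs n x - u0 x\<bar> \<partial>U) \<longlonglongrightarrow> 0"
    using L1_complete_U[OF Hs_int sm] by blast
  define u where "u x = u0 x / h x" for x
  have um: "u \<in> borel_measurable U" unfolding u_def using u0(1) hm by (intro borel_measurable_divide) auto
  have uh: "h x * u x = u0 x" for x using h_pos[of x] by (simp add: u_def)
  have uhi: "integrable U (\<lambda>x. h x * u x)" using u0(1) by (simp add: uh)
  define z where "z x = ph x + u x - u (T x)" for x
  have zi: "integrable U (\<lambda>x. h x * z x)"
  proof -
    have "(\<lambda>x. h x * z x) = (\<lambda>x. ph x * h x + h x * u x - h x * u (T x))" by (auto simp: z_def algebra_simps)
    then show ?thesis using phh_int uhi T_invariant(1)[OF um uhi] by simp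
  qed
  have le: "(\<integral>x. h x * \<bar>z x\<bar> \<partial>U) \<le> sqrt (V N) + 2 * (\<integral>x. \<bar>Hs N x - u0 x\<bar> \<partial>U)" for N
  proof -
    define y where "y x = ph x + w N x - w N (T x)" for x
    have wT: "(\<lambda>x. w N (T x)) \<in> borel_measurable U" by (rule measurable_compose[OF T_measurable w_measurable])
    have ym: "y \<in> borel_measurable U" unfolding y_def using ph_U w_measurable wT by (intro borel_measurable_diff borel_measurable_add)
    define B where "B = 2 * M + 4 * M * real N"
    have yb: "\<bar>y x\<bar> \<le> B" for x
      unfolding y_def B_def using ph_bound[of x] w_bound[of N x] w_bound[of N "T x"] by linarith
    have yi: "integrable U (\<lambda>x. \<bar>y x\<bar> * h x)"
      by (rule integral_mult_bound(1)[OF h_int, of _ B]) (use ym yb in auto)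
    have y2i: "integrable U (\<lambda>x. (y x)\<^sup>2 * h x)"
      by (rule integral_mult_bound(1)[OF h_int, of _ "B\<^sup>2"]) (use ym yb in \<open>auto simp: abs_le_square_iff[symmetric] intro: order.trans[OF _ abs_ge_self]\<close>)
    define J where "J = (\<integral>x. \<bar>y x\<bar> * h x \<partial>U)"
    \<comment> \<open>Cauchy-Schwarz for the probability \<open>h\<close> dm, in the form that the
      variance of \<open>\<bar>y\<bar>\<close> is nonnegative.\<close>
    have "0 \<le> (\<integral>x. (\<bar>y x\<bar> - J)\<^sup>2 * h x \<partial>U)"
      by (rule Bochner_Integration.integral_nonneg) (simp add: less_imp_le[OF h_pos])
    also have "\<dots> = (\<integral>x. (y x)\<^sup>2 * h x - 2 * J * (\<bar>y x\<bar> * h x) + J\<^sup>2 * h x \<partial>U)"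
      by (rule Bochner_Integration.integral_cong) (auto simp: power2_eq_square algebra_simps)
    also have "\<dots> = V N - J\<^sup>2"
      using yi y2i h_int h_integral by (simp add: V_def y_def[symmetric] J_def[symmetric] power2_eq_square)
    finally have J: "J \<le> sqrt (V N)" by (simp add: real_le_rsqrt)
    have e1: "h x * \<bar>w N x - u x\<bar> = \<bar>Hs N x - u0 x\<bar>" for x
    proof -
      have "h x * \<bar>w N x - u x\<bar> = \<bar>h x * (w N x - u x)\<bar>" using h_pos[of x] by (simp add: abs_mult)
      moreover have "h x * w N x = Hs N x" by (subst mult.commute) (rule w_h)
      ultimately show ?thesis by (simp add: right_diff_distrib uh)
    qed
    have i1: "integrable U (\<lambda>x. h x * \<bar>w N x - u x\<bar>)"
      unfolding e1 using Hs_int u0(1) by auto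
    note inv = T_invariant[of "\<lambda>x. \<bar>w N x - u x\<bar>", OF _ i1]
    have wum: "(\<lambda>x. \<bar>w N x - u x\<bar>) \<in> borel_measurable U" using w_measurable um by auto
    have "(\<integral>x. h x * \<bar>z x\<bar> \<partial>U) \<le> (\<integral>x. \<bar>y x\<bar> * h x + h x * \<bar>w N x - u x\<bar> + h x * \<bar>w N (T x) - u (T x)\<bar> \<partial>U)"
    proof (rule integral_mono)
      have "integrable U (\<lambda>x. \<bar>h x * z x\<bar>)" using zi by auto
      then show "integrable U (\<lambda>x. h x * \<bar>z x\<bar>)" using h_pos by (simp add: abs_mult abs_of_pos)
      show "integrable U (\<lambda>x. \<bar>y x\<bar> * h x + h x * \<bar>w N x - u x\<bar> + h x * \<bar>w N (T x) - u (T x)\<bar>)"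
        using yi i1 inv(1)[OF wum] by auto
      fix x
      have "\<bar>z x\<bar> \<le> \<bar>y x\<bar> + \<bar>w N x - u x\<bar> + \<bar>w N (T x) - u (T x)\<bar>" by (simp add: z_def y_def)
      then have "h x * \<bar>z x\<bar> \<le> h x * (\<bar>y x\<bar> + \<bar>w N x - u x\<bar> + \<bar>w N (T x) - u (T x)\<bar>)"
        using h_pos[of x] by (intro mult_left_mono) auto
      then show "h x * \<bar>z x\<bar> \<le> \<bar>y x\<bar> * h x + h x * \<bar>w N x - u x\<bar> + h x * \<bar>w N (T x) - u (T x)\<bar>"
        by (simp add: algebra_simps)
    qed
    also have "\<dots> = J + (\<integral>x. h x * \<bar>w N x - u x\<bar> \<partial>U) + (\<integral>x. h x * \<bar>w N (T x) - u (T x)\<bar> \<partial>U)"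
      unfolding J_def using yi i1 inv(1)[OF wum] by simp
    also have "\<dots> = J + 2 * (\<integral>x. \<bar>Hs N x - u0 x\<bar> \<partial>U)" unfolding inv(2)[OF wum] e1 by simp
    finally show ?thesis using J by linarith
  qed
  have "(\<lambda>N. sqrt (V N) + 2 * (\<integral>x. \<bar>Hs N x - u0 x\<bar> \<partial>U)) \<longlonglongrightarrow> sqrt Vlim + 2 * 0"
    by (intro tendsto_intros V_lim u0(2))
  then have "(\<integral>x. h x * \<bar>z x\<bar> \<partial>U) \<le> sqrt Vlim + 2 * 0"
    by (rule LIMSEQ_le_const) (use le in auto)
  then have z0: "(\<integral>x. h x * \<bar>z x\<bar> \<partial>U) \<le> 0" using assms by simp
  have nn: "0 \<le> h x * \<bar>z x\<bar>" for x using h_pos[of x] by simp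
  have "0 \<le> (\<integral>x. h x * \<bar>z x\<bar> \<partial>U)" using nn by (rule Bochner_Integration.integral_nonneg)
  then have "(\<integral>x. h x * \<bar>z x\<bar> \<partial>U) = 0" using z0 by linarith
  moreover have "integrable U (\<lambda>x. h x * \<bar>z x\<bar>)"
  proof -
    have "integrable U (\<lambda>x. \<bar>h x * z x\<bar>)" using zi by auto
    then show ?thesis using h_pos by (simp add: abs_mult abs_of_pos)
  qed
  ultimately have "AE x in U. h x * \<bar>z x\<bar> = 0" using nn by (subst (asm) integral_nonneg_eq_0_iff_AE) auto
  then have "AE x in U. \<phi> x = c0 + u (LSV \<gamma> x) - u x"
  proof eventually_elim
    case (elim x)
    then have "z x = 0" using h_pos[of x] by auto
    then show ?case by (simp add: z_def ph_def T_def)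
  qed
  then show ?thesis using um by blast
qed

end

section \<open>Linear growth of the variance\<close>

lemma symmetric_double_sum:
  fixes c :: "nat \<Rightarrow> nat \<Rightarrow> real"
  assumes "\<And>i j. c i j = c j i"
  shows "(\<Sum>i=1..n. \<Sum>j=1..n. c i j) = (\<Sum>i=1..n. c i i + 2 * (\<Sum>d=1..n-i. c i (i + d)))"
proof (induction n)
  case (Suc n)
  have "(\<Sum>i=1..Suc n. \<Sum>j=1..Suc n. c i j) = (\<Sum>i=1..n. (\<Sum>j=1..n. c i j) + c i (Suc n)) + ((\<Sum>j=1..n. c (Suc n) j) + c (Suc n) (Suc n))"
    by simp
  also have "\<dots> = (\<Sum>i=1..n. \<Sum>j=1..n. c i j) + 2 * (\<Sum>i=1..n. c i (Suc n)) + c (Suc n) (Suc n)"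
  proof -
    have "(\<Sum>j=1..n. c (Suc n) j) = (\<Sum>i=1..n. c i (Suc n))" by (rule sum.cong[OF refl assms])
    then show ?thesis by (simp add: sum.distrib)
  qed
  also have "\<dots> = (\<Sum>i=1..n. (c i i + 2 * (\<Sum>d=1..n-i. c i (i + d))) + 2 * c i (Suc n)) + c (Suc n) (Suc n)"
    unfolding Suc.IH by (simp add: sum.distrib sum_distrib_left)
  also have "(\<Sum>i=1..n. (c i i + 2 * (\<Sum>d=1..n-i. c i (i + d))) + 2 * c i (Suc n)) = (\<Sum>i=1..n. c i i + 2 * (\<Sum>d=1..Suc n-i. c i (i + d)))"
  proof (rule sum.cong[OF refl])
    fix i assume "i \<in> {1..n}"
    then have "Suc n - i = Suc (n - i)" "i + Suc (n - i) = Suc n" by auto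
    then show "(c i i + 2 * (\<Sum>d=1..n-i. c i (i + d))) + 2 * c i (Suc n) = c i i + 2 * (\<Sum>d=1..Suc n-i. c i (i + d))"
      by simp
  qed
  finally show ?case by simp
qed simp

lemma sum_le_tail:
  fixes r :: "nat \<Rightarrow> real"
  assumes "summable r" "\<And>d. 0 \<le> r d"
  shows "(\<Sum>d=Suc L..m. r d) \<le> (\<Sum>d. r (d + Suc L))"
proof -
  have s: "summable (\<lambda>d. r (d + Suc L))" using assms(1) by (rule summable_ignore_initial_segment)
  show ?thesis
  proof (cases "Suc L \<le> m")
    case True
    have "(\<Sum>d=Suc L..m. r d) = (\<Sum>d=0+Suc L..(m - Suc L)+Suc L. r d)" using True by simp
    also have "\<dots> = (\<Sum>d=0..m - Suc L. r (d + Suc L))" by (rule sum.shift_bounds_cl_nat_ivl)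
    also have "\<dots> \<le> (\<Sum>d. r (d + Suc L))" by (rule sum_le_suminf[OF s]) (use assms(2) in auto)
    finally show ?thesis .
  next
    case False
    then show ?thesis using suminf_nonneg[OF s] assms(2) by simp
  qed
qed

text \<open>Grouped by rows, the double sum consists of one-sided correlation sums. A row away from
  both ends resembles \<open>V\<close>; at most \<open>k + L\<close> rows are exceptional, and these
  are bounded below by a constant. The gap between 5/8 and 1/2 absorbs them for large
  \<open>n\<close>.\<close>

lemma double_sum_lower:
  fixes c :: "nat \<Rightarrow> nat \<Rightarrow> real" and r \<rho> :: "nat \<Rightarrow> real"
  assumes sym: "\<And>i j. c i j = c j i" and dec: "\<And>i d. \<bar>c i (i + d)\<bar> \<le> r d" and r: "summable r"
    and \<rho>: "summable (\<lambda>d. \<bar>\<rho> d\<bar>)" and V: "V = \<rho> 0 + 2 * (\<Sum>d. \<rho> (Suc d))" "0 < V"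
    and close: "\<And>i d. k \<le> i \<Longrightarrow> d \<le> L \<Longrightarrow> \<bar>c i (i + d) - \<rho> d\<bar> \<le> \<eta>"
    and t1: "(\<Sum>d. r (d + Suc L)) \<le> V / 16" and t2: "(\<Sum>d. \<bar>\<rho> (d + Suc L)\<bar>) \<le> V / 16"
    and \<eta>: "(2 * real L + 1) * \<eta> \<le> V / 8"
  shows "\<exists>N. \<forall>n\<ge>N. V / 2 * real n \<le> (\<Sum>i=1..n. \<Sum>j=1..n. c i j)"
proof -
  define a where "a n i = c i i + 2 * (\<Sum>d=1..n-i. c i (i + d))" for n i
  have r0: "0 \<le> r d" for d using dec[of 0 d] by linarith
  define R where "R = (\<Sum>d. r d)"
  have R0: "0 \<le> R" unfolding R_def by (rule suminf_nonneg[OF r r0])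
  have low1: "- (2 * R) \<le> a n i" for n i
  proof -
    have "\<bar>\<Sum>d=1..n-i. c i (i + d)\<bar> \<le> (\<Sum>d=1..n-i. r d)"
      by (rule order.trans[OF sum_abs sum_mono]) (rule dec)
    moreover have "\<bar>c i i\<bar> \<le> r 0" using dec[of i 0] by simp
    moreover have "r 0 + (\<Sum>d=1..n-i. r d) \<le> R"
    proof -
      have "r 0 + (\<Sum>d=1..n-i. r d) = (\<Sum>d\<in>{0..n-i}. r d)" by (simp add: sum.atLeast_Suc_atMost)
      also have "\<dots> \<le> R" unfolding R_def by (rule sum_le_suminf[OF r]) (use r0 in auto)
      finally show ?thesis .
    qed
    ultimately show ?thesis unfolding a_def using r0[of 0] by linarith
  qed
  \<comment> \<open>Three losses of \<open>V/8\<close> each: twice the tail of the covariances,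
    twice the tail of \<open>\<rho>\<close>, and the error \<open>(2 * real L + 1) * \<eta>\<close>
    on lags up to \<open>L\<close>.\<close>
  have low2: "5 * V / 8 \<le> a n i" if "k \<le> i" "i + L \<le> n" for n i
  proof -
    have split: "(\<Sum>d=1..n-i. f d) = (\<Sum>d=1..L. f d) + (\<Sum>d=Suc L..n-i. f d)" for f :: "nat \<Rightarrow> real"
    proof -
      have "L \<le> n - i" using that by auto
      then obtain e where e: "n - i = L + e" by (metis le_Suc_ex)
      show ?thesis unfolding e using sum.ub_add_nat[of 1 L f e] by simp
    qed
    have tail: "- (V / 16) \<le> (\<Sum>d=Suc L..n-i. c i (i + d))"
    proof -
      have "\<bar>\<Sum>d=Suc L..n-i. c i (i + d)\<bar> \<le> (\<Sum>d=Suc L..n-i. r d)"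
        by (rule order.trans[OF sum_abs sum_mono]) (rule dec)
      also have "\<dots> \<le> V / 16" using sum_le_tail[OF r r0, of L "n - i"] t1 by linarith
      finally show ?thesis by linarith
    qed
    have head: "(\<Sum>d=1..L. \<rho> d) - real L * \<eta> \<le> (\<Sum>d=1..L. c i (i + d))"
    proof -
      have "(\<Sum>d=1..L. \<rho> d - \<eta>) \<le> (\<Sum>d=1..L. c i (i + d))"
      proof (rule sum_mono)
        fix d assume "d \<in> {1..L}"
        then show "\<rho> d - \<eta> \<le> c i (i + d)" using close[OF that(1), of d] by auto
      qed
      then show ?thesis by (simp add: sum_subtractf)
    qed
    have h0: "\<rho> 0 - \<eta> \<le> c i i" using close[OF that(1), of 0] by auto
    have inf: "(\<Sum>d. \<rho> (Suc d)) \<le> (\<Sum>d=1..L. \<rho> d) + V / 16"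
    proof -
      have s: "summable (\<lambda>d. \<rho> (Suc d))" using summable_norm_cancel[of \<rho>] \<rho> by (simp add: summable_Suc_iff)
      have "(\<Sum>d. \<rho> (Suc d)) = (\<Sum>d. \<rho> (Suc (d + L))) + (\<Sum>d<L. \<rho> (Suc d))"
        by (rule suminf_split_initial_segment[OF s])
      also have "(\<Sum>d<L. \<rho> (Suc d)) = (\<Sum>d=1..L. \<rho> d)" by (induction L) auto
      also have "(\<Sum>d. \<rho> (Suc (d + L))) \<le> (\<Sum>d. \<bar>\<rho> (d + Suc L)\<bar>)"
      proof -
        have s': "summable (\<lambda>d. \<bar>\<rho> (d + Suc L)\<bar>)" using summable_ignore_initial_segment[OF \<rho>] .
        then have "(\<Sum>d. \<rho> (d + Suc L)) \<le> (\<Sum>d. \<bar>\<rho> (d + Suc L)\<bar>)"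
          by (intro suminf_le[OF abs_ge_self summable_rabs_cancel[OF s'] s'])
        then show ?thesis by simp
      qed
      finally show ?thesis using t2 by linarith
    qed
    have "a n i = c i i + 2 * (\<Sum>d=1..L. c i (i + d)) + 2 * (\<Sum>d=Suc L..n-i. c i (i + d))"
      unfolding a_def split by simp
    moreover have "(2 * real L + 1) * \<eta> = \<eta> + 2 * (real L * \<eta>)" by (simp add: algebra_simps)
    ultimately show ?thesis using tail head h0 inf V(1) \<eta> by linarith
  qed
  \<comment> \<open>The price of an exceptional row: the difference between \<open>5 * V / 8\<close>
    and the general lower bound \<open>- (2 * R)\<close>.\<close>
  define W where "W = 2 * R + 5 * V / 8"
  have W: "0 \<le> W" using R0 V(2) by (simp add: W_def)
  have total: "5 * V / 8 * real n - W * real (k + L) \<le> (\<Sum>i=1..n. \<Sum>j=1..n. c i j)" for n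
  proof -
    define B where "B = {i\<in>{1..n}. \<not> (k \<le> i \<and> i + L \<le> n)}"
    have "B \<subseteq> {..<k} \<union> {n-L<..n}" by (auto simp: B_def)
    then have "card B \<le> card ({..<k} \<union> {n-L<..n})" by (intro card_mono) auto
    also have "\<dots> \<le> card {..<k} + card {n-L<..n}" by (rule card_Un_le)
    also have "\<dots> \<le> k + L" by simp
    finally have cB: "W * real (card B) \<le> W * real (k + L)" using W by (intro mult_left_mono) auto
    have "(\<Sum>i=1..n. 5 * V / 8 - W * indicator B i) \<le> (\<Sum>i=1..n. a n i)"
    proof (rule sum_mono)
      fix i assume "i \<in> {1..n}"
      then show "5 * V / 8 - W * indicator B i \<le> a n i"
        using low1[of n i] low2[of i n] by (auto simp: B_def W_def split: split_indicator)
    qed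
    moreover have "(\<Sum>i=1..n. W * indicator B i) = W * real (card B)"
    proof -
      have "(\<Sum>i=1..n. indicator B i :: real) = real (card ({1..n} \<inter> B))"
        by (simp add: indicator_def sum.If_cases Int_def)
      also have "{1..n} \<inter> B = B" by (auto simp: B_def)
      finally show ?thesis by (simp add: sum_distrib_left[symmetric])
    qed
    moreover have "(\<Sum>i=1..n. 5 * V / 8 - W * indicator B i) = 5 * V / 8 * real n - (\<Sum>i=1..n. W * indicator B i)"
      by (simp add: sum_subtractf mult.commute)
    ultimately have "5 * V / 8 * real n - W * real (card B) \<le> (\<Sum>i=1..n. a n i)" by linarith
    moreover have "(\<Sum>i=1..n. \<Sum>j=1..n. c i j) = (\<Sum>i=1..n. a n i)"
      unfolding a_def by (rule symmetric_double_sum[OF sym])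
    ultimately show ?thesis using cB by linarith
  qed
  obtain N :: nat where N: "W * real (k + L) / (V / 8) \<le> real N" using real_arch_simple by blast
  show ?thesis
  proof (intro exI[of _ N] allI impI)
    fix n assume "N \<le> n"
    then have "W * real (k + L) / (V / 8) \<le> real n" using N by linarith
    then have "W * real (k + L) \<le> real n * (V / 8)" using V(2) by (subst (asm) pos_divide_le_eq) auto
    then show "V / 2 * real n \<le> (\<Sum>i=1..n. \<Sum>j=1..n. c i j)" using total[of n] by (simp add: algebra_simps)
  qed
qed

lemma AE_U_ne: "AE x in U. x \<noteq> (1/2::real)"
proof -
  have "emeasure U {1/2} = emeasure lborel {1/2::real}"
    unfolding U_def by (rule emeasure_restrict_space) auto
  then have "{1/2} \<in> null_sets U" by (auto simp: null_sets_def sets_U)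
  from AE_not_in[OF this] show ?thesis by simp
qed

section \<open>Continuity in the exponents and comparison with the stationary covariances\<close>

lemma LSV_tendsto:
  assumes g: "g \<longlonglongrightarrow> \<gamma>" and y: "y \<longlonglongrightarrow> z" and z: "0 < z" "z \<noteq> 1/2"
  shows "(\<lambda>n. LSV (g n) (y n)) \<longlonglongrightarrow> LSV \<gamma> z"
proof (cases "z < 1/2")
  case True
  have "(\<lambda>n. y n + 2 powr g n * y n powr (1 + g n)) \<longlonglongrightarrow> z + 2 powr \<gamma> * z powr (1 + \<gamma>)"
    by (intro tendsto_intros g y) (use z in auto)
  moreover have "\<forall>\<^sub>F n in sequentially. y n + 2 powr g n * y n powr (1 + g n) = LSV (g n) (y n)"
    using order_tendstoD(2)[OF y True] by eventually_elim (simp add: LSV_def)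
  ultimately have "(\<lambda>n. LSV (g n) (y n)) \<longlonglongrightarrow> z + 2 powr \<gamma> * z powr (1 + \<gamma>)"
    by (rule Lim_transform_eventually)
  then show ?thesis using True by (simp add: LSV_def)
next
  case False
  then have zz: "1/2 < z" using z by auto
  have "(\<lambda>n. 2 * y n - 1) \<longlonglongrightarrow> 2 * z - 1" by (intro tendsto_intros y)
  moreover have "\<forall>\<^sub>F n in sequentially. 2 * y n - 1 = LSV (g n) (y n)"
    using order_tendstoD(1)[OF y zz] by eventually_elim (simp add: LSV_def)
  ultimately have "(\<lambda>n. LSV (g n) (y n)) \<longlonglongrightarrow> 2 * z - 1" by (rule Lim_transform_eventually)
  then show ?thesis using False z by (simp add: LSV_def)
qed

context lsv_inv
begin

abbreviation Tk :: "nat \<Rightarrow> real \<Rightarrow> real" where "Tk \<equiv> seqT (\<lambda>_. \<gamma>)"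

text \<open>The law of the orbit at time \<open>k\<close> has density \<open>\<psi> k\<close>, so it
  does not charge the point \<open>1/2\<close>, where the maps jump and orbits need not depend
  continuously on the exponents.\<close>

lemma orbit_avoids_half: "AE x in U. \<forall>k. Tk k x \<noteq> 1/2"
  unfolding AE_all_countable
proof
  fix k
  let ?I = "indicator {1/2::real} :: real \<Rightarrow> real"
  have Im: "?I \<in> borel_measurable U" by (rule borel_measurable_U_I) measurable
  have Ib: "norm (?I x) \<le> 1" for x by (auto split: split_indicator)
  note D = PP_duality[OF adm_const _ Im, of "\<lambda>_. 1" 1 k]
  have i: "integrable U (\<lambda>x. ?I (Tk k x))" using D(1) Ib by simp
  have "(\<integral>x. ?I (Tk k x) \<partial>U) = (\<integral>x. ?I x * \<psi> k x \<partial>U)" using D(3) Ib by simp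
  also have "\<dots> = (\<integral>x. 0 \<partial>U)"
  proof (rule integral_cong_AE)
    show "AE x in U. ?I x * \<psi> k x = 0" using AE_U_ne by eventually_elim simp
  qed (use Im borel_measurable_integrable[OF P_one(3)] in auto)
  finally have "(\<integral>x. ?I (Tk k x) \<partial>U) = 0" by simp
  then have "AE x in U. ?I (Tk k x) = 0" using i by (subst (asm) integral_nonneg_eq_0_iff_AE) auto
  then show "AE x in U. Tk k x \<noteq> 1/2" by eventually_elim auto
qed

lemma orbit_tendsto:
  assumes b: "\<And>k. 1 \<le> k \<Longrightarrow> (\<lambda>n. b n k) \<longlonglongrightarrow> \<gamma>" and x: "0 < x" "x \<le> 1" "\<And>k. Tk k x \<noteq> 1/2"
  shows "(\<lambda>n. seqT (b n) k x) \<longlonglongrightarrow> Tk k x"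
proof (induction k)
  case (Suc k)
  have "(\<lambda>n. LSV (b n (Suc k)) (seqT (b n) k x)) \<longlonglongrightarrow> LSV \<gamma> (Tk k x)"
    by (rule LSV_tendsto[OF b Suc]) (use seqT_in[OF adm_const x(1,2)] x(3) in auto)
  then show ?case by simp
qed simp

text \<open>Instantiated both with \<open>\<phi>\<close> and with the constant 1, so that one comparison covers covariances and means.\<close>

definition nice :: "(real \<Rightarrow> real) \<Rightarrow> bool" where
  "nice p \<longleftrightarrow> p \<in> borel_measurable U \<and> (\<forall>x. \<bar>p x\<bar> \<le> M + 1) \<and>
    (\<forall>y z. (\<forall>n. 0 < y n \<and> y n \<le> 1) \<longrightarrow> 0 < z \<longrightarrow> z \<le> 1 \<longrightarrow> y \<longlonglongrightarrow> z \<longrightarrow> (\<lambda>n. p (y n)) \<longlonglongrightarrow> p z)"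

lemma nice_tendsto:
  assumes "nice p" "\<And>n. 0 < y n" "\<And>n. y n \<le> 1" "0 < z" "z \<le> 1" "y \<longlonglongrightarrow> z"
  shows "(\<lambda>n. p (y n)) \<longlonglongrightarrow> p z"
  using assms unfolding nice_def by simp

lemma nice_one: "nice (\<lambda>_. 1)" using M_nonneg by (auto simp: nice_def)

lemma nice_\<phi>: "nice \<phi>"
  unfolding nice_def
proof (intro conjI allI impI)
  fix y :: "nat \<Rightarrow> real" and z :: real assume y: "\<forall>n. 0 < y n \<and> y n \<le> 1" "0 < z" "z \<le> 1" "y \<longlonglongrightarrow> z"
  have le: "\<bar>\<phi> u - \<phi> v\<bar> \<le> lip * \<bar>u - v\<bar>" if "0 < u" "u \<le> 1" "0 < v" "v \<le> 1" for u v
    using \<phi>_lip[of u v] \<phi>_lip[of v u] that by (cases "u \<le> v") (auto simp: abs_minus_commute)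
  have "(\<lambda>n. lip * \<bar>y n - z\<bar>) \<longlonglongrightarrow> 0"
    by (rule tendsto_mult_right_zero[OF tendsto_rabs_zero[OF LIM_zero[OF y(4)]]])
  moreover have "\<forall>\<^sub>F n in sequentially. norm (\<phi> (y n) - \<phi> z) \<le> lip * \<bar>y n - z\<bar>"
    using le y by (intro always_eventually) auto
  ultimately have "(\<lambda>n. \<phi> (y n) - \<phi> z) \<longlonglongrightarrow> 0" by (rule Lim_null_comparison[rotated])
  then show "(\<lambda>n. \<phi> (y n)) \<longlonglongrightarrow> \<phi> z" by (rule LIM_zero_cancel)
next
  show "\<bar>\<phi> x\<bar> \<le> M + 1" for x using \<phi>_bound[of x] by simp
qed (rule \<phi>_U)

lemma nice_pair:
  assumes "nice p" "nice q" "adm \<beta>"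
  shows "(\<lambda>x. p (seqT \<beta> a x) * q (seqT \<beta> b x)) \<in> borel_measurable U"
    "\<bar>p x * q y\<bar> \<le> (M + 1)\<^sup>2"
proof -
  have p: "p \<in> borel_measurable U" "\<And>x. \<bar>p x\<bar> \<le> M + 1" and q: "q \<in> borel_measurable U" "\<And>x. \<bar>q x\<bar> \<le> M + 1"
    using assms by (auto simp: nice_def)
  show "(\<lambda>x. p (seqT \<beta> a x) * q (seqT \<beta> b x)) \<in> borel_measurable U"
    by (intro borel_measurable_times measurable_compose[OF seqT_measurable[OF assms(3)]] p q)
  show "\<bar>p x * q y\<bar> \<le> (M + 1)\<^sup>2"
    unfolding abs_mult power2_eq_square using p(2) q(2) M_nonneg by (intro mult_mono) auto
qed

text \<open>Uniformity over all sequences comes by contradiction: counterexamples for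
  \<open>\<epsilon>\<close> tending to 0 have orbits converging almost everywhere, and dominated
  convergence applies. The weight \<open>X\<close> is included because cone densities are bounded by
  multiples of it.\<close>

lemma orbit_pair_close:
  assumes p: "nice p" and q: "nice q" and \<eta>: "0 < \<eta>"
  shows "\<exists>\<epsilon>>0. \<forall>\<beta>. adm \<beta> \<longrightarrow> (\<forall>k\<ge>1. \<bar>\<beta> k - \<gamma>\<bar> < \<epsilon>) \<longrightarrow>
    (\<integral>x. \<bar>p (seqT \<beta> a x) * q (seqT \<beta> b x) - p (Tk a x) * q (Tk b x)\<bar> * X x \<partial>U) \<le> \<eta>"
proof (rule ccontr)
  assume "\<not> ?thesis"
  then have neg: "\<exists>\<beta>. adm \<beta> \<and> (\<forall>k\<ge>1. \<bar>\<beta> k - \<gamma>\<bar> < \<epsilon>) \<and>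
    \<eta> < (\<integral>x. \<bar>p (seqT \<beta> a x) * q (seqT \<beta> b x) - p (Tk a x) * q (Tk b x)\<bar> * X x \<partial>U)" if "0 < \<epsilon>" for \<epsilon>
    using that by (auto simp: not_le)
  have "\<forall>n. \<exists>\<beta>. adm \<beta> \<and> (\<forall>k\<ge>1. \<bar>\<beta> k - \<gamma>\<bar> < inverse (real (Suc n))) \<and>
    \<eta> < (\<integral>x. \<bar>p (seqT \<beta> a x) * q (seqT \<beta> b x) - p (Tk a x) * q (Tk b x)\<bar> * X x \<partial>U)"
    by (intro allI neg) simp
  from choice[OF this]
  obtain B where B: "\<And>n. adm (B n)" "\<And>n k. 1 \<le> k \<Longrightarrow> \<bar>B n k - \<gamma>\<bar> < inverse (real (Suc n))"
    "\<And>n. \<eta> < (\<integral>x. \<bar>p (seqT (B n) a x) * q (seqT (B n) b x) - p (Tk a x) * q (Tk b x)\<bar> * X x \<partial>U)"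
    by blast
  have Bl: "(\<lambda>n. B n k) \<longlonglongrightarrow> \<gamma>" if "1 \<le> k" for k
  proof (rule LIM_zero_cancel, rule tendsto_rabs_zero_cancel, rule tendsto_sandwich[OF _ _ tendsto_const LIMSEQ_inverse_real_of_nat])
    show "\<forall>\<^sub>F n in sequentially. \<bar>B n k - \<gamma>\<bar> \<le> inverse (real (Suc n))"
      using B(2)[OF that] by (auto intro!: always_eventually less_imp_le)
  qed auto
  have "(\<lambda>n. \<integral>x. \<bar>p (seqT (B n) a x) * q (seqT (B n) b x) - p (Tk a x) * q (Tk b x)\<bar> * X x \<partial>U) \<longlonglongrightarrow> (\<integral>x. 0 \<partial>U)"
  proof (rule integral_dominated_convergence[where w = "\<lambda>x. 2 * (M + 1)\<^sup>2 * X x" and f = "\<lambda>_. 0"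
      and s = "\<lambda>n x. \<bar>p (seqT (B n) a x) * q (seqT (B n) b x) - p (Tk a x) * q (Tk b x)\<bar> * X x"])
    show "(\<lambda>x. \<bar>p (seqT (B n) a x) * q (seqT (B n) b x) - p (Tk a x) * q (Tk b x)\<bar> * X x) \<in> borel_measurable U" for n
      by (rule borel_measurable_times[OF borel_measurable_abs[OF borel_measurable_diff[OF nice_pair(1)[OF p q B(1)] nice_pair(1)[OF p q adm_const]]]
            borel_measurable_integrable[OF X_integral(1)]])
    show "integrable U (\<lambda>x. 2 * (M + 1)\<^sup>2 * X x)" using X_integral(1) by (rule integrable_mult_right)
    show "AE x in U. norm (\<bar>p (seqT (B n) a x) * q (seqT (B n) b x) - p (Tk a x) * q (Tk b x)\<bar> * X x) \<le> 2 * (M + 1)\<^sup>2 * X x" for n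
    proof (rule AE_I2)
      fix x
      have "\<bar>p (seqT (B n) a x) * q (seqT (B n) b x) - p (Tk a x) * q (Tk b x)\<bar> \<le> 2 * (M + 1)\<^sup>2"
        using nice_pair(2)[OF p q adm_const, of "seqT (B n) a x" "seqT (B n) b x"] nice_pair(2)[OF p q adm_const, of "Tk a x" "Tk b x"]
        by linarith
      then show "norm (\<bar>p (seqT (B n) a x) * q (seqT (B n) b x) - p (Tk a x) * q (Tk b x)\<bar> * X x) \<le> 2 * (M + 1)\<^sup>2 * X x"
        by (simp add: abs_mult mult_right_mono)
    qed
    show "AE x in U. (\<lambda>n. \<bar>p (seqT (B n) a x) * q (seqT (B n) b x) - p (Tk a x) * q (Tk b x)\<bar> * X x) \<longlonglongrightarrow> 0"
      using orbit_avoids_half AE_space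
    proof eventually_elim
      case (elim x)
      then have x: "0 < x" "x \<le> 1" by auto
      have T: "(\<lambda>n. seqT (B n) k x) \<longlonglongrightarrow> Tk k x" for k
        by (rule orbit_tendsto[OF Bl x]) (use elim in auto)
      have pq: "(\<lambda>n. p (seqT (B n) a x)) \<longlonglongrightarrow> p (Tk a x)" "(\<lambda>n. q (seqT (B n) b x)) \<longlonglongrightarrow> q (Tk b x)"
        using seqT_in[OF B(1) x] seqT_in[OF adm_const x] by (auto intro!: nice_tendsto[OF p] nice_tendsto[OF q] T)
      have "(\<lambda>n. p (seqT (B n) a x) * q (seqT (B n) b x) - p (Tk a x) * q (Tk b x)) \<longlonglongrightarrow> 0"
        by (rule LIM_zero[OF tendsto_mult[OF pq]])
      from tendsto_mult_left_zero[OF tendsto_rabs_zero[OF this]] show ?case .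
    qed
  qed simp
  then have "\<eta> \<le> (\<integral>x. 0 \<partial>U)" by (rule LIMSEQ_le_const) (use B(3) in \<open>auto intro: less_imp_le\<close>)
  then show False using \<eta> by simp
qed

text \<open>A window of fixed length \<open>k\<close> is placed before time \<open>i\<close>. In it
  the given exponents are replaced by the constant one, and \<open>k\<close> is so large that the
  stationary operator brings any cone density close to \<open>h\<close>.\<close>

lemma correlation_close:
  assumes p: "nice p" and q: "nice q" and \<eta>: "0 < \<eta>"
  shows "\<exists>\<epsilon>>0. \<exists>k. \<forall>\<beta>. adm \<beta> \<longrightarrow> (\<forall>j\<ge>1. \<bar>\<beta> j - \<gamma>\<bar> < \<epsilon>) \<longrightarrow> (\<forall>i\<ge>k.
    \<bar>(\<integral>x. p (seqT \<beta> i x) * q (seqT \<beta> (i + d) x) \<partial>U) - (\<integral>x. p x * q (Tk d x) * h x \<partial>U)\<bar> \<le> \<eta>)"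
proof -
  define B where "B = (M + 1)\<^sup>2"
  have B: "0 < B" using M_nonneg by (simp add: B_def)
  have "(\<lambda>k. B * (C / real (Suc k) ^ 4)) \<longlonglongrightarrow> 0"
    by (rule tendsto_mult_right_zero[OF summable_LIMSEQ_zero[OF summable_inverse_4]])
  from order_tendstoD(2)[OF this half_gt_zero[OF \<eta>]]
  obtain k where k: "B * (C / real (Suc k) ^ 4) < \<eta> / 2" by (meson eventually_sequentially order_refl)
  \<comment> \<open>A cone density of mass 1 is at most \<open>12 * X\<close>, so
    \<open>\<eta> / 24\<close> here costs half of \<open>\<eta>\<close>; the other half is spent on
    the distance to \<open>h\<close>.\<close>
  obtain \<epsilon> where \<epsilon>: "0 < \<epsilon>" "\<And>\<beta>. adm \<beta> \<Longrightarrow> (\<forall>k\<ge>1. \<bar>\<beta> k - \<gamma>\<bar> < \<epsilon>) \<Longrightarrow>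
    (\<integral>x. \<bar>p (seqT \<beta> k x) * q (seqT \<beta> (k + d) x) - p (Tk k x) * q (Tk (k + d) x)\<bar> * X x \<partial>U) \<le> \<eta> / 24"
  proof -
    have "0 < \<eta> / 24" using \<eta> by simp
    from orbit_pair_close[OF p q this, of k "k + d"] show ?thesis using that by blast
  qed
  have "\<bar>(\<integral>x. p (seqT \<beta> i x) * q (seqT \<beta> (i + d) x) \<partial>U) - (\<integral>x. p x * q (Tk d x) * h x \<partial>U)\<bar> \<le> \<eta>"
    if \<beta>: "adm \<beta>" "\<forall>k\<ge>1. \<bar>\<beta> k - \<gamma>\<bar> < \<epsilon>" and i: "k \<le> i" for \<beta> i
  proof -
    \<comment> \<open>Everything before the window enters only through \<open>f\<close>, a cone
      density whatever the earlier exponents were; hence a bound uniform in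
      \<open>i\<close>.\<close>
    define j where "j = i - k"
    define \<beta>' where "\<beta>' = sh j \<beta>"
    have \<beta>': "adm \<beta>'" "\<forall>k\<ge>1. \<bar>\<beta>' k - \<gamma>\<bar> < \<epsilon>" using adm_sh[OF \<beta>(1)] \<beta>(2) by (auto simp: \<beta>'_def sh_def)
    define f where "f = PP \<beta> j (\<lambda>_. 1::real)"
    have f: "K 12 f" "(\<integral>x. f x \<partial>U) = 1"
      using PP_K[OF \<beta>(1) _ K_one] PP_integrable(2)[OF \<beta>(1), of "\<lambda>_. 1::real"] U.prob_space by (auto simp: f_def)
    note fi = K_integrable[OF f(1)]
    let ?Q = "\<lambda>x. p (seqT \<beta>' k x) * q (seqT \<beta>' (k + d) x)"
    let ?R = "\<lambda>x. p (Tk k x) * q (Tk (k + d) x)"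
    let ?S = "\<lambda>x. p x * q (Tk d x)"
    have Q: "?Q \<in> borel_measurable U" by (rule nice_pair(1)[OF p q \<beta>'(1)])
    have R: "?R \<in> borel_measurable U" by (rule nice_pair(1)[OF p q adm_const])
    have S: "?S \<in> borel_measurable U" using nice_pair(1)[OF p q adm_const, of 0 d] by simp
    have bd: "\<bar>p x * q y\<bar> \<le> B" for x y unfolding B_def by (rule nice_pair(2)[OF p q adm_const])
    have 1: "(\<integral>x. p (seqT \<beta> i x) * q (seqT \<beta> (i + d) x) \<partial>U) = (\<integral>x. ?Q x * f x \<partial>U)"
    proof -
      have "i = j + k" "i + d = j + (k + d)" using i by (auto simp: j_def)
      then have "(\<integral>x. p (seqT \<beta> i x) * q (seqT \<beta> (i + d) x) \<partial>U) = (\<integral>x. ?Q (seqT \<beta> j x) \<partial>U)"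
        by (simp only: seqT_plus \<beta>'_def)
      also have "\<dots> = (\<integral>x. ?Q x * f x \<partial>U)"
        unfolding f_def by (rule integral_density_form[OF \<beta>(1) Q]) (rule bd)
      finally show ?thesis .
    qed
    have iQ: "integrable U (\<lambda>x. ?Q x * f x)" by (rule integral_mult_bound(1)[OF fi Q, of B]) (simp add: bd)
    have iR: "integrable U (\<lambda>x. ?R x * f x)" by (rule integral_mult_bound(1)[OF fi R, of B]) (simp add: bd)
    have iX: "integrable U (\<lambda>x. \<bar>?Q x - ?R x\<bar> * X x)"
    proof (rule integral_mult_bound(1)[OF X_integral(1), of _ "2 * B"])
      show "(\<lambda>x. \<bar>?Q x - ?R x\<bar>) \<in> borel_measurable U" using Q R by auto
      fix x show "norm \<bar>?Q x - ?R x\<bar> \<le> 2 * B"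
        using bd[of "seqT \<beta>' k x" "seqT \<beta>' (k + d) x"] bd[of "Tk k x" "Tk (k + d) x"] unfolding real_norm_def by linarith
    qed
    have 2: "\<bar>(\<integral>x. ?Q x * f x \<partial>U) - (\<integral>x. ?R x * f x \<partial>U)\<bar> \<le> \<eta> / 2"
    proof -
      have e: "(\<integral>x. ?Q x * f x \<partial>U) - (\<integral>x. ?R x * f x \<partial>U) = (\<integral>x. ?Q x * f x - ?R x * f x \<partial>U)" using iQ iR by simp
      have "\<bar>\<integral>x. ?Q x * f x - ?R x * f x \<partial>U\<bar> \<le> (\<integral>x. 12 * (\<bar>?Q x - ?R x\<bar> * X x) \<partial>U)"
      proof (rule order.trans[OF integral_abs_bound integral_mono])
        show "integrable U (\<lambda>x. \<bar>?Q x * f x - ?R x * f x\<bar>)" using iQ iR by auto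
        show "integrable U (\<lambda>x. 12 * (\<bar>?Q x - ?R x\<bar> * X x))" using iX by (rule integrable_mult_right)
        fix x assume "x \<in> space U"
        then have fx: "0 \<le> f x" "f x \<le> 12 * X x" using KD(2,3)[OF f(1), of x] f(2) by auto
        have "\<bar>?Q x * f x - ?R x * f x\<bar> = \<bar>?Q x - ?R x\<bar> * f x"
          using fx by (simp add: left_diff_distrib[symmetric] abs_mult)
        also have "\<dots> \<le> \<bar>?Q x - ?R x\<bar> * (12 * X x)" using fx by (intro mult_left_mono) auto
        finally show "\<bar>?Q x * f x - ?R x * f x\<bar> \<le> 12 * (\<bar>?Q x - ?R x\<bar> * X x)" by (simp add: mult_ac)
      qed
      also have "\<dots> \<le> 12 * (\<eta> / 24)"
        unfolding integral_mult_right_zero by (rule mult_left_mono[OF \<epsilon>(2)[OF \<beta>']]) simp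
      finally show ?thesis unfolding e by simp
    qed
    have 3: "(\<integral>x. ?R x * f x \<partial>U) = (\<integral>x. ?S x * P k f x \<partial>U)"
    proof -
      have "Tk (k + d) x = Tk d (Tk k x)" for x by (simp only: seqT_plus sh_def[abs_def])
      then have "(\<integral>x. ?R x * f x \<partial>U) = (\<integral>x. ?S (Tk k x) * f x \<partial>U)" by (simp only:)
      also have "\<dots> = (\<integral>x. ?S x * P k f x \<partial>U)"
        by (rule PP_duality(3)[OF adm_const fi S, of B, symmetric]) (simp add: bd)
      finally show ?thesis .
    qed
    have 4: "\<bar>(\<integral>x. ?S x * P k f x \<partial>U) - (\<integral>x. ?S x * h x \<partial>U)\<bar> \<le> \<eta> / 2"
    proof -
      have Pi: "integrable U (P k f)" by (rule PP_integrable(1)[OF adm_const fi])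
      have i: "integrable U (\<lambda>x. ?S x * P k f x)" "integrable U (\<lambda>x. ?S x * h x)"
        by (rule integral_mult_bound(1)[OF Pi S, of B], simp add: bd)
           (rule integral_mult_bound(1)[OF h_int S, of B], simp add: bd)
      have e: "(\<integral>x. ?S x * P k f x \<partial>U) - (\<integral>x. ?S x * h x \<partial>U) = (\<integral>x. ?S x * (P k f x - h x) \<partial>U)"
        using i by (simp add: right_diff_distrib)
      have "\<bar>\<integral>x. ?S x * (P k f x - h x) \<partial>U\<bar> \<le> B * (\<integral>x. \<bar>P k f x - h x\<bar> \<partial>U)"
        using integral_mult_bound(2)[of "\<lambda>x. P k f x - h x" ?S B] Pi h_int S bd by simp
      also have "\<dots> \<le> B * (C / real (Suc k) ^ 4)" using h_rate[OF f] B by (intro mult_left_mono) auto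
      finally show ?thesis unfolding e using k by linarith
    qed
    show ?thesis using 1 2 3 4 by linarith
  qed
  then show ?thesis using \<epsilon>(1) by blast
qed

lemma cov_close:
  assumes \<eta>: "0 < \<eta>"
  shows "\<exists>\<epsilon>>0. \<exists>k. \<forall>\<beta>. adm \<beta> \<longrightarrow> (\<forall>j\<ge>1. \<bar>\<beta> j - \<gamma>\<bar> < \<epsilon>) \<longrightarrow> (\<forall>i\<ge>k. \<bar>cov \<beta> i (i + d) - \<rho> d\<bar> \<le> \<eta>)"
proof -
  \<comment> \<open>The difference of the products of means consists of two terms of size at most
    \<open>(M + 1) * \<delta>\<close>, each of which is \<open>\<eta> / 4\<close>.\<close>
  define \<delta> where "\<delta> = \<eta> / (4 * (M + 1))"
  have \<delta>: "0 < \<delta>" using \<eta> M_nonneg by (simp add: \<delta>_def)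
  obtain \<epsilon>1 k1 where 1: "0 < \<epsilon>1" "\<And>\<beta> i. adm \<beta> \<Longrightarrow> (\<forall>j\<ge>1. \<bar>\<beta> j - \<gamma>\<bar> < \<epsilon>1) \<Longrightarrow> k1 \<le> i \<Longrightarrow>
    \<bar>(\<integral>x. \<phi> (seqT \<beta> i x) * \<phi> (seqT \<beta> (i + d) x) \<partial>U) - (\<integral>x. \<phi> x * \<phi> (Tk d x) * h x \<partial>U)\<bar> \<le> \<eta> / 2"
    using correlation_close[OF nice_\<phi> nice_\<phi> half_gt_zero[OF \<eta>], of d] by blast
  obtain \<epsilon>2 k2 where 2: "0 < \<epsilon>2" "\<And>\<beta> i. adm \<beta> \<Longrightarrow> (\<forall>j\<ge>1. \<bar>\<beta> j - \<gamma>\<bar> < \<epsilon>2) \<Longrightarrow> k2 \<le> i \<Longrightarrow>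
    \<bar>(\<integral>x. \<phi> (seqT \<beta> i x) * 1 \<partial>U) - (\<integral>x. \<phi> x * 1 * h x \<partial>U)\<bar> \<le> \<delta>"
    using correlation_close[OF nice_\<phi> nice_one \<delta>] by blast
  have m: "\<bar>mean \<beta> i - c0\<bar> \<le> \<delta>" if "adm \<beta>" "\<forall>j\<ge>1. \<bar>\<beta> j - \<gamma>\<bar> < \<epsilon>2" "k2 \<le> i" for \<beta> i
    using 2(2)[OF that] by (simp add: mean_def c0_def)
  have "\<bar>cov \<beta> i (i + d) - \<rho> d\<bar> \<le> \<eta>"
    if \<beta>: "adm \<beta>" and near: "\<forall>j\<ge>1. \<bar>\<beta> j - \<gamma>\<bar> < min \<epsilon>1 \<epsilon>2" and i: "max k1 k2 \<le> i" for \<beta> i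
  proof -
    have a: "\<bar>(\<integral>x. \<phi> (seqT \<beta> i x) * \<phi> (seqT \<beta> (i + d) x) \<partial>U) - (\<integral>x. \<phi> x * \<phi> (Tk d x) * h x \<partial>U)\<bar> \<le> \<eta> / 2"
      using 1(2)[OF \<beta>] near i by auto
    have b: "\<bar>mean \<beta> i - c0\<bar> \<le> \<delta>" "\<bar>mean \<beta> (i + d) - c0\<bar> \<le> \<delta>" using m[OF \<beta>] near i by auto
    have e: "mean \<beta> i * mean \<beta> (i + d) - c0 * c0 = mean \<beta> i * (mean \<beta> (i + d) - c0) + c0 * (mean \<beta> i - c0)"
      by (simp add: algebra_simps)
    have "\<bar>mean \<beta> i * (mean \<beta> (i + d) - c0) + c0 * (mean \<beta> i - c0)\<bar> \<le> \<bar>mean \<beta> i\<bar> * \<bar>mean \<beta> (i + d) - c0\<bar> + \<bar>c0\<bar> * \<bar>mean \<beta> i - c0\<bar>"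
      by (simp add: abs_mult[symmetric])
    also have "\<dots> \<le> (M + 1) * \<delta> + (M + 1) * \<delta>"
      using mean_le[OF \<beta>, of i] c0_bound b M_nonneg by (intro add_mono mult_mono) auto
    also have "\<dots> = \<eta> / 2"
    proof -
      have "M + 1 \<noteq> 0" using M_nonneg by linarith
      moreover have "b * (\<eta> / (4 * b)) = \<eta> / 4" if "b \<noteq> 0" for b :: real using that by simp
      ultimately have "(M + 1) * \<delta> = \<eta> / 4" unfolding \<delta>_def by blast
      then show ?thesis by linarith
    qed
    finally have "\<bar>mean \<beta> i * mean \<beta> (i + d) - c0 * c0\<bar> \<le> \<eta> / 2" unfolding e .
    moreover have "(\<integral>x. \<phi> x * \<phi> (Tk d x) * h x \<partial>U) = (\<integral>x. \<phi> (Tk d x) * (\<phi> x * h x) \<partial>U)"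
      by (simp add: mult_ac)
    ultimately show ?thesis using a unfolding cov_def \<rho>_eq by linarith
  qed
  then show ?thesis using 1(1) 2(1) by (intro exI[of _ "min \<epsilon>1 \<epsilon>2"] conjI exI[of _ "max k1 k2"]) auto
qed

lemma cov_close_upto:
  assumes \<eta>: "0 < \<eta>"
  shows "\<exists>\<epsilon>>0. \<exists>k. \<forall>\<beta>. adm \<beta> \<longrightarrow> (\<forall>j\<ge>1. \<bar>\<beta> j - \<gamma>\<bar> < \<epsilon>) \<longrightarrow> (\<forall>i\<ge>k. \<forall>d\<le>L. \<bar>cov \<beta> i (i + d) - \<rho> d\<bar> \<le> \<eta>)"
proof (induction L)
  case 0
  then show ?case using cov_close[OF \<eta>, of 0] by auto
next
  case (Suc L)
  obtain \<epsilon>1 k1 where 1: "0 < \<epsilon>1" "\<And>\<beta> i d. adm \<beta> \<Longrightarrow> (\<forall>j\<ge>1. \<bar>\<beta> j - \<gamma>\<bar> < \<epsilon>1) \<Longrightarrow> k1 \<le> i \<Longrightarrow> d \<le> L \<Longrightarrow> \<bar>cov \<beta> i (i + d) - \<rho> d\<bar> \<le> \<eta>"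
    using Suc by blast
  obtain \<epsilon>2 k2 where 2: "0 < \<epsilon>2" "\<And>\<beta> i. adm \<beta> \<Longrightarrow> (\<forall>j\<ge>1. \<bar>\<beta> j - \<gamma>\<bar> < \<epsilon>2) \<Longrightarrow> k2 \<le> i \<Longrightarrow> \<bar>cov \<beta> i (i + Suc L) - \<rho> (Suc L)\<bar> \<le> \<eta>"
    using cov_close[OF \<eta>, of "Suc L"] by blast
  show ?case
  proof (intro exI[of _ "min \<epsilon>1 \<epsilon>2"] conjI exI[of _ "max k1 k2"] allI impI)
    fix \<beta> i d assume a: "adm \<beta>" "\<forall>j\<ge>1. \<bar>\<beta> j - \<gamma>\<bar> < min \<epsilon>1 \<epsilon>2" "max k1 k2 \<le> i" "d \<le> Suc L"
    show "\<bar>cov \<beta> i (i + d) - \<rho> d\<bar> \<le> \<eta>"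
    proof (cases "d \<le> L")
      case True then show ?thesis using 1(2)[OF a(1), of i d] a by auto
    next
      case False
      then have "d = Suc L" using a by simp
      then show ?thesis using 2(2)[OF a(1), of i] a by auto
    qed
  qed (use 1 2 in auto)
qed

text \<open>The order of choices matters: the cut-off \<open>L\<close> comes from tails that are
  uniform over admissible sequences, then \<open>\<eta>\<close> depends on \<open>L\<close>, and
  only then is the closeness \<open>\<epsilon>\<close> of the exponents fixed.\<close>

lemma variance_growth:
  assumes V: "0 < Vlim"
  shows "\<exists>\<epsilon>>0. \<forall>\<beta>. adm \<beta> \<longrightarrow> (\<forall>j\<ge>1. \<bar>\<beta> j - \<gamma>\<bar> < \<epsilon>) \<longrightarrow>
    (\<exists>N. \<forall>n\<ge>N. Vlim / 2 * real n \<le> (\<Sum>i=1..n. \<Sum>j=1..n. cov \<beta> i j))"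
proof -
  obtain D where D: "0 < D" "\<And>\<beta> i d. adm \<beta> \<Longrightarrow> \<bar>cov \<beta> i (i + d)\<bar> \<le> D / real (Suc d) ^ 4"
    using cov_decay by blast
  define r where "r d = D / real (Suc d) ^ 4" for d
  have r: "summable r" unfolding r_def by (rule summable_inverse_4)
  have tail: "\<forall>\<^sub>F L in sequentially. (\<Sum>d. f (d + Suc L)) < Vlim / 16" if "summable f" for f :: "nat \<Rightarrow> real"
  proof -
    have "(\<lambda>L. \<Sum>d. f (d + L)) \<longlonglongrightarrow> 0" using suminf_exist_split2[OF that] .
    then have "(\<lambda>L. \<Sum>d. f (d + Suc L)) \<longlonglongrightarrow> 0" by (rule LIMSEQ_Suc)
    then show ?thesis by (rule order_tendstoD(2)) (use V in simp)
  qed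
  from eventually_conj[OF tail[OF r] tail[OF \<rho>_summable]]
  obtain L where L: "(\<Sum>d. r (d + Suc L)) < Vlim / 16" "(\<Sum>d. \<bar>\<rho> (d + Suc L)\<bar>) < Vlim / 16"
    by (auto simp: eventually_sequentially)
  define \<eta> where "\<eta> = Vlim / (8 * (2 * real L + 1))"
  have \<eta>: "0 < \<eta>" "(2 * real L + 1) * \<eta> \<le> Vlim / 8" using V by (auto simp: \<eta>_def field_simps)
  obtain \<epsilon> k where \<epsilon>: "0 < \<epsilon>" "\<And>\<beta> i d. adm \<beta> \<Longrightarrow> (\<forall>j\<ge>1. \<bar>\<beta> j - \<gamma>\<bar> < \<epsilon>) \<Longrightarrow> k \<le> i \<Longrightarrow> d \<le> L \<Longrightarrow> \<bar>cov \<beta> i (i + d) - \<rho> d\<bar> \<le> \<eta>"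
    using cov_close_upto[OF \<eta>(1), of L] by blast
  have "\<exists>N. \<forall>n\<ge>N. Vlim / 2 * real n \<le> (\<Sum>i=1..n. \<Sum>j=1..n. cov \<beta> i j)"
    if \<beta>: "adm \<beta>" "\<forall>j\<ge>1. \<bar>\<beta> j - \<gamma>\<bar> < \<epsilon>" for \<beta>
    by (rule double_sum_lower[of "cov \<beta>" r \<rho> Vlim k L \<eta>])
       (use cov_sym D(2)[OF \<beta>(1)] r \<rho>_summable V \<epsilon>(2)[OF \<beta>] L \<eta> in \<open>auto simp: r_def Vlim_def\<close>)
  then show ?thesis using \<epsilon>(1) by blast
qed

end

section \<open>The central limit theorem by Bernstein blocks\<close>

lemma norm_integral_le_one_U:
  fixes f :: "real \<Rightarrow> 'a::{banach, second_countable_topology}"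
  assumes "f \<in> borel_measurable U" "\<And>x. norm (f x) \<le> 1"
  shows "integrable U f" "norm (\<integral>x. f x \<partial>U) \<le> 1"
proof -
  show i: "integrable U f"
    by (rule Bochner_Integration.integrable_bound[of _ "\<lambda>_. 1::real"]) (use assms in auto)
  have "norm (\<integral>x. f x \<partial>U) \<le> (\<integral>x. norm (f x) \<partial>U)" by (rule integral_norm_bound)
  also have "\<dots> \<le> (\<integral>x. 1 \<partial>U)" by (rule integral_mono) (use i assms in auto)
  finally show "norm (\<integral>x. f x \<partial>U) \<le> 1" using U.prob_space by simp
qed

lemma integrable_bounded_U:
  fixes f :: "real \<Rightarrow> real"
  assumes "f \<in> borel_measurable U" "\<And>x. \<bar>f x\<bar> \<le> B"
  shows "integrable U f"
  by (rule Bochner_Integration.integrable_bound[of _ "\<lambda>_. B"]) (use assms in \<open>auto intro: order.trans[OF _ abs_ge_self]\<close>)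

lemma L1_le_L2_U:
  fixes f :: "real \<Rightarrow> real"
  assumes "f \<in> borel_measurable U" "\<And>x. \<bar>f x\<bar> \<le> B"
  shows "(\<integral>x. \<bar>f x\<bar> \<partial>U) \<le> sqrt (\<integral>x. (f x)\<^sup>2 \<partial>U)"
proof -
  have i1: "integrable U (\<lambda>x. \<bar>f x\<bar>)" using integrable_bounded_U[OF assms] by auto
  have i2: "integrable U (\<lambda>x. (f x)\<^sup>2)"
    by (rule integrable_bounded_U[of _ "B\<^sup>2"]) (use assms in \<open>auto simp: abs_le_square_iff[symmetric] intro: order.trans[OF _ abs_ge_self]\<close>)
  define J where "J = (\<integral>x. \<bar>f x\<bar> \<partial>U)"
  have "0 \<le> (\<integral>x. (\<bar>f x\<bar> - J)\<^sup>2 \<partial>U)" by (rule Bochner_Integration.integral_nonneg) simp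
  also have "\<dots> = (\<integral>x. (f x)\<^sup>2 - 2 * J * \<bar>f x\<bar> + J\<^sup>2 \<partial>U)"
    by (rule Bochner_Integration.integral_cong) (auto simp: power2_eq_square algebra_simps)
  also have "\<dots> = (\<integral>x. (f x)\<^sup>2 \<partial>U) - J\<^sup>2"
    using i1 i2 U.prob_space by (simp add: J_def[symmetric] power2_eq_square)
  finally show ?thesis unfolding J_def[symmetric] by (simp add: real_le_rsqrt)
qed

lemma exp_minus_quadratic:
  assumes "0 \<le> (y::real)"
  shows "\<bar>1 - y - exp (- y)\<bar> \<le> y\<^sup>2"
proof -
  have "1 - y \<le> exp (- y)" using exp_ge_add_one_self[of "- y"] by simp
  moreover have "exp (- y) \<le> 1 - y + y\<^sup>2"
  proof -
    have "exp (- y) \<le> 1 / (1 + y)"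
      using exp_ge_add_one_self[of y] assms by (simp add: exp_minus divide_inverse le_imp_inverse_le)
    also have "\<dots> \<le> 1 - y + y\<^sup>2"
    proof -
      have "(1 - y + y\<^sup>2) * (1 + y) = 1 + y * y * y" by (simp add: power2_eq_square algebra_simps)
      then have "1 \<le> (1 - y + y\<^sup>2) * (1 + y)" using assms by simp
      moreover have "0 < 1 + y" using assms by simp
      ultimately show ?thesis by (subst pos_divide_le_eq)
    qed
    finally show ?thesis .
  qed
  ultimately show ?thesis by auto
qed

lemma exp_minus_lipschitz:
  assumes "0 \<le> (x::real)" "0 \<le> y"
  shows "\<bar>exp (- x) - exp (- y)\<bar> \<le> \<bar>x - y\<bar>"
proof -
  have *: "exp (- a) - exp (- b) \<le> b - a" if "0 \<le> a" "a \<le> b" for a b :: real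
  proof -
    have "exp (- a) - exp (- b) = exp (- a) * (1 - exp (- (b - a)))" by (simp add: algebra_simps exp_add[symmetric])
    also have "\<dots> \<le> 1 * (b - a)"
    proof (rule mult_mono)
      show "1 - exp (- (b - a)) \<le> b - a" using exp_ge_add_one_self[of "- (b - a)"] by linarith
    qed (use that in auto)
    finally show ?thesis by simp
  qed
  show ?thesis using *[of x y] *[of y x] assms by (cases "x \<le> y") auto
qed

lemma cis_taylor: "norm (cis y - (1 + \<i> * of_real y - of_real (y\<^sup>2 / 2))) \<le> \<bar>y\<bar> ^ 3 / 6"
proof -
  have e: "(\<Sum>k\<le>2. (\<i> * complex_of_real y) ^ k / fact k) = 1 + \<i> * of_real y - of_real (y\<^sup>2 / 2)"
  proof -
    have "(\<Sum>k\<le>2. f k) = f 0 + f 1 + f 2" for f :: "nat \<Rightarrow> complex" by (simp add: numeral_2_eq_2)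
    then show ?thesis by (simp add: power_mult_distrib)
  qed
  show ?thesis using iexp_approx1[of y 2] unfolding e by (simp add: cis_conv_exp fact_numeral eval_nat_numeral)
qed

lemma cis_measurable_U: "f \<in> borel_measurable U \<Longrightarrow> (\<lambda>x. cis (f x)) \<in> borel_measurable U"
  by (rule measurable_compose[where g = cis]) (auto intro!: borel_measurable_continuous_onI continuous_intros)

context lsv_obs
begin

definition Y :: "(nat \<Rightarrow> real) \<Rightarrow> nat set \<Rightarrow> real \<Rightarrow> real" where
  "Y \<beta> Q x = (\<Sum>k\<in>Q. \<phi> (seqT \<beta> k x) - mean \<beta> k)"

definition vr :: "(nat \<Rightarrow> real) \<Rightarrow> nat set \<Rightarrow> real" where
  "vr \<beta> Q = (\<integral>x. (Y \<beta> Q x)\<^sup>2 \<partial>U)"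

lemma term_bound: "adm \<beta> \<Longrightarrow> \<bar>\<phi> y - mean \<beta> k\<bar> \<le> 2 * M"
  using \<phi>_bound[of y] mean_le[of \<beta> k] by linarith

lemma Y_bound: "adm \<beta> \<Longrightarrow> \<bar>Y \<beta> Q x\<bar> \<le> 2 * M * real (card Q)"
proof -
  assume "adm \<beta>"
  then have "\<bar>Y \<beta> Q x\<bar> \<le> (\<Sum>k\<in>Q. 2 * M)"
    unfolding Y_def by (intro order.trans[OF sum_abs sum_mono] term_bound)
  then show ?thesis by (simp add: mult.commute)
qed

lemma \<phi>T_measurable: "adm \<beta> \<Longrightarrow> (\<lambda>x. \<phi> (seqT \<beta> k x)) \<in> borel_measurable U"
  by (rule measurable_compose[OF seqT_measurable \<phi>_U])

lemma Y_measurable: "adm \<beta> \<Longrightarrow> Y \<beta> Q \<in> borel_measurable U"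
  unfolding Y_def by (intro borel_measurable_sum borel_measurable_diff \<phi>T_measurable) auto

lemma Y_integral: "adm \<beta> \<Longrightarrow> (\<integral>x. Y \<beta> Q x \<partial>U) = 0"
proof -
  assume \<beta>: "adm \<beta>"
  have i: "integrable U (\<lambda>x. \<phi> (seqT \<beta> k x))" for k
    by (rule integrable_bounded_U[OF \<phi>T_measurable[OF \<beta>]]) (rule \<phi>_bound)
  show ?thesis unfolding Y_def using i U.prob_space by (simp add: mean_def)
qed

lemma vr_eq:
  assumes \<beta>: "adm \<beta>" shows "vr \<beta> Q = (\<Sum>i\<in>Q. \<Sum>j\<in>Q. cov \<beta> i j)"
proof -
  let ?f = "\<lambda>k x. \<phi> (seqT \<beta> k x)"
  have i: "integrable U (?f k)" for k by (rule integrable_bounded_U[OF \<phi>T_measurable[OF \<beta>]]) (rule \<phi>_bound)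
  have ij: "integrable U (\<lambda>x. ?f k x * ?f l x)" for k l
    by (rule integrable_bounded_U[of _ "M * M"])
       (use \<phi>T_measurable[OF \<beta>] \<phi>_bound M_nonneg in \<open>auto simp: abs_mult intro!: mult_mono\<close>)
  have e: "(?f k x - mean \<beta> k) * (?f l x - mean \<beta> l) = ?f k x * ?f l x - mean \<beta> l * ?f k x - mean \<beta> k * ?f l x + mean \<beta> k * mean \<beta> l" for k l x
    by (simp add: algebra_simps)
  have I: "integrable U (\<lambda>x. (?f k x - mean \<beta> k) * (?f l x - mean \<beta> l))" for k l
    unfolding e using i ij by auto
  have c: "(\<integral>x. (?f k x - mean \<beta> k) * (?f l x - mean \<beta> l) \<partial>U) = cov \<beta> k l" for k l
    unfolding e using i ij U.prob_space by (simp add: cov_def mean_def[symmetric])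
  have "vr \<beta> Q = (\<integral>x. (\<Sum>k\<in>Q. \<Sum>l\<in>Q. (?f k x - mean \<beta> k) * (?f l x - mean \<beta> l)) \<partial>U)"
    unfolding vr_def Y_def power2_eq_square by (simp add: sum_product)
  also have "\<dots> = (\<Sum>k\<in>Q. \<Sum>l\<in>Q. cov \<beta> k l)"
    using I by (simp add: c)
  finally show ?thesis .
qed

end

section \<open>Bernstein blocks of length \<open>p\<close> separated by gaps of length
  \<open>q\<close>\<close>

definition blk :: "nat \<Rightarrow> nat \<Rightarrow> nat \<Rightarrow> nat set" where
  "blk p q j = {j * (p + q) + 1 .. j * (p + q) + p}"

lemma blk_far:
  assumes "i \<in> blk p q j" "i' \<in> blk p q j'" "j \<noteq> j'"
  shows "q \<le> (if i \<le> i' then i' - i else i - i')"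
proof -
  have *: "i + q < i'" if "i \<in> blk p q j" "i' \<in> blk p q j'" "j < j'" for i i' j j'
  proof -
    have "Suc j * (p + q) \<le> j' * (p + q)" using that(3) by (intro mult_right_mono) auto
    then show ?thesis using that by (auto simp: blk_def)
  qed
  show ?thesis using *[of i j i' j'] *[of i' j' i j] assms by (cases "j < j'") auto
qed

lemma blk_disjoint: "j \<noteq> j' \<Longrightarrow> blk p q j \<inter> blk p q j' = {}"
proof -
  assume "j \<noteq> j'"
  have *: "i < i'" if "i \<in> blk p q j" "i' \<in> blk p q j'" "j < j'" for i i' j j'
  proof -
    have "Suc j * (p + q) \<le> j' * (p + q)" using that(3) by (intro mult_right_mono) auto
    then show ?thesis using that by (auto simp: blk_def)
  qed
  show ?thesis using *[of _ j _ j'] *[of _ j' _ j] \<open>j \<noteq> j'\<close> by (cases "j < j'") fastforce+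
qed

definition blks :: "nat \<Rightarrow> nat \<Rightarrow> nat \<Rightarrow> nat set" where
  "blks p q m = (\<Union>j<m. blk p q j)"

lemma blks_Suc: "blks p q (Suc m) = blks p q m \<union> blk p q m" "blks p q m \<inter> blk p q m = {}"
proof -
  have "blk p q j \<inter> blk p q m = {}" if "j < m" for j using that by (intro blk_disjoint) simp
  then show "blks p q m \<inter> blk p q m = {}" by (auto simp: blks_def)
qed (auto simp: blks_def lessThan_Suc)

lemma finite_blk [simp]: "finite (blk p q j)" "card (blk p q j) = p"
  by (auto simp: blk_def)

lemma finite_blks [simp]: "finite (blks p q m)"
  by (simp add: blks_def)

lemma card_blks: "card (blks p q m) = m * p"
  by (induction m) (simp_all add: blks_Suc card_Un_disjoint, simp add: blks_def)

lemma sum_blks: "sum f (blks p q m) = (\<Sum>j<m. sum f (blk p q j))"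
  by (induction m) (simp_all add: blks_Suc sum.union_disjoint, simp add: blks_def)

text \<open>The upper end excludes the gap after the last block: exactly \<open>q\<close> free steps
  remain before the next block begins.\<close>

lemma blks_subset: "blks p q (Suc m) \<subseteq> {1..m * (p + q) + p}"
proof -
  have "j * (p + q) + p \<le> m * (p + q) + p" if "j < Suc m" for j using that by (intro add_right_mono mult_right_mono) auto
  then have "blk p q j \<subseteq> {1..m * (p + q) + p}" if "j < Suc m" for j
    using order.trans[of _ "j * (p + q) + p" "m * (p + q) + p"] that unfolding blk_def by (intro subsetI) (simp only: atLeastAtMost_iff, simp)
  then show ?thesis unfolding blks_def by blast
qed

context lsv_obs
begin

text \<open>The constant of \<open>cov_decay\<close>, fixed once so that the bounds derived from it
  are common to all admissible sequences.\<close>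

definition rC :: real where
  "rC = (SOME C. C > 0 \<and> (\<forall>\<beta> i d. adm \<beta> \<longrightarrow> \<bar>cov \<beta> i (i + d)\<bar> \<le> C / real (Suc d) ^ 4))"

definition r :: "nat \<Rightarrow> real" where "r d = rC / real (Suc d) ^ 4"

lemma r: "0 < rC" "adm \<beta> \<Longrightarrow> \<bar>cov \<beta> i (i + d)\<bar> \<le> r d"
  using someI_ex[OF cov_decay] by (auto simp: rC_def r_def)

lemma r_nonneg: "0 \<le> r d" using r(1) by (simp add: r_def)

lemma r_summable: "summable r"
  unfolding r_def by (rule summable_inverse_4)

text \<open>The factor 2 accounts for partners on either side of a given time.\<close>

definition rtail :: "nat \<Rightarrow> real" where "rtail q = 2 * (\<Sum>d. r (d + q))"

lemma rtail_nonneg: "0 \<le> rtail q"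
  unfolding rtail_def using suminf_nonneg[OF summable_ignore_initial_segment[OF r_summable, of q]] r_nonneg by simp

lemma rtail_lim: "rtail \<longlonglongrightarrow> 0"
  unfolding rtail_def by (rule tendsto_mult_right_zero[OF suminf_exist_split2[OF r_summable]])

lemma cov_sum_far:
  assumes \<beta>: "adm \<beta>" and A: "finite A" and far: "\<And>j. j \<in> A \<Longrightarrow> q \<le> (if i \<le> j then j - i else i - j)"
  shows "(\<Sum>j\<in>A. \<bar>cov \<beta> i j\<bar>) \<le> rtail q"
proof -
  have s: "summable (\<lambda>d. r (d + q))" by (rule summable_ignore_initial_segment[OF r_summable])
  have bound: "sum r D \<le> (\<Sum>d. r (d + q))" if "finite D" "\<And>d. d \<in> D \<Longrightarrow> q \<le> d" for D
  proof -
    have "sum r D = (\<Sum>d\<in>(\<lambda>d. d - q) ` D. r (d + q))"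
      by (subst sum.reindex) (use that in \<open>auto simp: inj_on_def intro!: sum.cong\<close>, metis le_add_diff_inverse2)
    also have "\<dots> \<le> (\<Sum>d. r (d + q))" by (rule sum_le_suminf[OF s]) (use that r_nonneg in auto)
    finally show ?thesis .
  qed
  let ?A1 = "{j\<in>A. i \<le> j}" and ?A2 = "{j\<in>A. \<not> i \<le> j}"
  have "(\<Sum>j\<in>A. \<bar>cov \<beta> i j\<bar>) = (\<Sum>j\<in>?A1. \<bar>cov \<beta> i j\<bar>) + (\<Sum>j\<in>?A2. \<bar>cov \<beta> i j\<bar>)"
    using A by (subst sum.union_disjoint[symmetric]) (auto intro!: sum.cong)
  also have "(\<Sum>j\<in>?A1. \<bar>cov \<beta> i j\<bar>) \<le> (\<Sum>j\<in>?A1. r (j - i))"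
  proof (rule sum_mono)
    fix j assume "j \<in> ?A1"
    then show "\<bar>cov \<beta> i j\<bar> \<le> r (j - i)" using r(2)[OF \<beta>, of i "j - i"] by simp
  qed
  also have "(\<Sum>j\<in>?A1. r (j - i)) = sum r ((\<lambda>j. j - i) ` ?A1)"
    by (subst sum.reindex) (auto simp: inj_on_def)
  also have "\<dots> \<le> (\<Sum>d. r (d + q))" using A far by (intro bound) fastforce+
  also have "(\<Sum>j\<in>?A2. \<bar>cov \<beta> i j\<bar>) \<le> (\<Sum>j\<in>?A2. r (i - j))"
  proof (rule sum_mono)
    fix j assume "j \<in> ?A2"
    then show "\<bar>cov \<beta> i j\<bar> \<le> r (i - j)" using r(2)[OF \<beta>, of j "i - j"] cov_sym[of \<beta> i j] by simp
  qed
  also have "(\<Sum>j\<in>?A2. r (i - j)) = sum r ((\<lambda>j. i - j) ` ?A2)"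
    by (subst sum.reindex) (auto simp: inj_on_def)
  also have "\<dots> \<le> (\<Sum>d. r (d + q))" using A far by (intro bound) fastforce+
  finally show ?thesis by (simp add: rtail_def)
qed

definition R :: real where "R = rtail 0"

lemma R_nonneg: "0 \<le> R" by (simp add: R_def rtail_nonneg)

lemma cov_sum_le: "adm \<beta> \<Longrightarrow> finite A \<Longrightarrow> (\<Sum>j\<in>A. \<bar>cov \<beta> i j\<bar>) \<le> R"
  unfolding R_def by (rule cov_sum_far) auto

lemma double_cov_le:
  assumes "adm \<beta>" "finite A" "finite B"
  shows "\<bar>\<Sum>i\<in>A. \<Sum>j\<in>B. cov \<beta> i j\<bar> \<le> R * real (card A)"
proof -
  have "\<bar>\<Sum>i\<in>A. \<Sum>j\<in>B. cov \<beta> i j\<bar> \<le> (\<Sum>i\<in>A. \<Sum>j\<in>B. \<bar>cov \<beta> i j\<bar>)"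
    by (rule order.trans[OF sum_abs sum_mono]) (rule sum_abs)
  also have "\<dots> \<le> (\<Sum>i\<in>A. R)" by (intro sum_mono cov_sum_le assms)
  finally show ?thesis by (simp add: mult.commute)
qed

lemma vr_le: "adm \<beta> \<Longrightarrow> finite A \<Longrightarrow> vr \<beta> A \<le> R * real (card A)"
  using double_cov_le[of \<beta> A A] vr_eq[of \<beta> A] by auto

lemma vr_nonneg: "0 \<le> vr \<beta> A"
  by (simp add: vr_def)

text \<open>Pairs with an index outside the blocks contribute at most \<open>R\<close> per such
  index, once as row and once as column. Pairs from different blocks are at distance at least
  \<open>q\<close>, so each row loses at most \<open>rtail q\<close>.\<close>

lemma block_variance:
  assumes \<beta>: "adm \<beta>" and E: "blks p q m \<subseteq> {1..n}"
  shows "\<bar>vr \<beta> {1..n} - (\<Sum>j<m. vr \<beta> (blk p q j))\<bar> \<le> 2 * R * real (card ({1..n} - blks p q m)) + real n * rtail q"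
proof -
  define E' where "E' = blks p q m"
  define Q where "Q = {1..n} - E'"
  have fin: "finite Q" "finite E'" by (auto simp: Q_def E'_def)
  have split: "sum f {1..n} = sum f Q + sum f E'" for f :: "nat \<Rightarrow> real"
    unfolding Q_def using E by (intro sum.subset_diff) (auto simp: E'_def)
  have "vr \<beta> {1..n} = (\<Sum>i\<in>Q. \<Sum>j\<in>{1..n}. cov \<beta> i j) + (\<Sum>i\<in>E'. \<Sum>j\<in>Q. cov \<beta> i j) + (\<Sum>i\<in>E'. \<Sum>j\<in>E'. cov \<beta> i j)"
    unfolding vr_eq[OF \<beta>] by (subst split, subst (2) split) (simp add: sum.distrib)
  moreover have "\<bar>\<Sum>i\<in>Q. \<Sum>j\<in>{1..n}. cov \<beta> i j\<bar> \<le> R * real (card Q)"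
    by (rule double_cov_le[OF \<beta>]) (use fin in auto)
  moreover have "\<bar>\<Sum>i\<in>E'. \<Sum>j\<in>Q. cov \<beta> i j\<bar> \<le> R * real (card Q)"
  proof -
    have "(\<Sum>i\<in>E'. \<Sum>j\<in>Q. cov \<beta> i j) = (\<Sum>j\<in>Q. \<Sum>i\<in>E'. cov \<beta> j i)"
      by (subst sum.swap) (simp add: cov_sym)
    then show ?thesis using double_cov_le[OF \<beta> fin] by simp
  qed
  moreover have "\<bar>(\<Sum>i\<in>E'. \<Sum>j\<in>E'. cov \<beta> i j) - (\<Sum>j<m. vr \<beta> (blk p q j))\<bar> \<le> real n * rtail q"
  proof -
    have "(\<Sum>i\<in>E'. \<Sum>j\<in>E'. cov \<beta> i j) - (\<Sum>j<m. vr \<beta> (blk p q j)) = (\<Sum>l<m. \<Sum>i\<in>blk p q l. \<Sum>j\<in>E' - blk p q l. cov \<beta> i j)"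
    proof -
      have "(\<Sum>i\<in>E'. \<Sum>j\<in>E'. cov \<beta> i j) = (\<Sum>l<m. \<Sum>i\<in>blk p q l. \<Sum>j\<in>E'. cov \<beta> i j)"
        unfolding E'_def by (rule sum_blks)
      also have "\<dots> = (\<Sum>l<m. \<Sum>i\<in>blk p q l. (\<Sum>j\<in>E' - blk p q l. cov \<beta> i j) + (\<Sum>j\<in>blk p q l. cov \<beta> i j))"
      proof (intro sum.cong[OF refl])
        fix l i assume "l \<in> {..<m}"
        then have "blk p q l \<subseteq> E'" by (auto simp: E'_def blks_def)
        then show "(\<Sum>j\<in>E'. cov \<beta> i j) = (\<Sum>j\<in>E' - blk p q l. cov \<beta> i j) + (\<Sum>j\<in>blk p q l. cov \<beta> i j)"
          using fin by (intro sum.subset_diff) auto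
      qed
      finally show ?thesis by (simp add: vr_eq[OF \<beta>] sum.distrib)
    qed
    also have "\<bar>\<dots>\<bar> \<le> (\<Sum>l<m. \<Sum>i\<in>blk p q l. \<bar>\<Sum>j\<in>E' - blk p q l. cov \<beta> i j\<bar>)"
      by (rule order.trans[OF sum_abs sum_mono]) (rule sum_abs)
    also have "\<dots> \<le> (\<Sum>l<m. \<Sum>i\<in>blk p q l. rtail q)"
    proof (intro sum_mono)
      fix l i assume l: "l \<in> {..<m}" "i \<in> blk p q l"
      have "(\<Sum>j\<in>E' - blk p q l. \<bar>cov \<beta> i j\<bar>) \<le> rtail q"
      proof (rule cov_sum_far[OF \<beta>])
        fix j assume "j \<in> E' - blk p q l"
        then obtain l' where "j \<in> blk p q l'" "l \<noteq> l'" by (auto simp: E'_def blks_def)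
        then show "q \<le> (if i \<le> j then j - i else i - j)" using blk_far[OF l(2)] by blast
      qed (use fin in auto)
      then show "\<bar>\<Sum>j\<in>E' - blk p q l. cov \<beta> i j\<bar> \<le> rtail q" using sum_abs order.trans by blast
    qed
    also have "\<dots> = real (m * p) * rtail q" by simp
    also have "\<dots> \<le> real n * rtail q"
    proof -
      have "card (blks p q m) \<le> n" using card_mono[OF _ E] by simp
      then have "real (m * p) \<le> real n" unfolding card_blks of_nat_le_iff .
      then show ?thesis by (rule mult_right_mono[OF _ rtail_nonneg])
    qed
    finally show ?thesis .
  qed
  ultimately show ?thesis unfolding Q_def[symmetric] E'_def[symmetric] by linarith
qed

lemma Y_blks: "Y \<beta> (blks p q m) x = (\<Sum>j<m. Y \<beta> (blk p q j) x)"
  unfolding Y_def by (rule sum_blks)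

section \<open>Characteristic functions of blocks and of their union\<close>

definition chf :: "(nat \<Rightarrow> real) \<Rightarrow> real \<Rightarrow> nat set \<Rightarrow> complex" where
  "chf \<beta> s Q = (\<integral>x. cis (s * Y \<beta> Q x) \<partial>U)"

lemma cisY: "adm \<beta> \<Longrightarrow> (\<lambda>x. cis (s * Y \<beta> Q x)) \<in> borel_measurable U"
  by (intro cis_measurable_U borel_measurable_times borel_measurable_const Y_measurable)

lemma chf_norm: "adm \<beta> \<Longrightarrow> norm (chf \<beta> s Q) \<le> 1"
  unfolding chf_def by (rule norm_integral_le_one_U(2)[OF cisY]) auto

text \<open>The last block is peeled off: earlier blocks supply the phases, the gap before it the
  decorrelation time, and the block itself is a unimodular test function of the later orbit. As
  characteristic functions have modulus at most 1, the errors of the factors add up.\<close>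

lemma block_decoupling:
  "\<exists>C>0. \<forall>\<beta> s p q m. adm \<beta> \<longrightarrow> norm (chf \<beta> s (blks p q m) - (\<Prod>j<m. chf \<beta> s (blk p q j)))
      \<le> real m * (C * (1 + real (m * (p + q)) * (\<bar>s\<bar> * lip)) / real (Suc q) ^ 4)"
proof -
  obtain C where C: "0 < C" "\<And>\<beta> \<theta> l W k q. adm \<beta> \<Longrightarrow> 0 \<le> l \<Longrightarrow>
     (\<forall>j x y. 0 < x \<longrightarrow> x \<le> y \<longrightarrow> y \<le> 1 \<longrightarrow> \<bar>\<theta> j x - \<theta> j y\<bar> \<le> l * (y - x)) \<Longrightarrow>
     (\<forall>j. \<theta> j \<in> borel_measurable U) \<Longrightarrow>
     W \<in> borel_measurable U \<Longrightarrow> (\<forall>x. 0 < x \<longrightarrow> x \<le> 1 \<longrightarrow> norm (W x) \<le> 1) \<Longrightarrow>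
     norm ((\<integral>x. cis (\<Sum>j=1..k. \<theta> j (seqT \<beta> j x)) * W (seqT \<beta> (k + q) x) \<partial>U)
        - (\<integral>x. cis (\<Sum>j=1..k. \<theta> j (seqT \<beta> j x)) \<partial>U) * (\<integral>x. W (seqT \<beta> (k + q) x) \<partial>U))
     \<le> C * (1 + real k * l) / real (Suc q) ^ 4"
    using twisted_decorrelation by blast
  have one: "norm (chf \<beta> s (blks p q (Suc (Suc m))) - chf \<beta> s (blks p q (Suc m)) * chf \<beta> s (blk p q (Suc m)))
      \<le> C * (1 + real (Suc m * (p + q)) * (\<bar>s\<bar> * lip)) / real (Suc q) ^ 4" if \<beta>: "adm \<beta>" for \<beta> s p q m
  proof -
    define E where "E = blks p q (Suc m)"
    define k where "k = m * (p + q) + p"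
    define b where "b = Suc m * (p + q)"
    have kb: "k + q = b" by (simp add: k_def b_def)
    have Ek: "E \<subseteq> {1..k}" unfolding E_def k_def by (rule blks_subset)
    \<comment> \<open>The indicator switches the phase off inside the gaps, so that the sum over all
      times up to \<open>k\<close> is the sum over the blocks.\<close>
    define \<theta> where "\<theta> j x = s * (indicator E j * (\<phi> x - mean \<beta> j))" for j x
    define W where "W x = cis (s * (\<Sum>i=1..p. \<phi> (seqT (sh b \<beta>) i x) - mean \<beta> (b + i)))" for x
    have \<beta>': "adm (sh b \<beta>)" by (rule adm_sh[OF \<beta>])
    have th: "\<bar>\<theta> j x - \<theta> j y\<bar> \<le> (\<bar>s\<bar> * lip) * (y - x)" if "0 < x" "x \<le> y" "y \<le> 1" for j x y
    proof -
      have "\<theta> j x - \<theta> j y = s * (indicator E j * (\<phi> x - \<phi> y))" by (simp add: \<theta>_def algebra_simps)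
      then have "\<bar>\<theta> j x - \<theta> j y\<bar> = \<bar>s\<bar> * (indicator E j * \<bar>\<phi> x - \<phi> y\<bar>)" by (simp add: abs_mult)
      also have "\<dots> \<le> \<bar>s\<bar> * (1 * (lip * (y - x)))"
        using \<phi>_lip[OF that] lip_nonneg that by (intro mult_left_mono mult_mono) (auto split: split_indicator)
      finally show ?thesis by simp
    qed
    have \<theta>m: "\<theta> j \<in> borel_measurable U" for j
      unfolding \<theta>_def by (intro borel_measurable_times borel_measurable_const borel_measurable_diff \<phi>_U)
    have Wm: "W \<in> borel_measurable U"
      unfolding W_def by (intro cis_measurable_U borel_measurable_times borel_measurable_const borel_measurable_sum
        borel_measurable_diff \<phi>T_measurable[OF \<beta>'])
    have past: "(\<Sum>j=1..k. \<theta> j (seqT \<beta> j x)) = s * Y \<beta> E x" for x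
    proof -
      have "(\<Sum>j=1..k. \<theta> j (seqT \<beta> j x)) = s * (\<Sum>j=1..k. if j \<in> E then \<phi> (seqT \<beta> j x) - mean \<beta> j else 0)"
        by (auto simp: \<theta>_def sum_distrib_left intro!: sum.cong split: split_indicator)
      also have "(\<Sum>j=1..k. if j \<in> E then \<phi> (seqT \<beta> j x) - mean \<beta> j else 0) = (\<Sum>j\<in>{1..k} \<inter> E. \<phi> (seqT \<beta> j x) - mean \<beta> j)"
        by (rule sum.inter_restrict[symmetric]) simp
      also have "{1..k} \<inter> E = E" using Ek by auto
      finally show ?thesis by (simp add: Y_def)
    qed
    have fut: "W (seqT \<beta> (k + q) x) = cis (s * Y \<beta> (blk p q (Suc m)) x)" for x
    proof -
      have "(\<Sum>i=1..p. \<phi> (seqT (sh b \<beta>) i (seqT \<beta> b x)) - mean \<beta> (b + i)) = (\<Sum>i=1..p. \<phi> (seqT \<beta> (i + b) x) - mean \<beta> (i + b))"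
        by (simp add: seqT_plus[symmetric] add.commute)
      also have "\<dots> = (\<Sum>i=1+b..p+b. \<phi> (seqT \<beta> i x) - mean \<beta> i)"
        by (rule sum.shift_bounds_cl_nat_ivl[symmetric])
      also have "{1+b..p+b} = blk p q (Suc m)" by (auto simp: blk_def b_def)
      finally show ?thesis unfolding kb W_def by (simp add: Y_def)
    qed
    have comb: "cis (s * Y \<beta> E x) * cis (s * Y \<beta> (blk p q (Suc m)) x) = cis (s * Y \<beta> (blks p q (Suc (Suc m))) x)" for x
      unfolding E_def by (simp add: cis_mult Y_blks algebra_simps)
    have "norm ((\<integral>x. cis (\<Sum>j=1..k. \<theta> j (seqT \<beta> j x)) * W (seqT \<beta> (k + q) x) \<partial>U)
        - (\<integral>x. cis (\<Sum>j=1..k. \<theta> j (seqT \<beta> j x)) \<partial>U) * (\<integral>x. W (seqT \<beta> (k + q) x) \<partial>U))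
      \<le> C * (1 + real k * (\<bar>s\<bar> * lip)) / real (Suc q) ^ 4"
      by (rule C(2)[OF \<beta> _ _ _ Wm]) (use th \<theta>m lip_nonneg in \<open>auto simp: W_def\<close>)
    also have "\<dots> \<le> C * (1 + real (Suc m * (p + q)) * (\<bar>s\<bar> * lip)) / real (Suc q) ^ 4"
    proof (intro divide_right_mono mult_left_mono add_left_mono mult_right_mono)
      show "real k \<le> real (Suc m * (p + q))" unfolding of_nat_le_iff by (simp add: k_def)
    qed (use C(1) lip_nonneg in auto)
    finally show ?thesis unfolding past fut comb chf_def E_def[symmetric] .
  qed
  \<comment> \<open>The induction runs over the number of blocks with a fixed upper limit
    \<open>n\<close>, so every step uses the same error bound.\<close>
  have "norm (chf \<beta> s (blks p q m) - (\<Prod>j<m. chf \<beta> s (blk p q j))) \<le> real m * (C * (1 + real (n * (p + q)) * (\<bar>s\<bar> * lip)) / real (Suc q) ^ 4)"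
    if \<beta>: "adm \<beta>" and "m \<le> n" for \<beta> s p q m n
    using that(2)
  proof (induction m)
    case 0
    show ?case using U.prob_space by (simp add: chf_def blks_def Y_def)
  next
    case (Suc m)
    define \<delta> where "\<delta> = C * (1 + real (n * (p + q)) * (\<bar>s\<bar> * lip)) / real (Suc q) ^ 4"
    have \<delta>0: "0 \<le> \<delta>" using C(1) lip_nonneg by (simp add: \<delta>_def)
    show ?case
    proof (cases m)
      case 0
      then have "blks p q (Suc m) = blk p q 0" by (simp add: blks_def lessThan_Suc)
      then have "norm (chf \<beta> s (blks p q (Suc m)) - (\<Prod>j<Suc m. chf \<beta> s (blk p q j))) = 0" using 0 by simp
      then show ?thesis using \<delta>0 unfolding \<delta>_def[symmetric] by simp
    next
      case (Suc l)
      let ?P = "\<Prod>j<m. chf \<beta> s (blk p q j)"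
      have a: "norm (chf \<beta> s (blks p q (Suc m)) - chf \<beta> s (blks p q m) * chf \<beta> s (blk p q m)) \<le> \<delta>"
      proof -
        have "norm (chf \<beta> s (blks p q (Suc m)) - chf \<beta> s (blks p q m) * chf \<beta> s (blk p q m)) \<le> C * (1 + real (m * (p + q)) * (\<bar>s\<bar> * lip)) / real (Suc q) ^ 4"
          using one[OF \<beta>, of s p q l] Suc by simp
        also have "\<dots> \<le> \<delta>" unfolding \<delta>_def
        proof (intro divide_right_mono mult_left_mono add_left_mono mult_right_mono)
          show "real (m * (p + q)) \<le> real (n * (p + q))" unfolding of_nat_le_iff using Suc.prems by (intro mult_right_mono) auto
        qed (use C(1) lip_nonneg in auto)
        finally show ?thesis .
      qed
      have b: "norm ((chf \<beta> s (blks p q m) - ?P) * chf \<beta> s (blk p q m)) \<le> real m * \<delta>"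
      proof -
        have "norm ((chf \<beta> s (blks p q m) - ?P) * chf \<beta> s (blk p q m)) \<le> norm (chf \<beta> s (blks p q m) - ?P) * 1"
          unfolding norm_mult by (intro mult_left_mono chf_norm[OF \<beta>]) auto
        also have "\<dots> \<le> real m * \<delta>" using Suc.IH Suc.prems unfolding \<delta>_def by simp
        finally show ?thesis .
      qed
      have dec: "chf \<beta> s (blks p q (Suc m)) - (\<Prod>j<Suc m. chf \<beta> s (blk p q j))
        = (chf \<beta> s (blks p q (Suc m)) - chf \<beta> s (blks p q m) * chf \<beta> s (blk p q m)) + (chf \<beta> s (blks p q m) - ?P) * chf \<beta> s (blk p q m)"
        by (simp add: algebra_simps)
      have "norm (chf \<beta> s (blks p q (Suc m)) - (\<Prod>j<Suc m. chf \<beta> s (blk p q j))) \<le> \<delta> + real m * \<delta>"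
        unfolding dec by (rule norm_triangle_mono[OF a b])
      then show ?thesis unfolding \<delta>_def[symmetric] by (simp add: algebra_simps)
    qed
  qed
  then show ?thesis using C(1) by blast
qed

text \<open>Taylor expansion to second order; the third absolute moment is at most the supremum of
  the block sum times its variance, and that supremum is at most
  \<open>2 * M * real (card Q)\<close>. The quadratic is then replaced by the exponential.\<close>

lemma chf_gauss:
  assumes \<beta>: "adm \<beta>" and Q: "finite Q"
  shows "norm (chf \<beta> s Q - of_real (exp (- (s\<^sup>2 * vr \<beta> Q / 2)))) \<le> (\<bar>s\<bar> ^ 3 * (2 * M * real (card Q)) / 6) * vr \<beta> Q + (s\<^sup>2 * vr \<beta> Q / 2)\<^sup>2"
proof -
  define B where "B = 2 * M * real (card Q)"
  define v where "v = vr \<beta> Q"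
  let ?Y = "Y \<beta> Q"
  have Yb: "\<bar>?Y x\<bar> \<le> B" for x unfolding B_def by (rule Y_bound[OF \<beta>])
  have Ym: "?Y \<in> borel_measurable U" by (rule Y_measurable[OF \<beta>])
  have Yi: "integrable U ?Y" by (rule integrable_bounded_U[OF Ym Yb])
  have Y2i: "integrable U (\<lambda>x. (?Y x)\<^sup>2)"
    by (rule integrable_bounded_U[of _ "B\<^sup>2"]) (use Ym Yb in \<open>auto simp: abs_le_square_iff[symmetric] intro: order.trans[OF _ abs_ge_self]\<close>)
  have ci: "integrable U (\<lambda>x. cis (s * ?Y x))" by (rule norm_integral_le_one_U(1)[OF cisY[OF \<beta>]]) simp
  define D where "D x = cis (s * ?Y x) - (1 + \<i> * of_real (s * ?Y x) - of_real ((s * ?Y x)\<^sup>2 / 2))" for x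
  have i1: "integrable U (\<lambda>x. \<i> * complex_of_real (s * ?Y x))" using Yi by (intro integrable_mult_right integrable_of_real) auto
  have e2: "(s * ?Y x)\<^sup>2 / 2 = s\<^sup>2 / 2 * (?Y x)\<^sup>2" for x by (simp add: power_mult_distrib)
  have i2: "integrable U (\<lambda>x. complex_of_real ((s * ?Y x)\<^sup>2 / 2))" unfolding e2 using Y2i by (intro integrable_of_real) auto
  have Di: "integrable U D" unfolding D_def using ci i1 i2 by auto
  have "(\<integral>x. D x \<partial>U) = chf \<beta> s Q - (1 + \<i> * of_real (s * (\<integral>x. ?Y x \<partial>U)) - of_real (s\<^sup>2 / 2 * v))"
  proof -
    have "(\<integral>x. D x \<partial>U) = chf \<beta> s Q - ((\<integral>x. 1 \<partial>U) + (\<integral>x. \<i> * complex_of_real (s * ?Y x) \<partial>U) - (\<integral>x. complex_of_real ((s * ?Y x)\<^sup>2 / 2) \<partial>U))"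
      unfolding D_def chf_def using ci i1 i2 by simp
    also have "(\<integral>x. \<i> * complex_of_real (s * ?Y x) \<partial>U) = \<i> * complex_of_real (\<integral>x. s * ?Y x \<partial>U)"
      by (simp only: integral_mult_right_zero integral_complex_of_real)
    also have "(\<integral>x. complex_of_real ((s * ?Y x)\<^sup>2 / 2) \<partial>U) = complex_of_real (\<integral>x. s\<^sup>2 / 2 * (?Y x)\<^sup>2 \<partial>U)"
      unfolding e2 by (simp only: integral_complex_of_real)
    finally show ?thesis using U.prob_space by (simp add: v_def vr_def)
  qed
  then have De: "(\<integral>x. D x \<partial>U) = chf \<beta> s Q - of_real (1 - s\<^sup>2 * v / 2)" using Y_integral[OF \<beta>, of Q] by simp
  have "norm (\<integral>x. D x \<partial>U) \<le> (\<integral>x. norm (D x) \<partial>U)" by (rule integral_norm_bound)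
  also have "\<dots> \<le> (\<integral>x. (\<bar>s\<bar> ^ 3 * B / 6) * (?Y x)\<^sup>2 \<partial>U)"
  proof (rule integral_mono)
    fix x
    have "norm (D x) \<le> \<bar>s * ?Y x\<bar> ^ 3 / 6" unfolding D_def by (rule cis_taylor)
    also have "\<dots> = \<bar>s\<bar> ^ 3 / 6 * (\<bar>?Y x\<bar> * (?Y x)\<^sup>2)"
    proof -
      have "\<bar>a\<bar> ^ 3 = \<bar>a\<bar> * a\<^sup>2" for a :: real by (simp add: power3_eq_cube power2_eq_square mult.assoc)
      then show ?thesis by (simp add: abs_mult power_mult_distrib)
    qed
    also have "\<dots> \<le> \<bar>s\<bar> ^ 3 / 6 * (B * (?Y x)\<^sup>2)" by (intro mult_left_mono mult_right_mono Yb) auto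
    finally show "norm (D x) \<le> (\<bar>s\<bar> ^ 3 * B / 6) * (?Y x)\<^sup>2" by (simp add: mult_ac)
  qed (use Di Y2i in auto)
  also have "\<dots> = (\<bar>s\<bar> ^ 3 * B / 6) * v" by (simp add: v_def vr_def)
  finally have 1: "norm (chf \<beta> s Q - of_real (1 - s\<^sup>2 * v / 2)) \<le> (\<bar>s\<bar> ^ 3 * B / 6) * v" unfolding De .
  have "0 \<le> s\<^sup>2 * v / 2" using vr_nonneg[of \<beta> Q] by (simp add: v_def)
  from exp_minus_quadratic[OF this]
  have 2: "norm (complex_of_real (1 - s\<^sup>2 * v / 2) - of_real (exp (- (s\<^sup>2 * v / 2)))) \<le> (s\<^sup>2 * v / 2)\<^sup>2"
    by (simp only: of_real_diff[symmetric] norm_of_real)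
  show ?thesis using norm_triangle_mono[OF 1 2] unfolding B_def v_def by simp
qed

end

text \<open>With \<open>w = scl n\<close>, the integer part of the tenth root of \<open>n\<close>, the Bernstein blocks have length \<open>w^4\<close> and the gaps \<open>w^3\<close>.\<close>

definition scl :: "nat \<Rightarrow> nat" where "scl n = (LEAST w. n < Suc w ^ 10)"

lemma scl_props:
  assumes "1 \<le> n"
  shows "1 \<le> scl n" "scl n ^ 10 \<le> n" "n < Suc (scl n) ^ 10"
proof -
  have "Suc n \<le> Suc n ^ 10" by (rule self_le_power) simp_all
  then have ex: "n < Suc n ^ 10" by (rule Suc_le_lessD)
  show 1: "n < Suc (scl n) ^ 10" unfolding scl_def by (rule LeastI, rule ex)
  show 2: "1 \<le> scl n"
  proof (rule ccontr)
    assume "\<not> 1 \<le> scl n"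
    then have "scl n = 0" by simp
    then show False using 1 assms by simp
  qed
  then obtain w where w: "scl n = Suc w" by (cases "scl n") auto
  have "\<not> n < Suc w ^ 10" using not_less_Least[of w "\<lambda>w. n < Suc w ^ 10"] w by (simp add: scl_def)
  then show "scl n ^ 10 \<le> n" using w by simp
qed

lemma scl_at_top: "filterlim scl at_top sequentially"
  unfolding filterlim_at_top
proof
  fix Z
  show "\<forall>\<^sub>F n in sequentially. Z \<le> scl n"
    using eventually_ge_at_top[of "max 1 (Suc Z ^ 10)"]
  proof eventually_elim
    case (elim n)
    then have "1 \<le> n" "Suc Z ^ 10 \<le> n" by (simp_all only: max.bounded_iff)
    then have "Suc Z ^ 10 < Suc (scl n) ^ 10" using scl_props(3)[of n] by linarith
    then have "Suc Z < Suc (scl n)" by (rule power_less_imp_less_base) simp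
    then show ?case by simp
  qed
qed

context lsv_obs
begin

text \<open>The first term discards the indices outside the blocks, the second decouples the blocks,
  the third and fourth replace each block by a Gaussian, and the last corrects the sum of block
  variances to the full variance.\<close>

lemma chf_bound:
  "\<exists>C>0. \<forall>\<beta> n p q m s. adm \<beta> \<longrightarrow> m * (p + q) \<le> n \<longrightarrow>
    norm (chf \<beta> s {1..n} - of_real (exp (- (s\<^sup>2 * vr \<beta> {1..n} / 2)))) \<le>
      \<bar>s\<bar> * sqrt (R * real (n - m * p)) + real m * (C * (1 + real n * (\<bar>s\<bar> * lip)) / real (Suc q) ^ 4)
      + \<bar>s\<bar> ^ 3 * (M * real p / 3) * (R * real n) + s ^ 4 * (R * real p) * (R * real n) / 4
      + s\<^sup>2 / 2 * (2 * R * real (n - m * p) + real n * rtail q)"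
proof -
  obtain C where C: "0 < C" "\<And>\<beta> s p q m. adm \<beta> \<Longrightarrow> norm (chf \<beta> s (blks p q m) - (\<Prod>j<m. chf \<beta> s (blk p q j)))
      \<le> real m * (C * (1 + real (m * (p + q)) * (\<bar>s\<bar> * lip)) / real (Suc q) ^ 4)"
    using block_decoupling by blast
  have "norm (chf \<beta> s {1..n} - of_real (exp (- (s\<^sup>2 * vr \<beta> {1..n} / 2)))) \<le>
      \<bar>s\<bar> * sqrt (R * real (n - m * p)) + real m * (C * (1 + real n * (\<bar>s\<bar> * lip)) / real (Suc q) ^ 4)
      + \<bar>s\<bar> ^ 3 * (M * real p / 3) * (R * real n) + s ^ 4 * (R * real p) * (R * real n) / 4
      + s\<^sup>2 / 2 * (2 * R * real (n - m * p) + real n * rtail q)"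
    if \<beta>: "adm \<beta>" and mn: "m * (p + q) \<le> n" for \<beta> n p q m s
  proof -
    define E where "E = blks p q m"
    have E: "E \<subseteq> {1..n}"
    proof (cases m)
      case 0 then show ?thesis by (simp add: E_def blks_def)
    next
      case (Suc l)
      have "{1..l * (p + q) + p} \<subseteq> {1..n}" using mn Suc by simp
      then show ?thesis using blks_subset[of p q l] Suc unfolding E_def by blast
    qed
    define Q where "Q = {1..n} - E"
    have fin: "finite E" "finite Q" by (auto simp: E_def Q_def)
    have cQ: "card Q = n - m * p" unfolding Q_def using E fin by (simp add: card_Diff_subset E_def card_blks)
    have mp: "m * p \<le> n" using mn by (simp add: algebra_simps)
    have YS: "Y \<beta> {1..n} x = Y \<beta> E x + Y \<beta> Q x" for x
      unfolding Y_def Q_def using E by (subst add.commute, intro sum.subset_diff) auto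
    have e1: "norm (chf \<beta> s {1..n} - chf \<beta> s E) \<le> \<bar>s\<bar> * sqrt (R * real (n - m * p))"
    proof -
      have ci: "integrable U (\<lambda>x. cis (s * Y \<beta> A x))" for A by (rule norm_integral_le_one_U(1)[OF cisY[OF \<beta>]]) simp
      have Yi: "integrable U (\<lambda>x. \<bar>Y \<beta> Q x\<bar>)"
        using integrable_bounded_U[OF Y_measurable[OF \<beta>] Y_bound[OF \<beta>]] by auto
      have "norm (chf \<beta> s {1..n} - chf \<beta> s E) = norm (\<integral>x. cis (s * Y \<beta> {1..n} x) - cis (s * Y \<beta> E x) \<partial>U)"
        unfolding chf_def using ci by simp
      also have "\<dots> \<le> (\<integral>x. norm (cis (s * Y \<beta> {1..n} x) - cis (s * Y \<beta> E x)) \<partial>U)" by (rule integral_norm_bound)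
      also have "\<dots> \<le> (\<integral>x. \<bar>s\<bar> * \<bar>Y \<beta> Q x\<bar> \<partial>U)"
      proof (rule integral_mono)
        fix x
        have "norm (cis (s * Y \<beta> {1..n} x) - cis (s * Y \<beta> E x)) \<le> \<bar>s * Y \<beta> {1..n} x - s * Y \<beta> E x\<bar>" by (rule cis_lipschitz)
        also have "s * Y \<beta> {1..n} x - s * Y \<beta> E x = s * Y \<beta> Q x" unfolding YS by (simp add: distrib_left)
        also have "\<bar>s * Y \<beta> Q x\<bar> = \<bar>s\<bar> * \<bar>Y \<beta> Q x\<bar>" by (rule abs_mult)
        finally show "norm (cis (s * Y \<beta> {1..n} x) - cis (s * Y \<beta> E x)) \<le> \<bar>s\<bar> * \<bar>Y \<beta> Q x\<bar>" .
      qed (use ci Yi in auto)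
      also have "\<dots> = \<bar>s\<bar> * (\<integral>x. \<bar>Y \<beta> Q x\<bar> \<partial>U)" by simp
      also have "\<dots> \<le> \<bar>s\<bar> * sqrt (vr \<beta> Q)"
        unfolding vr_def by (intro mult_left_mono L1_le_L2_U[OF Y_measurable[OF \<beta>] Y_bound[OF \<beta>]]) auto
      also have "\<dots> \<le> \<bar>s\<bar> * sqrt (R * real (n - m * p))"
        using vr_le[OF \<beta> fin(2)] by (intro mult_left_mono real_sqrt_le_mono) (auto simp: cQ)
      finally show ?thesis .
    qed
    have e2: "norm (chf \<beta> s E - (\<Prod>j<m. chf \<beta> s (blk p q j))) \<le> real m * (C * (1 + real n * (\<bar>s\<bar> * lip)) / real (Suc q) ^ 4)"
    proof -
      have "norm (chf \<beta> s E - (\<Prod>j<m. chf \<beta> s (blk p q j))) \<le> real m * (C * (1 + real (m * (p + q)) * (\<bar>s\<bar> * lip)) / real (Suc q) ^ 4)"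
        unfolding E_def by (rule C(2)[OF \<beta>])
      also have "\<dots> \<le> real m * (C * (1 + real n * (\<bar>s\<bar> * lip)) / real (Suc q) ^ 4)"
      proof (intro mult_left_mono divide_right_mono add_left_mono mult_right_mono)
        show "real (m * (p + q)) \<le> real n" unfolding of_nat_le_iff by (rule mn)
      qed (use C(1) lip_nonneg in auto)
      finally show ?thesis .
    qed
    let ?v = "\<lambda>j. vr \<beta> (blk p q j)"
    have v: "0 \<le> ?v j" "?v j \<le> R * real p" for j
      using vr_nonneg vr_le[OF \<beta> finite_blk(1)] by auto
    have sv: "(\<Sum>j<m. ?v j) \<le> R * real n"
    proof -
      have "(\<Sum>j<m. ?v j) \<le> (\<Sum>j<m. R * real p)" by (intro sum_mono v)
      also have "\<dots> = R * real (m * p)" by simp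
      also have "\<dots> \<le> R * real n" using mp by (intro mult_left_mono R_nonneg) (simp only: of_nat_le_iff)
      finally show ?thesis .
    qed
    have e3: "norm ((\<Prod>j<m. chf \<beta> s (blk p q j)) - (\<Prod>j<m. complex_of_real (exp (- (s\<^sup>2 * ?v j / 2)))))
      \<le> \<bar>s\<bar> ^ 3 * (M * real p / 3) * (R * real n) + s ^ 4 * (R * real p) * (R * real n) / 4"
    proof -
      have "norm ((\<Prod>j<m. chf \<beta> s (blk p q j)) - (\<Prod>j<m. complex_of_real (exp (- (s\<^sup>2 * ?v j / 2)))))
        \<le> (\<Sum>j<m. norm (chf \<beta> s (blk p q j) - complex_of_real (exp (- (s\<^sup>2 * ?v j / 2)))))"
        using v by (intro norm_prod_diff chf_norm[OF \<beta>]) auto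
      also have "\<dots> \<le> (\<Sum>j<m. \<bar>s\<bar> ^ 3 * (M * real p / 3) * ?v j + s ^ 4 * (R * real p) / 4 * ?v j)"
      proof (rule sum_mono)
        fix j
        have a: "norm (chf \<beta> s (blk p q j) - complex_of_real (exp (- (s\<^sup>2 * ?v j / 2))))
          \<le> (\<bar>s\<bar> ^ 3 * (2 * M * real p) / 6) * ?v j + (s\<^sup>2 * ?v j / 2)\<^sup>2"
          using chf_gauss[OF \<beta> finite_blk(1), of s p q j] by simp
        have "(s\<^sup>2 * ?v j / 2)\<^sup>2 = s ^ 4 / 4 * (?v j * ?v j)" by (simp add: power2_eq_square eval_nat_numeral)
        also have "\<dots> \<le> s ^ 4 / 4 * (R * real p * ?v j)" by (intro mult_left_mono mult_right_mono v) auto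
        finally have "(s\<^sup>2 * ?v j / 2)\<^sup>2 \<le> s ^ 4 / 4 * (R * real p * ?v j)" .
        moreover have "(\<bar>s\<bar> ^ 3 * (2 * M * real p) / 6) * ?v j + s ^ 4 / 4 * (R * real p * ?v j) = \<bar>s\<bar> ^ 3 * (M * real p / 3) * ?v j + s ^ 4 * (R * real p) / 4 * ?v j"
          by (simp add: mult_ac)
        ultimately show "norm (chf \<beta> s (blk p q j) - complex_of_real (exp (- (s\<^sup>2 * ?v j / 2)))) \<le> \<bar>s\<bar> ^ 3 * (M * real p / 3) * ?v j + s ^ 4 * (R * real p) / 4 * ?v j"
          using a by linarith
      qed
      also have "\<dots> = \<bar>s\<bar> ^ 3 * (M * real p / 3) * (\<Sum>j<m. ?v j) + s ^ 4 * (R * real p) / 4 * (\<Sum>j<m. ?v j)"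
        by (simp only: sum.distrib sum_distrib_left)
      also have "\<dots> \<le> \<bar>s\<bar> ^ 3 * (M * real p / 3) * (R * real n) + s ^ 4 * (R * real p) / 4 * (R * real n)"
        using M_nonneg R_nonneg by (intro add_mono mult_left_mono sv) auto
      finally show ?thesis by simp
    qed
    have pr: "(\<Prod>j<m. complex_of_real (exp (- (s\<^sup>2 * ?v j / 2)))) = of_real (exp (- (s\<^sup>2 * (\<Sum>j<m. ?v j) / 2)))"
    proof -
      have "exp (- (s\<^sup>2 * (\<Sum>j<m. ?v j) / 2)) = exp (\<Sum>j<m. - (s\<^sup>2 * ?v j / 2))"
        by (simp add: sum_negf sum_distrib_left sum_divide_distrib)
      then show ?thesis by (simp add: exp_sum)
    qed
    have e5: "norm (complex_of_real (exp (- (s\<^sup>2 * (\<Sum>j<m. ?v j) / 2))) - of_real (exp (- (s\<^sup>2 * vr \<beta> {1..n} / 2))))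
      \<le> s\<^sup>2 / 2 * (2 * R * real (n - m * p) + real n * rtail q)"
    proof -
      have "norm (complex_of_real (exp (- (s\<^sup>2 * (\<Sum>j<m. ?v j) / 2))) - of_real (exp (- (s\<^sup>2 * vr \<beta> {1..n} / 2))))
        = \<bar>exp (- (s\<^sup>2 * (\<Sum>j<m. ?v j) / 2)) - exp (- (s\<^sup>2 * vr \<beta> {1..n} / 2))\<bar>"
        by (simp only: of_real_diff[symmetric] norm_of_real)
      also have "\<dots> \<le> \<bar>s\<^sup>2 * (\<Sum>j<m. ?v j) / 2 - s\<^sup>2 * vr \<beta> {1..n} / 2\<bar>"
        using v(1) vr_nonneg by (intro exp_minus_lipschitz divide_nonneg_pos mult_nonneg_nonneg sum_nonneg) auto
      also have "\<dots> = s\<^sup>2 / 2 * \<bar>vr \<beta> {1..n} - (\<Sum>j<m. ?v j)\<bar>"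
      proof -
        have e: "s\<^sup>2 * (\<Sum>j<m. ?v j) / 2 - s\<^sup>2 * vr \<beta> {1..n} / 2 = s\<^sup>2 / 2 * ((\<Sum>j<m. ?v j) - vr \<beta> {1..n})"
          by (simp add: algebra_simps diff_divide_distrib)
        show ?thesis unfolding e abs_mult by (simp add: abs_minus_commute)
      qed
      also have "\<dots> \<le> s\<^sup>2 / 2 * (2 * R * real (n - m * p) + real n * rtail q)"
        using block_variance[OF \<beta> E[unfolded E_def]] unfolding E_def[symmetric] Q_def[symmetric] cQ by (intro mult_left_mono) auto
      finally show ?thesis .
    qed
    have "norm (chf \<beta> s {1..n} - of_real (exp (- (s\<^sup>2 * vr \<beta> {1..n} / 2)))) \<le>
      norm (chf \<beta> s {1..n} - chf \<beta> s E) + norm (chf \<beta> s E - (\<Prod>j<m. chf \<beta> s (blk p q j)))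
      + norm ((\<Prod>j<m. chf \<beta> s (blk p q j)) - of_real (exp (- (s\<^sup>2 * (\<Sum>j<m. ?v j) / 2))))
      + norm (complex_of_real (exp (- (s\<^sup>2 * (\<Sum>j<m. ?v j) / 2))) - of_real (exp (- (s\<^sup>2 * vr \<beta> {1..n} / 2))))"
      by norm
    then show ?thesis using e1 e2 e3[unfolded pr] e5 by linarith
  qed
  then show ?thesis using C(1) by blast
qed

text \<open>Linear growth gives \<open>\<bar>s\<bar> * sqrt (real n) \<le> b\<close>. For
  \<open>x = real (scl n)\<close>, so that \<open>n\<close> is of order x^10, the gap term is of
  order x^(-1/2) and the rest of order 1/x plus a multiple of \<open>rtail\<close> at the gap
  length.\<close>

lemma chf_tendsto:
  assumes \<beta>: "adm \<beta>" and c: "0 < c" and grow: "\<And>n. N \<le> n \<Longrightarrow> c * real n \<le> vr \<beta> {1..n}"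
  shows "(\<lambda>n. chf \<beta> (t / sqrt (vr \<beta> {1..n})) {1..n}) \<longlonglongrightarrow> of_real (exp (- t\<^sup>2 / 2))"
proof -
  obtain C where C: "0 < C" "\<And>\<beta> n p q m s. adm \<beta> \<Longrightarrow> m * (p + q) \<le> n \<Longrightarrow>
    norm (chf \<beta> s {1..n} - of_real (exp (- (s\<^sup>2 * vr \<beta> {1..n} / 2)))) \<le>
      \<bar>s\<bar> * sqrt (R * real (n - m * p)) + real m * (C * (1 + real n * (\<bar>s\<bar> * lip)) / real (Suc q) ^ 4)
      + \<bar>s\<bar> ^ 3 * (M * real p / 3) * (R * real n) + s ^ 4 * (R * real p) * (R * real n) / 4
      + s\<^sup>2 / 2 * (2 * R * real (n - m * p) + real n * rtail q)"
    using chf_bound by blast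
  define b where "b = \<bar>t\<bar> / sqrt c"
  have b0: "0 \<le> b" using c by (simp add: b_def)
  \<comment> \<open>1024 is 2^10, from \<open>n < (w + 1) ^ 10 \<le> (2 * w) ^ 10\<close>, and 32 is
    its square root. The four summands collect the terms of order 1/w from \<open>E2\<close> to
    \<open>E5\<close>.\<close>
  define K1 where "K1 = 1024 * C * (1 + 32 * b * lip) + b ^ 3 * M * R / 3 + b ^ 4 * R * R / 4 + 3 * b\<^sup>2 * R"
  define g where "g w = b * sqrt (3 * R * inverse (real w)) + K1 * inverse (real w) + b\<^sup>2 / 2 * rtail (w ^ 3)" for w :: nat
  have main: "norm (chf \<beta> (t / sqrt (vr \<beta> {1..n})) {1..n} - of_real (exp (- t\<^sup>2 / 2))) \<le> g (scl n)"
    if n: "max N 1 \<le> n" for n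
  proof -
    define w where "w = scl n"
    have n1: "1 \<le> n" using n by simp
    note sc = scl_props[OF n1, folded w_def]
    define x where "x = real w"
    have x1: "1 \<le> x" using sc(1) by (simp add: x_def)
    have xn: "x ^ 10 \<le> real n" unfolding x_def using sc(2) by (metis of_nat_le_iff of_nat_power)
    have nx: "real n \<le> 1024 * x ^ 10"
    proof -
      have "Suc w ^ 10 \<le> (2 * w) ^ 10" using sc(1) by (intro power_mono) auto
      then have "n \<le> (2 * w) ^ 10" using sc(3) by linarith
      then have "real n \<le> real ((2 * w) ^ 10)" by (simp only: of_nat_le_iff)
      also have "\<dots> = 1024 * x ^ 10" by (simp add: x_def power_mult_distrib)
      finally show ?thesis .
    qed
    define y where "y = sqrt (real n)"
    have y2: "y * y = real n" by (simp add: y_def)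
    have y0: "0 < y" using n1 by (simp add: y_def)
    have xy: "x ^ 5 \<le> y"
      unfolding y_def by (rule real_le_rsqrt) (use xn in \<open>simp add: power_mult[symmetric]\<close>)
    have yx: "y \<le> 32 * x ^ 5"
      unfolding y_def by (rule real_le_lsqrt) (use nx x1 in \<open>auto simp: power_mult_distrib power_mult[symmetric]\<close>)
    define p q m where "p = w ^ 4" and "q = w ^ 3" and "m = n div (p + q)"
    have mn: "m * (p + q) \<le> n" by (simp add: m_def)
    have rp: "real p = x ^ 4" and rq: "real q = x ^ 3" by (simp_all add: p_def q_def x_def)
    have px: "0 < x" using x1 by simp
    have m_le: "real m * x ^ 4 \<le> real n"
    proof -
      have "real m * real (p + q) \<le> real n" using mn by (metis of_nat_le_iff of_nat_mult)
      moreover have "real m * x ^ 4 \<le> real m * real (p + q)" using rp by (intro mult_left_mono) auto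
      ultimately show ?thesis by linarith
    qed
    \<comment> \<open>The \<open>m\<close> gaps of length x^3 make up at most n/x, since m x^4 is at
      most n. The incomplete last period has length at most x^4 + x^3, which is bounded by 2 n /
      x.\<close>
    have gapb: "real (n - m * p) \<le> 3 * real n / x"
    proof -
      have "n - m * p \<le> m * q + (p + q)"
      proof -
        have "n = m * (p + q) + n mod (p + q)" by (simp only: m_def div_mult_mod_eq)
        moreover have "n mod (p + q) \<le> p + q" using sc(1) by (intro less_imp_le mod_less_divisor) (simp add: p_def)
        ultimately show ?thesis by (simp add: algebra_simps)
      qed
      then have "real (n - m * p) \<le> real (m * q + (p + q))" by (simp only: of_nat_le_iff)
      also have "\<dots> = real m * x ^ 3 + (x ^ 4 + x ^ 3)" by (simp add: rp rq)
      finally have "real (n - m * p) * x \<le> (real m * x ^ 3 + (x ^ 4 + x ^ 3)) * x" using px by (intro mult_right_mono) auto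
      also have "\<dots> = real m * x ^ 4 + (x ^ 5 + x ^ 4)" by (simp add: algebra_simps eval_nat_numeral)
      also have "\<dots> \<le> real n + (real n + real n)"
        using m_le xn power_increasing[of 5 10 x] power_increasing[of 4 10 x] x1 by (intro add_mono) auto
      finally show ?thesis using px by (simp add: pos_le_divide_eq)
    qed
    define v where "v = vr \<beta> {1..n}"
    have vc: "c * real n \<le> v" unfolding v_def using grow n by auto
    have v0: "0 < v" using vc mult_pos_pos[of c "real n"] c n1 by linarith
    define s where "s = t / sqrt v"
    have s2: "s\<^sup>2 * v = t\<^sup>2" using v0 by (simp add: s_def power_divide)
    have sb: "\<bar>s\<bar> * y \<le> b"
    proof -
      have "sqrt (c * real n) \<le> sqrt v" using vc by simp
      then have le: "sqrt c * y \<le> sqrt v" by (simp add: real_sqrt_mult y_def)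
      have "\<bar>s\<bar> = \<bar>t\<bar> / sqrt v" using v0 by (simp add: s_def abs_div)
      also have "\<dots> \<le> \<bar>t\<bar> / (sqrt c * y)" using le c y0 v0 by (intro divide_left_mono mult_pos_pos) auto
      finally have "\<bar>s\<bar> * y \<le> \<bar>t\<bar> / (sqrt c * y) * y" using y0 by (intro mult_right_mono) auto
      then show ?thesis using y0 by (simp add: b_def)
    qed
    have s2n: "s\<^sup>2 * real n \<le> b\<^sup>2"
    proof -
      have "(\<bar>s\<bar> * y)\<^sup>2 \<le> b\<^sup>2" using sb y0 by (intro power_mono) auto
      moreover have "y\<^sup>2 = real n" by (simp add: y_def)
      ultimately show ?thesis by (simp add: power_mult_distrib)
    qed
    define z where "z = inverse x"
    have z0: "0 < z" using px by (simp add: z_def)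
    have zx: "z * x = 1" using px by (simp add: z_def)
    have E1: "\<bar>s\<bar> * sqrt (R * real (n - m * p)) \<le> b * sqrt (3 * R * z)"
    proof -
      have "R * real (n - m * p) \<le> R * (3 * real n / x)" by (intro mult_left_mono gapb R_nonneg)
      also have "\<dots> = (3 * R * z) * real n" by (simp add: z_def divide_inverse)
      finally have "sqrt (R * real (n - m * p)) \<le> sqrt (3 * R * z) * y" unfolding y_def real_sqrt_mult[symmetric] by (rule real_sqrt_le_mono)
      then have "\<bar>s\<bar> * sqrt (R * real (n - m * p)) \<le> \<bar>s\<bar> * (sqrt (3 * R * z) * y)" by (intro mult_left_mono) auto
      also have "\<dots> = (\<bar>s\<bar> * y) * sqrt (3 * R * z)" by simp
      also have "\<dots> \<le> b * sqrt (3 * R * z)" using sb R_nonneg z0 by (intro mult_right_mono) auto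
      finally show ?thesis .
    qed
    \<comment> \<open>The critical balance: x^6 blocks, a phase cost of order x^5, and a
      decorrelation factor x^(-12) from gaps of length x^3.\<close>
    have E2: "real m * (C * (1 + real n * (\<bar>s\<bar> * lip)) / real (Suc q) ^ 4) \<le> 1024 * C * (1 + 32 * b * lip) * z"
    proof -
      have m6: "real m \<le> 1024 * x ^ 6"
      proof -
        have "x ^ 10 = x ^ 6 * x ^ 4" by (simp flip: power_add)
        then have "real m * x ^ 4 \<le> (1024 * x ^ 6) * x ^ 4" using m_le nx by linarith
        moreover have "0 < x ^ 4" using px by simp
        ultimately show ?thesis by (rule mult_right_le_imp_le)
      qed
      have ns: "real n * (\<bar>s\<bar> * lip) \<le> 32 * b * lip * x ^ 5"
      proof -
        have "real n * (\<bar>s\<bar> * lip) = y * (\<bar>s\<bar> * y) * lip" by (simp add: y2[symmetric])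
        also have "\<dots> \<le> (32 * x ^ 5) * b * lip"
          using yx sb y0 b0 lip_nonneg px by (intro mult_right_mono mult_mono) auto
        finally show ?thesis by (simp add: mult_ac)
      qed
      have "1 + real n * (\<bar>s\<bar> * lip) \<le> (1 + 32 * b * lip) * x ^ 5"
        using ns one_le_power[OF x1, of 5] by (simp add: algebra_simps)
      moreover have "x ^ 12 \<le> real (Suc q) ^ 4"
      proof -
        have "(x ^ 3) ^ 4 \<le> real (Suc q) ^ 4" using rq px by (intro power_mono) auto
        then show ?thesis by (simp add: power_mult[symmetric])
      qed
      ultimately have "C * (1 + real n * (\<bar>s\<bar> * lip)) / real (Suc q) ^ 4 \<le> C * ((1 + 32 * b * lip) * x ^ 5) / x ^ 12"
        using C(1) px b0 lip_nonneg by (intro frac_le mult_left_mono) auto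
      then have "real m * (C * (1 + real n * (\<bar>s\<bar> * lip)) / real (Suc q) ^ 4) \<le> (1024 * x ^ 6) * (C * ((1 + 32 * b * lip) * x ^ 5) / x ^ 12)"
        using m6 C(1) lip_nonneg px by (intro mult_mono) auto
      also have "\<dots> = 1024 * C * (1 + 32 * b * lip) * (x ^ 11 / x ^ 12)"
        by (simp add: power_add[symmetric, of x 6 5, simplified] mult_ac)
      also have "x ^ 11 / x ^ 12 = z" using px by (simp add: z_def eval_nat_numeral field_simps)
      finally show ?thesis .
    qed
    have E3: "\<bar>s\<bar> ^ 3 * (M * real p / 3) * (R * real n) \<le> b ^ 3 * M * R / 3 * z"
    proof -
      \<comment> \<open>The block length x^4 is smaller than the square root of \<open>n\<close> by
        a factor \<open>x\<close>, which makes the third-order error negligible.\<close>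
      have pz: "real p \<le> y * z"
      proof -
        have "x ^ 4 = x ^ 5 * z" using zx by (simp add: eval_nat_numeral mult_ac)
        also have "\<dots> \<le> y * z" using xy z0 by (intro mult_right_mono) auto
        finally show ?thesis by (simp add: rp)
      qed
      have "\<bar>s\<bar> ^ 3 * (M * real p / 3) * (R * real n) \<le> \<bar>s\<bar> ^ 3 * (M * (y * z) / 3) * (R * real n)"
        using pz M_nonneg R_nonneg by (intro mult_right_mono mult_left_mono divide_right_mono) auto
      also have "\<dots> = (\<bar>s\<bar> * y) ^ 3 * (M * R / 3 * z)"
        by (simp add: y2[symmetric] power3_eq_cube mult_ac)
      also have "\<dots> \<le> b ^ 3 * (M * R / 3 * z)"
        using sb y0 M_nonneg R_nonneg z0 by (intro mult_right_mono power_mono) auto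
      finally show ?thesis by simp
    qed
    have E4: "s ^ 4 * (R * real p) * (R * real n) / 4 \<le> b ^ 4 * R * R / 4 * z"
    proof -
      have pz: "real p \<le> real n * z"
      proof -
        have "x ^ 4 = x ^ 5 * z" using zx by (simp add: eval_nat_numeral mult_ac)
        also have "\<dots> \<le> real n * z" using power_increasing[of 5 10 x] x1 xn z0 by (intro mult_right_mono) auto
        finally show ?thesis by (simp add: rp)
      qed
      have "s ^ 4 * (R * real p) * (R * real n) / 4 \<le> s ^ 4 * (R * (real n * z)) * (R * real n) / 4"
        using pz R_nonneg by (intro divide_right_mono mult_right_mono mult_left_mono) auto
      also have "\<dots> = (s\<^sup>2 * real n)\<^sup>2 * (R * R / 4 * z)"
        by (simp add: power2_eq_square eval_nat_numeral mult_ac)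
      also have "\<dots> \<le> (b\<^sup>2)\<^sup>2 * (R * R / 4 * z)"
        using s2n R_nonneg z0 by (intro mult_right_mono power_mono) auto
      finally show ?thesis by (simp add: power_mult[symmetric])
    qed
    have E5: "s\<^sup>2 / 2 * (2 * R * real (n - m * p) + real n * rtail q) \<le> 3 * b\<^sup>2 * R * z + b\<^sup>2 / 2 * rtail (w ^ 3)"
    proof -
      have g5: "2 * R * real (n - m * p) \<le> 2 * R * (3 * real n / x)" using gapb R_nonneg by (intro mult_left_mono) auto
      have "s\<^sup>2 / 2 * (2 * R * real (n - m * p) + real n * rtail q) \<le> s\<^sup>2 / 2 * (2 * R * (3 * real n / x) + real n * rtail q)"
        by (rule mult_left_mono[OF add_right_mono[OF g5]]) simp
      also have "3 * real n / x = 3 * real n * z" by (simp add: z_def divide_inverse)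
      also have "s\<^sup>2 / 2 * (2 * R * (3 * real n * z) + real n * rtail q) = (s\<^sup>2 * real n) * (3 * R * z + rtail q / 2)"
        by (simp add: algebra_simps)
      also have "\<dots> \<le> b\<^sup>2 * (3 * R * z + rtail q / 2)"
        using s2n R_nonneg z0 rtail_nonneg[of q] by (intro mult_right_mono) auto
      finally show ?thesis by (simp add: q_def algebra_simps)
    qed
    have "norm (chf \<beta> s {1..n} - of_real (exp (- (s\<^sup>2 * v / 2)))) \<le> g w"
      using C(2)[OF \<beta> mn, of s] E1 E2 E3 E4 E5 unfolding g_def K1_def x_def[symmetric] z_def[symmetric] v_def[symmetric]
      by (simp add: distrib_right)
    then have "norm (chf \<beta> s {1..n} - of_real (exp (- (t\<^sup>2 / 2)))) \<le> g w" by (simp only: s2)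
    then show ?thesis unfolding w_def s_def v_def by simp
  qed
  have glim: "g \<longlonglongrightarrow> 0"
  proof -
    have i: "(\<lambda>w. inverse (real w)) \<longlonglongrightarrow> 0" by (rule lim_inverse_n)
    have "filterlim (\<lambda>w::nat. w ^ 3) at_top sequentially"
    proof (rule filterlim_at_top_mono[OF filterlim_ident])
      show "\<forall>\<^sub>F w :: nat in sequentially. w \<le> w ^ 3"
        using eventually_ge_at_top[of "1::nat"] by eventually_elim (simp add: self_le_power)
    qed
    then have t: "(\<lambda>w. rtail (w ^ 3)) \<longlonglongrightarrow> 0" by (rule filterlim_compose[OF rtail_lim])
    have "(\<lambda>w. b * sqrt (3 * R * inverse (real w)) + K1 * inverse (real w) + b\<^sup>2 / 2 * rtail (w ^ 3)) \<longlonglongrightarrow> b * sqrt (3 * R * 0) + K1 * 0 + b\<^sup>2 / 2 * 0"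
      by (intro tendsto_add tendsto_mult tendsto_const tendsto_real_sqrt i t)
    then show ?thesis by (simp add: g_def[abs_def])
  qed
  have "(\<lambda>n. chf \<beta> (t / sqrt (vr \<beta> {1..n})) {1..n} - of_real (exp (- t\<^sup>2 / 2))) \<longlonglongrightarrow> 0"
  proof (rule Lim_null_comparison)
    show "\<forall>\<^sub>F n in sequentially. norm (chf \<beta> (t / sqrt (vr \<beta> {1..n})) {1..n} - of_real (exp (- t\<^sup>2 / 2))) \<le> g (scl n)"
      using eventually_ge_at_top[of "max N 1"] by eventually_elim (rule main)
    show "(\<lambda>n. g (scl n)) \<longlonglongrightarrow> 0" by (rule filterlim_compose[OF glim scl_at_top])
  qed
  then show ?thesis by (rule LIM_zero_cancel)
qed

end

section \<open>Nonstationary sums on the closed unit interval\<close>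

lemma seqT_unit:
  assumes "\<And>k. 1 \<le> k \<Longrightarrow> 0 < \<beta> k" "x \<in> {0..1}"
  shows "seqT \<beta> n x \<in> {0..1}"
proof (induction n)
  case (Suc n)
  show ?case
  proof (cases "seqT \<beta> n x = 0")
    case True
    then show ?thesis by (simp add: LSV_def)
  next
    case False
    then have "0 < seqT \<beta> n x" "seqT \<beta> n x \<le> 1" using Suc by auto
    then show ?thesis using LSV_in[of "\<beta> (Suc n)" "seqT \<beta> n x"] assms(1)[of "Suc n"] by auto
  qed
qed (use assms in simp)

lemma prob_space_mI: "prob_space mI"
  by (intro prob_spaceI) (simp add: emeasure_restrict_space space_restrict_space)

text \<open>\<open>mI\<close> is complete and contains the point 0, whereas \<open>U\<close> is
  Borel and does not. A Borel representative \<open>g\<close> bridges the completion, and the point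
  0 is a null set.\<close>

lemma integral_mI:
  fixes f g :: "real \<Rightarrow> 'a::{banach, second_countable_topology}"
  assumes g: "g \<in> borel_measurable borel" and fg: "\<And>x. x \<in> {0..1} \<Longrightarrow> f x = g x"
  shows "(\<integral>x. f x \<partial>mI) = (\<integral>x. g x \<partial>U)"
proof -
  have "(\<integral>x. f x \<partial>mI) = (\<integral>x. indicator {0..1} x *\<^sub>R f x \<partial>lebesgue)"
    by (rule integral_restrict_space) simp
  also have "\<dots> = (\<integral>x. indicator {0..1} x *\<^sub>R g x \<partial>lebesgue)"
    by (rule Bochner_Integration.integral_cong) (use fg in \<open>auto split: split_indicator\<close>)
  also have "\<dots> = (\<integral>x. indicator {0..1} x *\<^sub>R g x \<partial>lborel)"
    by (rule integral_completion) (use g in measurable)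
  also have "\<dots> = (\<integral>x. indicator {0<..1} x *\<^sub>R g x \<partial>lborel)"
  proof (rule integral_cong_AE)
    show "AE x in lborel. indicator {0..1} x *\<^sub>R g x = indicator {0<..1} x *\<^sub>R g x"
      using AE_lborel_singleton[of 0] by eventually_elim (auto split: split_indicator)
  qed (use g in measurable)
  also have "\<dots> = (\<integral>x. g x \<partial>U)" by (rule integral_U[symmetric])
  finally show ?thesis .
qed

lemma measurable_mI:
  assumes g: "g \<in> borel_measurable borel" and fg: "\<And>x. x \<in> {0..1} \<Longrightarrow> f x = g x"
  shows "f \<in> borel_measurable mI"
proof -
  have "g \<in> borel_measurable mI"
    by (rule measurable_restrict_space1, rule measurable_completion) (use g in simp)
  then show ?thesis by (rule measurable_cong[THEN iffD2, rotated]) (use fg in \<open>simp add: space_restrict_space\<close>)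
qed

lemma AE_mI_of_U:
  assumes "AE x in U. Q x"
  shows "AE x in mI. Q x"
proof -
  have "AE x in lborel. x \<in> {0<..1} \<longrightarrow> Q x"
    using assms unfolding U_def by (subst (asm) AE_restrict_space_iff) auto
  then have "AE x in lborel. x \<in> {0..1} \<longrightarrow> Q x"
    using AE_lborel_singleton[of 0] by eventually_elim auto
  then have "AE x in lebesgue. x \<in> {0..1} \<longrightarrow> Q x" by (rule AE_completion)
  then show ?thesis by (subst AE_restrict_space_iff) auto
qed

lemma C1_on_unit_lipschitz:
  assumes "C1_on_unit \<phi>"
  shows "\<exists>B l. continuous_on {0..1} \<phi> \<and> 0 \<le> l \<and> (\<forall>x\<in>{0..1}. \<bar>\<phi> x\<bar> \<le> B) \<and>
    (\<forall>x\<in>{0..1}. \<forall>y\<in>{0..1}. \<bar>\<phi> x - \<phi> y\<bar> \<le> l * \<bar>x - y\<bar>)"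
proof -
  obtain \<phi>' where \<phi>': "continuous_on {0..1} \<phi>'" "\<And>x. x \<in> {0..1} \<Longrightarrow> (\<phi> has_real_derivative \<phi>' x) (at x within {0..1})"
    using assms unfolding C1_on_unit_def by blast
  have c: "continuous_on {0..1} \<phi>" using \<phi>'(2) by (rule DERIV_continuous_on)
  have bd: "\<exists>B\<ge>0. \<forall>x\<in>{0..1}. \<bar>f x\<bar> \<le> B" if "continuous_on {0..1::real} f" for f :: "real \<Rightarrow> real"
  proof -
    have "bounded (f ` {0..1})" by (intro compact_imp_bounded compact_continuous_image that) simp
    then obtain B where "\<forall>y\<in>f ` {0..1}. norm y \<le> B" unfolding bounded_iff by blast
    then show ?thesis by (intro exI[of _ "max 0 B"]) (auto simp: le_max_iff_disj)
  qed
  obtain B where B: "\<And>x. x \<in> {0..1} \<Longrightarrow> \<bar>\<phi> x\<bar> \<le> B" using bd[OF c] by blast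
  obtain l where l: "0 \<le> l" "\<And>x. x \<in> {0..1} \<Longrightarrow> \<bar>\<phi>' x\<bar> \<le> l" using bd[OF \<phi>'(1)] by blast
  have "\<bar>\<phi> x - \<phi> y\<bar> \<le> l * \<bar>x - y\<bar>" if "x \<in> {0..1}" "y \<in> {0..1}" for x y
    using field_differentiable_bound[of "{0..1}" \<phi> \<phi>' l x y] \<phi>'(2) l(2) that by simp
  then show ?thesis using c l(1) B by blast
qed

context lsv_obs
begin

lemma Y_borel: "Y \<beta> Q \<in> borel_measurable borel"
  unfolding Y_def by (intro borel_measurable_sum borel_measurable_diff measurable_compose[OF seqT_borel \<phi>_measurable] borel_measurable_const)

lemma Ssum_eq:
  assumes \<beta>: "adm \<beta>" and eq: "\<And>x. x \<in> {0..1} \<Longrightarrow> f x = \<phi> x" and x: "x \<in> {0..1}"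
  shows "Ssum f \<beta> n x = Y \<beta> {1..n} x"
proof -
  have pos: "0 < \<beta> k" if "1 \<le> k" for k using \<beta> that by (simp add: adm_def)
  have m: "(\<integral>y. f (seqT \<beta> k y) \<partial>mI) = mean \<beta> k" for k
    unfolding mean_def
    by (rule integral_mI[OF measurable_compose[OF seqT_borel \<phi>_measurable]]) (rule eq[OF seqT_unit[OF pos]])
  show ?thesis unfolding Ssum_def Y_def m
    using eq[OF seqT_unit[OF pos x]] by simp
qed

lemma sigma2_eq:
  assumes "adm \<beta>" "\<And>x. x \<in> {0..1} \<Longrightarrow> f x = \<phi> x"
  shows "sigma2 f \<beta> n = vr \<beta> {1..n}"
  unfolding sigma2_def vr_def
  by (rule integral_mI) (use Ssum_eq[OF assms] Y_borel in auto)

text \<open>By Levy's theorem it suffices to rewrite the characteristic functions as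
  \<open>chf\<close>. For small \<open>n\<close> with zero variance, division by 0 gives 0 on both
  sides, so the rewriting holds for every \<open>n\<close>.\<close>

lemma clt:
  assumes \<beta>: "adm \<beta>" and eq: "\<And>x. x \<in> {0..1} \<Longrightarrow> f x = \<phi> x"
    and c: "0 < c" and grow: "\<And>n. N \<le> n \<Longrightarrow> c * real n \<le> vr \<beta> {1..n}"
  shows "weak_conv_m (\<lambda>n. distr mI borel (\<lambda>x. Ssum f \<beta> n x / sqrt (sigma2 f \<beta> n))) std_normal_distribution"
proof (rule levy_continuity)
  let ?Z = "\<lambda>n x. Ssum f \<beta> n x / sqrt (sigma2 f \<beta> n)"
  let ?W = "\<lambda>n x. Y \<beta> {1..n} x / sqrt (vr \<beta> {1..n})"
  have ZW: "?Z n x = ?W n x" if "x \<in> {0..1}" for n x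
    using Ssum_eq[OF \<beta> eq that] sigma2_eq[OF \<beta> eq] by simp
  have Wm: "?W n \<in> borel_measurable borel" for n using Y_borel by measurable
  have Zm: "?Z n \<in> borel_measurable mI" for n by (rule measurable_mI[OF Wm ZW])
  show "real_distribution (distr mI borel (?Z n))" for n
    by (rule prob_space.real_distribution_distr[OF prob_space_mI Zm])
  show "real_distribution std_normal_distribution" by (rule real_dist_normal_dist)
  fix t
  have "char (distr mI borel (?Z n)) t = chf \<beta> (t / sqrt (vr \<beta> {1..n})) {1..n}" for n
  proof -
    have im: "(\<lambda>x. iexp (t * x)) \<in> borel_measurable borel" by measurable
    have "char (distr mI borel (?Z n)) t = (\<integral>x. iexp (t * ?Z n x) \<partial>mI)"
      unfolding char_def by (rule integral_distr[OF Zm im])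
    also have "\<dots> = (\<integral>x. cis (t / sqrt (vr \<beta> {1..n}) * Y \<beta> {1..n} x) \<partial>U)"
    proof (rule integral_mI)
      show "(\<lambda>x. cis (t / sqrt (vr \<beta> {1..n}) * Y \<beta> {1..n} x)) \<in> borel_measurable borel"
      proof -
        have ym: "(\<lambda>x. t / sqrt (vr \<beta> {1..n}) * Y \<beta> {1..n} x) \<in> borel_measurable borel"
          by (intro borel_measurable_times borel_measurable_const Y_borel)
        have cm: "cis \<in> borel_measurable borel" by (intro borel_measurable_continuous_onI continuous_intros)
        show ?thesis by (rule measurable_compose[OF ym cm])
      qed
      fix x :: real assume "x \<in> {0..1}"
      then show "iexp (t * ?Z n x) = cis (t / sqrt (vr \<beta> {1..n}) * Y \<beta> {1..n} x)"
        using ZW by (simp add: cis_conv_exp)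
    qed
    finally show ?thesis by (simp add: chf_def)
  qed
  moreover have lim: "(\<lambda>n. chf \<beta> (t / sqrt (vr \<beta> {1..n})) {1..n}) \<longlonglongrightarrow> of_real (exp (- t\<^sup>2 / 2))"
    by (rule chf_tendsto[OF \<beta> c grow])
  moreover have "char std_normal_distribution t = of_real (exp (- t\<^sup>2 / 2))"
    by (simp add: char_std_normal_distribution)
  ultimately show "(\<lambda>n. char (distr mI borel (?Z n)) t) \<longlonglongrightarrow> char std_normal_distribution t"
    using lim by simp
qed

end

theorem mainTheorem13:
  fixes \<beta>bar :: real and \<phi> :: "real \<Rightarrow> real"
  assumes "0 < \<beta>bar" "\<beta>bar < 1/9"
    and "C1_on_unit \<phi>"
    and "\<not> coboundary_const (LSV \<beta>bar) \<phi>"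
  shows "\<exists>\<epsilon>>0. \<epsilon> < \<beta>bar \<and> \<beta>bar + \<epsilon> < 1/9 \<and>
    (\<forall>\<beta> :: nat \<Rightarrow> real. (\<forall>k\<ge>1. \<beta> k \<in> {\<beta>bar - \<epsilon> <..< \<beta>bar + \<epsilon>}) \<longrightarrow>
      (\<exists>C>0. \<exists>N. \<forall>n\<ge>N. sigma2 \<phi> \<beta> n \<ge> C * real n) \<and>
      weak_conv_m (\<lambda>n. distr mI borel (\<lambda>x. Ssum \<phi> \<beta> n x / sqrt (sigma2 \<phi> \<beta> n)))
                  (density lborel std_normal_density))"
proof -
  obtain M l where \<phi>: "continuous_on {0..1} \<phi>" "0 \<le> l" "\<And>x. x \<in> {0..1} \<Longrightarrow> \<bar>\<phi> x\<bar> \<le> M"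
    "\<And>x y. x \<in> {0..1} \<Longrightarrow> y \<in> {0..1} \<Longrightarrow> \<bar>\<phi> x - \<phi> y\<bar> \<le> l * \<bar>x - y\<bar>"
    using C1_on_unit_lipschitz[OF assms(3)] by blast
  \<comment> \<open>Composition with the retraction onto the unit interval makes the observable
    bounded and continuous on the whole line.\<close>
  define f where "f x = \<phi> (max 0 (min 1 x))" for x
  have f_eq: "\<phi> x = f x" if "x \<in> {0..1}" for x using that by (simp add: f_def)
  \<comment> \<open>The midpoint leaves room above the given exponent for the perturbation and stays
    strictly below the critical value.\<close>
  define al where "al = (\<beta>bar + 1/9) / 2"
  have al_bounds: "\<beta>bar < al" "al < 1/9" using assms(2) by (auto simp: al_def)
  interpret lsv_stat al f M l \<beta>bar
  proof unfold_locales
    have "continuous_on UNIV (\<lambda>x::real. max 0 (min 1 x))" by (intro continuous_intros)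
    then have "continuous_on UNIV f"
      unfolding f_def by (rule continuous_on_compose2[OF \<phi>(1)]) auto
    then show "f \<in> borel_measurable borel" by (rule borel_measurable_continuous_onI)
    show "\<bar>f x\<bar> \<le> M" for x unfolding f_def by (rule \<phi>(3)) auto
    show "\<bar>f x - f y\<bar> \<le> l * (y - x)" if "0 < x" "x \<le> y" "y \<le> 1" for x y
      using \<phi>(4)[of x y] that by (simp add: f_def)
  qed (use assms al_bounds \<phi>(2) in auto)
  obtain h c C where "0 < c" "0 < C" "integrable U h" "\<forall>x. c \<le> h x" "(\<lambda>n. \<integral>x. \<bar>P n (\<lambda>_. 1) x - h x\<bar> \<partial>U) \<longlonglongrightarrow> 0"
    "\<forall>f n. K 12 f \<longrightarrow> (\<integral>x. f x \<partial>U) = 1 \<longrightarrow> (\<integral>x. \<bar>P n f x - h x\<bar> \<partial>U) \<le> C / real (Suc n) ^ 4"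
    using stationary_density_exists by blast
  then interpret lsv_inv al f M l \<beta>bar h c C
    by unfold_locales auto
  have "Vlim \<noteq> 0"
  proof
    assume "Vlim = 0"
    then obtain u b where u: "u \<in> borel_measurable U" "AE x in U. f x = b + u (LSV \<beta>bar x) - u x"
      using variance_zero_imp_coboundary by blast
    \<comment> \<open>Extended by 0 to a Borel function on the line. The map preserves the half-open
      interval, so the cohomological equation is unaffected.\<close>
    define u' where "u' x = indicator {0<..1} x * u x" for x
    have u': "u' \<in> borel_measurable borel"
      using u(1) unfolding U_eq_restrict_borel u'_def by (subst (asm) borel_measurable_restrict_space_iff) auto
    have "AE x in U. \<phi> x = b + u' (LSV \<beta>bar x) - u' x"
      using u(2) AE_space
    proof eventually_elim
      case (elim x)
      then have x: "0 < x" "x \<le> 1" by auto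
      then show ?case using elim(1) LSV_in[OF assms(1) x] f_eq[of x] by (simp add: u'_def)
    qed
    then have "AE x in mI. \<phi> x = b + u' (LSV \<beta>bar x) - u' x" by (rule AE_mI_of_U)
    moreover have "u' \<in> borel_measurable mI" by (rule measurable_mI[OF u']) simp
    ultimately show False using assms(4) unfolding coboundary_const_def by blast
  qed
  then have V: "0 < Vlim" using V_nonneg by simp
  obtain \<epsilon>0 where \<epsilon>0: "0 < \<epsilon>0" "\<And>\<beta>. adm \<beta> \<Longrightarrow> (\<forall>j\<ge>1. \<bar>\<beta> j - \<beta>bar\<bar> < \<epsilon>0) \<Longrightarrow>
    \<exists>N. \<forall>n\<ge>N. Vlim / 2 * real n \<le> (\<Sum>i=1..n. \<Sum>j=1..n. cov \<beta> i j)"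
    using variance_growth[OF V] by blast
  \<comment> \<open>The three constraints ensure linear variance growth, positive exponents and
    exponents at most \<open>al\<close>.\<close>
  define \<epsilon> where "\<epsilon> = min \<epsilon>0 (min (\<beta>bar / 2) (al - \<beta>bar))"
  have \<epsilon>: "0 < \<epsilon>" "\<epsilon> \<le> \<epsilon>0" "\<epsilon> < \<beta>bar" "\<beta>bar + \<epsilon> \<le> al"
    using \<epsilon>0(1) assms(1) al_bounds by (auto simp: \<epsilon>_def min_def)
  show ?thesis
  proof (rule exI[of _ \<epsilon>], intro conjI allI impI)
    fix \<beta> :: "nat \<Rightarrow> real" assume b: "\<forall>k\<ge>1. \<beta> k \<in> {\<beta>bar - \<epsilon> <..< \<beta>bar + \<epsilon>}"
    have \<beta>: "adm \<beta>" unfolding adm_def using b \<epsilon> by fastforce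
    have near: "\<forall>j\<ge>1. \<bar>\<beta> j - \<beta>bar\<bar> < \<epsilon>0"
    proof (intro allI impI)
      fix j :: nat assume "1 \<le> j"
      then have "\<beta>bar - \<epsilon> < \<beta> j" "\<beta> j < \<beta>bar + \<epsilon>" using b by auto
      then show "\<bar>\<beta> j - \<beta>bar\<bar> < \<epsilon>0" using \<epsilon>(2) by linarith
    qed
    obtain N where N: "\<And>n. N \<le> n \<Longrightarrow> Vlim / 2 * real n \<le> vr \<beta> {1..n}"
      using \<epsilon>0(2)[OF \<beta> near] unfolding vr_eq[OF \<beta>] by blast
    have sigma2: "sigma2 \<phi> \<beta> n = vr \<beta> {1..n}" for n by (rule sigma2_eq[OF \<beta> f_eq])
    have "Vlim / 2 * real n \<le> sigma2 \<phi> \<beta> n" if "N \<le> n" for n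
      unfolding sigma2 by (rule N[OF that])
    then show "\<exists>C>0. \<exists>N. \<forall>n\<ge>N. sigma2 \<phi> \<beta> n \<ge> C * real n"
      using half_gt_zero[OF V] by blast
    show "weak_conv_m (\<lambda>n. distr mI borel (\<lambda>x. Ssum \<phi> \<beta> n x / sqrt (sigma2 \<phi> \<beta> n))) (density lborel std_normal_density)"
      by (rule clt[OF \<beta> f_eq half_gt_zero[OF V] N])
  qed (use \<epsilon> al_bounds in auto)
qed

end
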